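(* Let $k,n\ge1$ be integers, let $\omega:[0,\infty)\to[0,\infty)$ be a continuous, concave, strictly increasing function with $\omega(0)=0$, and let $\ell\ge0$ be an integer. Let $S\subset\mathbb R^n$ be a finite set and let $\mathcal G(x)=(G(x),x):=\{(P,x):P\in G(x)\}$, $x\in S$, be a set-valued mapping such that for each $x\in S$ the set $G(x)\subset\mathcal P_k$ is a convex set of polynomials of dimension at most $\ell$. Suppose that there exists a constant $K>0$ such that, for every subset $S'\subset S$ consisting of at most $2^{\min\{\ell+1,\,\dim\mathcal P_k\}}$ points, the restriction $\mathcal G|_{S'}$ has a Lipschitz selection $g_{S'}\in\operatorname{Lip}(S'_\omega,\mathcal T_{k,n})$ with $\|g_{S'}\|_{LO(S')}\le K$. Then $\mathcal G$ has, on all of $S$, a Lipschitz selection $g\in\operatorname{Lip}(S_\omega,\mathcal T_{k,n})$ with $\|g\|_{LO(S)}\le\gamma K$, where the constant $\gamma$ depends only on $k$, $n$ and $\operatorname{card}S$.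
   Context: $\|\cdot\|$ on $\mathbb R^n$ is the Euclidean norm; $\mathcal P_k$ is the space of real polynomials on $\mathbb R^n$ of degree at most $k$. The dimension of a convex set is the dimension of its affine hull. For a multi-index $\alpha$ with $|\alpha|<k$ let $\psi_\alpha:[0,\infty)\to[0,\infty)$ be the inverse of the strictly increasing function $s\mapsto s^{k-|\alpha|}\omega(s)$ and put $\varphi_\alpha:=\omega\circ\psi_\alpha$; for $|\alpha|=k$ put $\varphi_\alpha(t):=t$. For $T_0=(P_0,x_0)$, $T_1=(P_1,x_1)$ in $\mathcal P_k\times\mathbb R^n$ let $$\delta_\omega(T_0,T_1):=\max_{|\alpha|\le k}\{\omega(\|x_0-x_1\|),\ \varphi_\alpha(|D^\alpha(P_0-P_1)(x_0)|),\ \varphi_\alpha(|D^\alpha(P_0-P_1)(x_1)|)\},$$ and let $d_\omega(T,T'):=\inf\sum_{i=0}^{m-1}\delta_\omega(T_i,T_{i+1})$, the infimum being over all finite families $\{T_0,\dots,T_m\}\subset\mathcal P_k\times\mathbb R^n$ with $T_0=T$, $T_m=T'$. For $\lambda\in\mathbb R$ and $T=(P,x)$ put $\lambda\circ T:=(\lambda P,x)$. $\mathcal T_{k,n}:=(\mathcal P_k\times\mathbb R^n,d_\omega)$; for a set $S\subset\mathbb R^n$, $S_\omega$ is $S$ with the metric $\omega(\|x-y\|)$; $\operatorname{Lip}(S_\omega,\mathcal T_{k,n})$ is the set of Lipschitz mappings $S_\omega\to\mathcal T_{k,n}$. For $g:S\to\mathcal P_k\times\mathbb R^n$, $$\|g\|_{LO(S)}:=\inf\{\lambda>0:\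 d_\omega(\lambda^{-1}\circ g(x),\lambda^{-1}\circ g(y))\le\omega(\|x-y\|)\ \text{for all }x,y\in S\}.$$ A selection of $\mathcal G$ is a mapping $g$ with $g(x)\in\mathcal G(x)$ for all $x$ in its domain, i.e. $g(x)=(P_x,x)$ with $P_x\in G(x)$; it is a Lipschitz selection if it is a Lipschitz mapping. *)

theory Defs
  imports "HOL-Analysis.Analysis" "HOL-Library.Function_Algebras"
begin

text \<open>
  Polynomials on \<open>R^n\<close> are treated as functions of type \<open>real ^ 'n \<Rightarrow> real\<close>; the pointwise
  vector space structure below makes \<^const>\<open>convex\<close>, \<^const>\<open>hull\<close> and \<open>dim\<close> applicable to them.
\<close>

instantiation "fun" :: (type, real_vector) real_vector
begin

definition scaleR_fun :: "real \<Rightarrow> ('a \<Rightarrow> 'b) \<Rightarrow> 'a \<Rightarrow> 'b"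
  where "scaleR_fun c f = (\<lambda>x. c *\<^sub>R f x)"

instance
  by standard (simp_all add: scaleR_fun_def fun_eq_iff scaleR_add_left scaleR_add_right)

end

text \<open>
  The dimension of the affine hull, i.e. of its direction space; \<^const>\<open>aff_dim\<close> is restricted to
  Euclidean spaces. As \<open>dim\<close> is \<open>0\<close> on infinite-dimensional spaces, this is meaningful only
  inside a finite-dimensional space.
\<close>

definition affine_dim :: "'a::real_vector set \<Rightarrow> nat"
  where "affine_dim A = dim {p - q | p q. p \<in> affine hull A \<and> q \<in> affine hull A}"

lemma affine_dim_eq_aff_dim:
  fixes A :: "'a::euclidean_space set"
  assumes "A \<noteq> {}"
  shows "int (affine_dim A) = aff_dim A"
proof -
  obtain a where a: "a \<in> affine hull A"
    using assms by (metis ex_in_conv hull_inc)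
  have "p - q \<in> {x - a |x. x \<in> affine hull A}"
    if "p \<in> affine hull A" "q \<in> affine hull A" for p q
  proof -
    have "a + 1 *\<^sub>R (p - q) \<in> affine hull A"
      using mem_affine_3_minus [OF affine_affine_hull a that] .
    then show ?thesis by force
  qed
  then have "{p - q | p q. p \<in> affine hull A \<and> q \<in> affine hull A} = {x - a |x. x \<in> affine hull A}"
    using a by blast
  moreover have "aff_dim (affine hull A) = int (dim {x - a |x. x \<in> affine hull A})"
    using aff_dim_dim_affine_diffs [OF affine_affine_hull a] by (simp add: Setcompr_eq_image)
  ultimately show ?thesis
    by (simp add: affine_dim_def)
qed

definition mi_order :: "('n::finite \<Rightarrow> nat) \<Rightarrow> nat"
  where "mi_order \<alpha> = (\<Sum>i\<in>UNIV. \<alpha> i)"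

definition monomial_fun :: "('n::finite \<Rightarrow> nat) \<Rightarrow> real ^ 'n \<Rightarrow> real"
  where "monomial_fun \<alpha> x = (\<Prod>i\<in>UNIV. (x $ i) ^ \<alpha> i)"

definition polys :: "nat \<Rightarrow> (real ^ 'n::finite \<Rightarrow> real) set"
  where "polys k = {p. \<exists>c. p = (\<lambda>x. \<Sum>\<alpha> | mi_order \<alpha> \<le> k. c \<alpha> * monomial_fun \<alpha> x)}"

definition partial_deriv :: "'n::finite \<Rightarrow> (real ^ 'n \<Rightarrow> real) \<Rightarrow> real ^ 'n \<Rightarrow> real"
  where "partial_deriv i f x = deriv (\<lambda>t. f (x + t *\<^sub>R axis i 1)) 0"

text \<open>
  The mixed derivative \<open>D^\<alpha>\<close> differentiates once for each entry of a list in which every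
  coordinate \<open>i\<close> occurs \<open>\<alpha> i\<close> times. On polynomials the order of differentiation is
  immaterial, see \<open>mi_deriv_eq\<close> below.
\<close>

definition mi_deriv :: "('n::finite \<Rightarrow> nat) \<Rightarrow> (real ^ 'n \<Rightarrow> real) \<Rightarrow> real ^ 'n \<Rightarrow> real"
  where "mi_deriv \<alpha> f = foldr partial_deriv (SOME is. \<forall>i. count_list is i = \<alpha> i) f"

lemma finite_mi_order_le: "finite {\<alpha> :: 'n::finite \<Rightarrow> nat. mi_order \<alpha> \<le> k}"
proof (rule finite_subset)
  have "\<alpha> i \<le> mi_order \<alpha>" for \<alpha> :: "'n \<Rightarrow> nat" and i
    unfolding mi_order_def by (rule member_le_sum) auto
  then show "{\<alpha> :: 'n \<Rightarrow> nat. mi_order \<alpha> \<le> k} \<subseteq> UNIV \<rightarrow>\<^sub>E {..k}"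
    by (auto simp: PiE_UNIV_domain intro: order_trans)
  show "finite (UNIV \<rightarrow>\<^sub>E {..k} :: ('n \<Rightarrow> nat) set)"
    by (intro finite_PiE) auto
qed

lemma monomial_fun_split:
  "monomial_fun \<alpha> x = (x $ i) ^ \<alpha> i * (\<Prod>j\<in>UNIV - {i}. (x $ j) ^ \<alpha> j)"
  unfolding monomial_fun_def by (subst prod.remove [of _ i]) auto

lemma monomial_fun_line_deriv:
  "((\<lambda>t. monomial_fun \<alpha> (x + t *\<^sub>R axis i 1)) has_field_derivative
     real (\<alpha> i) * monomial_fun (\<alpha>(i := \<alpha> i - 1)) x) (at 0)"
proof -
  have "monomial_fun \<alpha> (x + t *\<^sub>R axis i 1) = (x $ i + t) ^ \<alpha> i * (\<Prod>j\<in>UNIV - {i}. (x $ j) ^ \<alpha> j)"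
    for t
    by (auto simp: monomial_fun_split [of _ _ i] axis_def)
  then have "(\<lambda>t. monomial_fun \<alpha> (x + t *\<^sub>R axis i 1)) =
      (\<lambda>t. (x $ i + t) ^ \<alpha> i * (\<Prod>j\<in>UNIV - {i}. (x $ j) ^ \<alpha> j))"
    by (rule ext)
  then show ?thesis
    by (auto simp: monomial_fun_split [of _ _ i] intro!: derivative_eq_intros)
qed

lemma partial_deriv_msum:
  fixes e :: "('n::finite \<Rightarrow> nat) \<Rightarrow> 'n \<Rightarrow> nat"
  shows "partial_deriv i (\<lambda>x. \<Sum>\<alpha>\<in>A. c \<alpha> * monomial_fun (e \<alpha>) x) =
    (\<lambda>x. \<Sum>\<alpha>\<in>A. (c \<alpha> * real (e \<alpha> i)) * monomial_fun ((e \<alpha>)(i := e \<alpha> i - 1)) x)"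
  unfolding partial_deriv_def mult.assoc
  by (intro ext DERIV_imp_deriv DERIV_sum DERIV_cmult monomial_fun_line_deriv)

lemma foldr_partial_deriv_msum:
  "foldr partial_deriv is (\<lambda>x. \<Sum>\<alpha>\<in>A. c \<alpha> * monomial_fun \<alpha> x) =
    (\<lambda>x. \<Sum>\<alpha>\<in>A. (c \<alpha> * (\<Prod>i\<in>UNIV. \<Prod>r<count_list is i. real (\<alpha> i - r))) *
      monomial_fun (\<lambda>i. \<alpha> i - count_list is i) x)"
proof (induction "is")
  case Nil
  show ?case by simp
next
  case (Cons j "is")
  have 1: "(\<Prod>i\<in>UNIV. \<Prod>r<count_list (j # is) i. real (\<alpha> i - r)) =
      (\<Prod>i\<in>UNIV. \<Prod>r<count_list is i. real (\<alpha> i - r)) * real (\<alpha> j - count_list is j)"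
    for \<alpha> :: "'a \<Rightarrow> nat"
  proof -
    have "(\<Prod>i\<in>UNIV. \<Prod>r<count_list (j # is) i. real (\<alpha> i - r)) =
      (\<Prod>i\<in>UNIV. (\<Prod>r<count_list is i. real (\<alpha> i - r)) *
         (if i = j then real (\<alpha> j - count_list is j) else 1))"
      by (intro prod.cong) auto
    then show ?thesis
      by (simp add: prod.distrib)
  qed
  have 2: "(\<lambda>i. \<alpha> i - count_list is i)(j := \<alpha> j - count_list is j - 1) =
      (\<lambda>i. \<alpha> i - count_list (j # is) i)" for \<alpha> :: "'a \<Rightarrow> nat"
    by auto
  show ?case
    unfolding foldr.simps comp_def Cons.IH partial_deriv_msum 1 2 by (simp only: mult.assoc)
qed

lemma mi_deriv_eq:
  assumes "p \<in> polys k" and "\<And>i. count_list is i = \<alpha> i"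
  shows "mi_deriv \<alpha> p = foldr partial_deriv is p"
proof -
  have "\<forall>i. count_list (SOME is. \<forall>i. count_list is i = \<alpha> i) i = \<alpha> i"
    by (rule someI [of _ "is"]) (use assms in auto)
  moreover obtain c where "p = (\<lambda>x. \<Sum>\<alpha> | mi_order \<alpha> \<le> k. c \<alpha> * monomial_fun \<alpha> x)"
    using assms(1) by (auto simp: polys_def)
  ultimately show ?thesis
    by (simp add: mi_deriv_def foldr_partial_deriv_msum assms(2))
qed

text \<open>\<open>\<phi>\<^sub>\<alpha>\<close>, with \<open>\<psi>\<^sub>\<alpha>\<close> the inverse of \<open>s \<mapsto> s^(k - |\<alpha>|) * \<omega> s\<close> on \<open>[0, \<infinity>)\<close>.\<close>

definition psi :: "nat \<Rightarrow> (real \<Rightarrow> real) \<Rightarrow> ('n::finite \<Rightarrow> nat) \<Rightarrow> real \<Rightarrow> real"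
  where "psi k \<omega> \<alpha> = inv_into {0..} (\<lambda>s. s ^ (k - mi_order \<alpha>) * \<omega> s)"

definition phi :: "nat \<Rightarrow> (real \<Rightarrow> real) \<Rightarrow> ('n::finite \<Rightarrow> nat) \<Rightarrow> real \<Rightarrow> real"
  where "phi k \<omega> \<alpha> t = (if mi_order \<alpha> < k then \<omega> (psi k \<omega> \<alpha> t) else t)"

type_synonym 'n jet = "(real ^ 'n \<Rightarrow> real) \<times> (real ^ 'n)"

definition jets :: "nat \<Rightarrow> 'n::finite jet set"
  where "jets k = polys k \<times> UNIV"

definition jet_delta :: "nat \<Rightarrow> (real \<Rightarrow> real) \<Rightarrow> 'n::finite jet \<Rightarrow> 'n jet \<Rightarrow> real"
  where "jet_delta k \<omega> = (\<lambda>(P0, x0) (P1, x1).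
    Max (\<Union>\<alpha> \<in> {\<alpha>. mi_order \<alpha> \<le> k}.
      {\<omega> (norm (x0 - x1)),
       phi k \<omega> \<alpha> \<bar>mi_deriv \<alpha> (P0 - P1) x0\<bar>,
       phi k \<omega> \<alpha> \<bar>mi_deriv \<alpha> (P0 - P1) x1\<bar>}))"

definition jet_dist :: "nat \<Rightarrow> (real \<Rightarrow> real) \<Rightarrow> 'n::finite jet \<Rightarrow> 'n jet \<Rightarrow> real"
  where "jet_dist k \<omega> T T' =
    Inf {\<Sum>i<m. jet_delta k \<omega> (C i) (C (Suc i)) | m C.
      (\<forall>i\<le>m. C i \<in> jets k) \<and> C 0 = T \<and> C m = T'}"

text \<open>Only the polynomial component is scaled, unlike with \<open>*\<^sub>R\<close> on pairs.\<close>

definition jet_scale :: "real \<Rightarrow> 'n::finite jet \<Rightarrow> 'n jet"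
  where "jet_scale c = (\<lambda>(P, x). (c *\<^sub>R P, x))"

text \<open>
  The Lipschitz maps from \<open>S\<close> with the metric \<open>\<omega> (norm (x - y))\<close> to \<open>jets k\<close> with the metric
  \<open>jet_dist k \<omega>\<close>; this is \<^const>\<open>Lipschitz_continuous_map\<close> written out for these two metrics.
\<close>

definition jet_Lip :: "nat \<Rightarrow> (real \<Rightarrow> real) \<Rightarrow> (real ^ 'n) set \<Rightarrow> (real ^ 'n::finite \<Rightarrow> 'n jet) set"
  where "jet_Lip k \<omega> S = {g. g \<in> S \<rightarrow> jets k \<and>
    (\<exists>B. \<forall>x\<in>S. \<forall>y\<in>S. jet_dist k \<omega> (g x) (g y) \<le> B * \<omega> (norm (x - y)))}"

text \<open>Extended-real valued, so that the infimum of the empty set is \<open>\<infinity>\<close>.\<close>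

definition LO_norm ::
    "nat \<Rightarrow> (real \<Rightarrow> real) \<Rightarrow> (real ^ 'n) set \<Rightarrow> (real ^ 'n::finite \<Rightarrow> 'n jet) \<Rightarrow> ereal"
  where "LO_norm k \<omega> S g = Inf {ereal c | c. c > 0 \<and>
    (\<forall>x\<in>S. \<forall>y\<in>S.
      jet_dist k \<omega> (jet_scale (inverse c) (g x)) (jet_scale (inverse c) (g y)) \<le> \<omega> (norm (x - y)))}"

definition jet_map :: "(real ^ 'n \<Rightarrow> (real ^ 'n \<Rightarrow> real) set) \<Rightarrow> real ^ 'n::finite \<Rightarrow> 'n jet set"
  where "jet_map G x = {(P, x) | P. P \<in> G x}"

definition selection_on :: "'a set \<Rightarrow> ('a \<Rightarrow> 'b set) \<Rightarrow> ('a \<Rightarrow> 'b) \<Rightarrow> bool"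
  where "selection_on S F g \<longleftrightarrow> (\<forall>x\<in>S. g x \<in> F x)"

end

theory Submission
  imports Defs
begin

text \<open>
  Up to constants, \<open>d\<^sub>\<omega>\<close>-Lipschitz jets are characterised by
  \<open>|D\<^sup>\<alpha> (P\<^sub>x - P\<^sub>y) (x)| \<le> \<lambda> * r ^ (k - |\<alpha>|) * \<omega> r\<close> with \<open>r = |x - y|\<close>, i.e. \<open>P\<^sub>x - P\<^sub>y\<close> lies in
  \<open>\<lambda>\<close> times a symmetric convex body. Splitting \<open>S\<close> repeatedly at gaps comparable with the
  diameter produces a binary tree with a body at every node, decreasing towards the leaves, such
  that the constraint between \<open>x\<close> and \<open>y\<close> is given by the body at the node separating them.

  If there is no selection with constant \<open>\<lambda>\<close>, then separating two convex sets gives affine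
  functionals \<open>\<phi>\<^sub>x \<ge> 0\<close> on \<open>G x\<close> with sum \<open>-1\<close> whose sum over each cluster is bounded by \<open>1/\<lambda>\<close> on
  the body of the parent node. The functionals vanishing on \<open>G x\<close> together with \<open>\<phi>\<^sub>x\<close> span a
  space of codimension at most \<open>c = min (l + 1) (dim (polys k))\<close>, so any \<open>c + 1\<close> functionals have a
  combination in it. Going up the tree, two such relations are combined so as to eliminate the
  cluster sum; this doubles the number of points and uses up one of the \<open>c + 1\<close> functionals, so
  that a comparable certificate supported on \<open>2 ^ c\<close> points results, contradicting the
  hypothesis on small subsets.
\<close>

section \<open>Separation and linear dependence in finite dimension\<close>

text \<open>The sets \<open>G x\<close> need be neither closed nor bounded, so separation is used in
  its weak form. The real obstacle is quantitative: elimination by plain linear algebra may leave a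
  combination with tiny coefficients, and dividing by them would destroy every bound. Coefficient
  vectors are therefore kept at maximum norm 1, and of three ways to eliminate a cluster sum at
  least one leaves a vector of norm 1/3 or more (\<open>normalized_trichotomy\<close>). Apart from
  linearity of the tests, only the nesting of the bodies enters there, so the losses are counted by
  nodes of the tree and do not see the geometry of \<open>S\<close>. Read downwards, the count
  \<open>2 ^ c\<close> arises as follows: at the root the only functional allowed in the total is
  the constant -1, a splitting at the price of a doubling adds one cluster sum, and once
  \<open>c + 1\<close> functionals are present a single leaf suffices. The minimum in
  \<open>c\<close> has two sources: the functionals vanishing on \<open>G x\<close> have codimension
  at most \<open>l + 1\<close>, and any nonzero space of affine functionals has codimension at most
  \<open>dim (polys k)\<close>.\<close>

lemma separation_finite_dim:
  fixes A :: "('i \<Rightarrow> real) set"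
  assumes "finite I" "convex A" "A \<noteq> {}" "\<And>a. a \<in> A \<Longrightarrow> \<exists>i\<in>I. a i \<noteq> 0"
  shows "\<exists>c. (\<exists>i\<in>I. c i \<noteq> 0) \<and> (\<forall>a\<in>A. (\<Sum>i\<in>I. c i * a i) \<ge> 0)"
  using assms
proof (induction I arbitrary: A)
  case empty
  then show ?case by blast
next
  \<comment> \<open>Hahn-Banach one coordinate at a time: the slice of \<open>A\<close> on the
    hyperplane \<open>a d = 0\<close> has a functional by induction, and a coefficient for
    \<open>d\<close> extends it to \<open>A\<close>. If \<open>a d\<close> keeps one sign on
    \<open>A\<close>, the coordinate \<open>d\<close> alone separates. As \<open>A\<close> need not
    be closed, strict inequality cannot be expected.\<close>
  case (insert d I)
  have comb: "(\<lambda>i. s * a i + t * b i) \<in> A" if "a \<in> A" "b \<in> A" "s \<ge> 0" "t \<ge> 0" "s + t = 1" for a b s t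
  proof -
    have "s *\<^sub>R a + t *\<^sub>R b \<in> A"
      using insert.prems(1) that by (auto simp: convex_def)
    then show ?thesis by (simp add: scaleR_fun_def plus_fun_def)
  qed
  \<comment> \<open>The point where the segment from \<open>a\<close> to \<open>b\<close> crosses
    the hyperplane on which coordinate \<open>d\<close> vanishes.\<close>
  define mix where "mix a b = (\<lambda>i. (- b d) / (a d - b d) * a i + a d / (a d - b d) * b i)" for a b :: "'i \<Rightarrow> real"
  have mix: "mix a b \<in> A" "mix a b d = 0" if "a \<in> A" "b \<in> A" "a d > 0" "b d < 0" for a b
  proof -
    show "mix a b \<in> A" unfolding mix_def
    proof (rule comb)
      show "- b d / (a d - b d) + a d / (a d - b d) = 1"
        using that by (simp add: add_divide_distrib[symmetric] diff_divide_distrib[symmetric])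
    qed (use that in \<open>auto simp: divide_nonpos_pos\<close>)
    show "mix a b d = 0" using that by (simp add: mix_def field_simps)
  qed
  have unit: ?case if s: "s \<noteq> 0" "\<forall>a\<in>A. s * a d \<ge> 0" for s
  proof (rule exI[of _ "\<lambda>i. if i = d then s else 0"], intro conjI ballI)
    fix a assume "a \<in> A"
    have "(\<Sum>i\<in>I. (if i = d then s else 0) * a i) = 0"
      using insert.hyps by (intro sum.neutral) auto
    then show "(\<Sum>i\<in>insert d I. (if i = d then s else 0) * a i) \<ge> 0"
      using insert.hyps s(2) \<open>a \<in> A\<close> by simp
  qed (use s in auto)
  show ?case
  proof (cases "(\<exists>a\<in>A. a d > 0) \<and> (\<exists>a\<in>A. a d < 0)")
    case False
    then have "(\<forall>a\<in>A. (-1) * a d \<ge> 0) \<or> (\<forall>a\<in>A. 1 * a d \<ge> 0)" by (auto simp: not_less)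
    then show ?thesis using unit[of 1] unit[of "-1"] by fastforce
  next
    case True
    then obtain p n where pn: "p \<in> A" "p d > 0" "n \<in> A" "n d < 0" by blast
    define A0 where "A0 = A \<inter> {a. a d = 0}"
    have "convex {a :: 'i \<Rightarrow> real. a d = 0}" by (auto simp: convex_def scaleR_fun_def)
    then have "convex A0" unfolding A0_def using insert.prems(1) by (rule convex_Int[rotated])
    moreover have "A0 \<noteq> {}" using mix[OF pn(1,3,2,4)] by (auto simp: A0_def)
    moreover have "\<exists>i\<in>I. a i \<noteq> 0" if "a \<in> A0" for a
      using insert.prems(3)[of a] that by (auto simp: A0_def)
    ultimately obtain c where c: "\<exists>i\<in>I. c i \<noteq> 0" "\<forall>a\<in>A0. (\<Sum>i\<in>I. c i * a i) \<ge> 0"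
      using insert.IH[of A0] by blast
    define f where "f a = (\<Sum>i\<in>I. c i * a i)" for a
    have f_lin: "f (\<lambda>i. s * a i + t * b i) = s * f a + t * f b" for a b s t
      by (simp add: f_def sum_distrib_left sum.distrib algebra_simps)
    have key: "- f a / a d \<le> - f b / b d" if ab: "a \<in> A" "b \<in> A" "a d > 0" "b d < 0" for a b
    proof -
      have "mix a b \<in> A0" using mix[OF ab] by (simp add: A0_def)
      then have "0 \<le> f (mix a b)" using c(2) by (simp add: f_def)
      also have "f (mix a b) = (- b d) / (a d - b d) * f a + a d / (a d - b d) * f b"
        unfolding mix_def by (rule f_lin)
      also have "\<dots> = ((- b d) * f a + a d * f b) / (a d - b d)"
        by (simp add: add_divide_distrib diff_divide_distrib)
      finally have "0 \<le> (- b d) * f a + a d * f b"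
        using ab by (simp add: zero_le_divide_iff)
      then show ?thesis using ab by (simp add: field_simps)
    qed
    \<comment> \<open>A coefficient of \<open>d\<close> works if it lies above these quotients and
      below the corresponding ones with \<open>b d < 0\<close>. By \<open>key\<close> the two
      families do not cross, so the supremum of the first is admissible.\<close>
    define X where "X = {- f a / a d | a. a \<in> A \<and> a d > 0}"
    have X: "X \<noteq> {}" "bdd_above X"
    proof -
      show "X \<noteq> {}" using pn by (auto simp: X_def)
      show "bdd_above X"
        by (rule bdd_aboveI[of _ "- f n / n d"]) (use pn key in \<open>auto simp: X_def\<close>)
    qed
    define cd where "cd = Sup X"
    have up: "- f a / a d \<le> cd" if "a \<in> A" "a d > 0" for a
      unfolding cd_def by (rule cSup_upper) (use X that in \<open>auto simp: X_def\<close>)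
    have low: "cd \<le> - f b / b d" if "b \<in> A" "b d < 0" for b
      unfolding cd_def by (rule cSup_least) (use X(1) that key in \<open>auto simp: X_def\<close>)
    have eq: "(\<Sum>i\<in>insert d I. (c(d := cd)) i * a i) = cd * a d + f a" for a
    proof -
      have "(\<Sum>i\<in>I. (c(d := cd)) i * a i) = f a"
        unfolding f_def using insert.hyps by (intro sum.cong) auto
      then show ?thesis using insert.hyps by simp
    qed
    have "cd * a d + f a \<ge> 0" if a: "a \<in> A" for a
    proof (cases "a d" "0 :: real" rule: linorder_cases)
      case less
      then show ?thesis using low[OF a less] by (simp add: field_simps)
    next
      case equal
      then show ?thesis using c(2) a by (simp add: A0_def f_def)
    next
      case greater
      then show ?thesis using up[OF a greater] by (simp add: field_simps)
    qed
    moreover have "\<exists>i\<in>insert d I. (c(d := cd)) i \<noteq> 0"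
      using c(1) insert.hyps by (metis fun_upd_apply insertI2)
    ultimately show ?thesis using eq by metis
  qed
qed

text \<open>A quantitative form of being not all zero: the upper bound keeps combinations bounded,
  the attained value keeps them nontrivial.\<close>

definition normalized :: "nat \<Rightarrow> (nat \<Rightarrow> real) \<Rightarrow> bool"
  where "normalized r a \<longleftrightarrow> (\<forall>j<r. \<bar>a j\<bar> \<le> 1) \<and> (\<exists>j<r. \<bar>a j\<bar> = 1)"

text \<open>The divisor is the largest modulus of an entry; its lower bound \<delta> limits what a
  flow loses when it is divided along with its coefficients.\<close>

lemma normalized_divide:
  assumes "\<exists>j<r. \<bar>a j\<bar> \<ge> \<delta>" "\<delta> > 0"
  obtains m where "m \<ge> \<delta>" "normalized r (\<lambda>j. a j / m)"
proof -
  define m where "m = Max ((\<lambda>j. \<bar>a j\<bar>) ` {..<r})"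
  have le: "\<bar>a j\<bar> \<le> m" if "j < r" for j
    unfolding m_def using that by (intro Max_ge) auto
  have ne: "(\<lambda>j. \<bar>a j\<bar>) ` {..<r} \<noteq> {}" using assms by auto
  have "m \<in> (\<lambda>j. \<bar>a j\<bar>) ` {..<r}"
    unfolding m_def by (rule Max_in) (use ne in auto)
  then obtain j where j: "j < r" "\<bar>a j\<bar> = m" by auto
  have "m \<ge> \<delta>" using assms(1) le order_trans by blast
  then have "m > 0" using assms(2) by linarith
  then have "normalized r (\<lambda>j. a j / m)"
    unfolding normalized_def using le j by (auto simp: abs_divide)
  with \<open>m \<ge> \<delta>\<close> show ?thesis using that by blast
qed

lemma normalized_nonzero:
  assumes "\<exists>j<r. a j \<noteq> 0"
  obtains m where "m > 0" "normalized r (\<lambda>j. a j / m)"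
proof -
  obtain j where "j < r" "\<bar>a j\<bar> > 0" using assms by auto
  then show ?thesis using normalized_divide[of r "\<bar>a j\<bar>" a] that by force
qed

text \<open>Gaussian elimination: a pivot row \<open>p\<close> clears the last column,
  \<open>s\<close> enumerates the other rows, and the coefficient of row \<open>p\<close>
  compensates for what was subtracted.\<close>

lemma dependent_rows:
  fixes F :: "nat \<Rightarrow> nat \<Rightarrow> real"
  shows "\<exists>a. (\<exists>j\<le>m. a j \<noteq> 0) \<and> (\<forall>i<m. (\<Sum>j\<le>m. a j * F j i) = 0)"
proof (induction m arbitrary: F)
  case 0
  show ?case by (rule exI[of _ "\<lambda>_. 1"]) simp
next
  case (Suc m)
  show ?case
  proof (cases "\<exists>p\<le>Suc m. F p m \<noteq> 0")
    case False
    obtain a where a: "\<exists>j\<le>m. a j \<noteq> 0" "\<forall>i<m. (\<Sum>j\<le>m. a j * F j i) = 0"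
      using Suc.IH[of F] by blast
    have "(\<Sum>j\<le>Suc m. (a(Suc m := 0)) j * F j i) = 0" if "i < Suc m" for i
    proof (cases "i = m")
      case True
      then show ?thesis using False by (intro sum.neutral) auto
    next
      case neq: False
      have "(\<Sum>j\<le>m. (a(Suc m := 0)) j * F j i) = (\<Sum>j\<le>m. a j * F j i)"
        by (intro sum.cong) auto
      then show ?thesis using a(2) that neq by simp
    qed
    moreover have "\<exists>j\<le>Suc m. (a(Suc m := 0)) j \<noteq> 0" using a(1)
      by (metis fun_upd_apply le_Suc_eq not_less_eq_eq)
    ultimately show ?thesis by blast
  next
    case True
    then obtain p where p: "p \<le> Suc m" "F p m \<noteq> 0" by blast
    define s where "s j = (if j < p then j else Suc j)" for j
    define G where "G j i = F (s j) i - F (s j) m / F p m * F p i" for j i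
    obtain a where a: "\<exists>j\<le>m. a j \<noteq> 0" "\<forall>i<m. (\<Sum>j\<le>m. a j * G j i) = 0"
      using Suc.IH[of G] by blast
    have bij: "bij_betw s {..m} ({..Suc m} - {p})"
    proof (rule bij_betwI[where g = "\<lambda>j. if j < p then j else j - 1"])
      show "s \<in> {..m} \<rightarrow> {..Suc m} - {p}" using p by (auto simp: s_def)
    qed (use p in \<open>auto simp: s_def split: if_splits\<close>)
    define b where "b j = (if j = p then - (\<Sum>l\<le>m. a l * (F (s l) m / F p m))
      else a (if j < p then j else j - 1))" for j
    have bs: "b (s j) = a j" for j by (auto simp: b_def s_def)
    have sum: "(\<Sum>j\<le>Suc m. b j * F j i) = (\<Sum>j\<le>m. a j * G j i)" for i
    proof -
      have "(\<Sum>j\<le>Suc m. b j * F j i) = b p * F p i + (\<Sum>j\<in>{..Suc m} - {p}. b j * F j i)"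
        using p by (intro sum.remove) auto
      also have "(\<Sum>j\<in>{..Suc m} - {p}. b j * F j i) = (\<Sum>j\<le>m. a j * F (s j) i)"
        using sum.reindex_bij_betw[OF bij, of "\<lambda>j. b j * F j i"] by (simp add: bs)
      also have "b p * F p i = - (\<Sum>j\<le>m. a j * (F (s j) m / F p m * F p i))"
        by (simp add: b_def sum_distrib_right mult.assoc)
      finally show ?thesis by (simp add: G_def algebra_simps sum_subtractf)
    qed
    have "(\<Sum>j\<le>Suc m. b j * F j i) = 0" if "i < Suc m" for i
    proof (cases "i = m")
      case True
      then show ?thesis unfolding sum using p by (simp add: G_def)
    next
      case False
      then show ?thesis unfolding sum using that a(2) by simp
    qed
    moreover have "\<exists>j\<le>Suc m. b j \<noteq> 0"
    proof -
      obtain j where "j \<le> m" "a j \<noteq> 0" using a(1) by blast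
      then show ?thesis using bs[of j] by (intro exI[of _ "s j"]) (auto simp: s_def)
    qed
    ultimately show ?thesis by blast
  qed
qed

section \<open>Sparse flows on cluster trees\<close>

datatype ('x, 'u) ctree = Lf 'x | Nd "'u set" "('x, 'u) ctree" "('x, 'u) ctree"

primrec leaves :: "('x, 'u) ctree \<Rightarrow> 'x set" where
  "leaves (Lf x) = {x}"
| "leaves (Nd U l r) = leaves l \<union> leaves r"

primrec fits :: "'u set \<Rightarrow> ('x, 'u) ctree \<Rightarrow> bool" where
  "fits W (Lf x) \<longleftrightarrow> True"
| "fits W (Nd U l r) \<longleftrightarrow> U \<subseteq> W"

primrec nested :: "('x, 'u) ctree \<Rightarrow> bool" where
  "nested (Lf x) \<longleftrightarrow> True"
| "nested (Nd U l r) \<longleftrightarrow>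
    nested l \<and> nested r \<and> fits U l \<and> fits U r \<and> leaves l \<inter> leaves r = {}"

lemma finite_leaves [simp]: "finite (leaves t)"
  by (induction t) auto

lemma leaves_nonempty [simp]: "leaves t \<noteq> {}"
  by (induction t) auto

lemma fits_mono: "fits U t \<Longrightarrow> U \<subseteq> W \<Longrightarrow> fits W t"
  by (cases t) auto

text \<open>
  Functionals are elements of an arbitrary real vector space, tested by the linear maps \<open>\<theta> u\<close>;
  the test set at a node plays the role of a unit ball and bounds the flow out of its two
  children.
\<close>

definition test_bound :: "('u \<Rightarrow> 'w \<Rightarrow> real) \<Rightarrow> 'u set \<Rightarrow> real \<Rightarrow> 'w \<Rightarrow> bool"
  where "test_bound \<theta> U B h \<longleftrightarrow> (\<forall>u\<in>U. \<bar>\<theta> u h\<bar> \<le> B)"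

definition total :: "('x, 'u) ctree \<Rightarrow> ('x \<Rightarrow> 'w) \<Rightarrow> 'w::comm_monoid_add"
  where "total t \<phi> = (\<Sum>x\<in>leaves t. \<phi> x)"

primrec flow_bound ::
    "('u \<Rightarrow> 'w::real_vector \<Rightarrow> real) \<Rightarrow> real \<Rightarrow> ('x, 'u) ctree \<Rightarrow> ('x \<Rightarrow> 'w) \<Rightarrow> bool" where
  "flow_bound \<theta> B (Lf x) \<phi> \<longleftrightarrow> True"
| "flow_bound \<theta> B (Nd U l r) \<phi> \<longleftrightarrow> flow_bound \<theta> B l \<phi> \<and> flow_bound \<theta> B r \<phi> \<and>
    test_bound \<theta> U B (total l \<phi>) \<and> test_bound \<theta> U B (total r \<phi>)"

lemma total_Lf [simp]: "total (Lf x) \<phi> = \<phi> x"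
  by (simp add: total_def)

lemma total_Nd:
  assumes "nested (Nd U l r)"
  shows "total (Nd U l r) \<phi> = total l \<phi> + total r \<phi>"
  using assms unfolding total_def by (simp add: sum.union_disjoint)

lemma total_add: "total t (\<lambda>x. \<phi> x + \<psi> x) = total t \<phi> + total t \<psi>"
  by (simp add: total_def sum.distrib)

lemma total_scale:
  fixes \<phi> :: "'x \<Rightarrow> 'w::real_vector"
  shows "total t (\<lambda>x. c *\<^sub>R \<phi> x) = c *\<^sub>R total t \<phi>"
  unfolding total_def by (rule scaleR_right.sum [symmetric])

lemma total_zero: "(\<And>x. x \<in> leaves t \<Longrightarrow> \<phi> x = 0) \<Longrightarrow> total t \<phi> = 0"
  by (simp add: total_def)

lemma flow_bound_mono: "flow_bound \<theta> B t \<phi> \<Longrightarrow> B \<le> B' \<Longrightarrow> flow_bound \<theta> B' t \<phi>"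
  by (induction t) (auto simp: test_bound_def intro: order_trans)

locale linear_tests =
  fixes \<theta> :: "'u \<Rightarrow> 'w::real_vector \<Rightarrow> real"
  assumes linear_test: "linear (\<theta> u)"
begin

lemma test_bound_add:
  "test_bound \<theta> U B g \<Longrightarrow> test_bound \<theta> U B' h \<Longrightarrow> test_bound \<theta> U (B + B') (g + h)"
  unfolding test_bound_def linear_add[OF linear_test]
  by (meson abs_triangle_ineq add_mono order_trans)

lemma test_bound_scale:
  "test_bound \<theta> U B g \<Longrightarrow> \<bar>c\<bar> * B \<le> B' \<Longrightarrow> test_bound \<theta> U B' (c *\<^sub>R g)"
  unfolding test_bound_def linear_scale[OF linear_test]
  by (auto simp: abs_mult intro: order_trans[OF mult_left_mono])

lemma test_bound_sum:
  assumes "\<And>j. j < r \<Longrightarrow> test_bound \<theta> U B (g j)" "normalized r a" "B \<ge> 0"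
  shows "test_bound \<theta> U (real r * B) (\<Sum>j<r. a j *\<^sub>R g j)"
proof -
  have "\<bar>\<theta> u (\<Sum>j<r. a j *\<^sub>R g j)\<bar> \<le> real r * B" if "u \<in> U" for u
  proof -
    have "\<bar>\<theta> u (\<Sum>j<r. a j *\<^sub>R g j)\<bar> \<le> (\<Sum>j<r. \<bar>\<theta> u (a j *\<^sub>R g j)\<bar>)"
      unfolding linear_sum[OF linear_test] by (rule sum_abs)
    also have "\<dots> \<le> (\<Sum>j<r. B)"
    proof (rule sum_mono)
      fix j assume "j \<in> {..<r}"
      then have "\<bar>a j\<bar> * \<bar>\<theta> u (g j)\<bar> \<le> 1 * B"
        using assms that unfolding normalized_def test_bound_def by (intro mult_mono) auto
      then show "\<bar>\<theta> u (a j *\<^sub>R g j)\<bar> \<le> B"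
        by (simp add: linear_scale[OF linear_test] abs_mult)
    qed
    finally show ?thesis by simp
  qed
  then show ?thesis by (simp add: test_bound_def)
qed

lemma test_bound_zero: "B \<ge> 0 \<Longrightarrow> test_bound \<theta> U B 0"
  by (simp add: test_bound_def linear_0[OF linear_test])

lemma flow_bound_add:
  "flow_bound \<theta> B t \<phi> \<Longrightarrow> flow_bound \<theta> B' t \<psi> \<Longrightarrow> flow_bound \<theta> (B + B') t (\<lambda>x. \<phi> x + \<psi> x)"
  by (induction t) (auto simp: total_add intro: test_bound_add)

lemma flow_bound_scale:
  "flow_bound \<theta> B t \<phi> \<Longrightarrow> \<bar>c\<bar> * B \<le> B' \<Longrightarrow> flow_bound \<theta> B' t (\<lambda>x. c *\<^sub>R \<phi> x)"
  by (induction t) (auto simp: total_scale intro: test_bound_scale)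

lemma flow_bound_zero:
  "B \<ge> 0 \<Longrightarrow> (\<And>x. x \<in> leaves t \<Longrightarrow> \<phi> x = 0) \<Longrightarrow> flow_bound \<theta> B t \<phi>"
  by (induction t) (auto simp: total_zero intro: test_bound_zero)

text \<open>Every cluster total is \<open>w\<close> or 0, and nesting puts all bodies of
  \<open>t\<close> inside \<open>U\<close>, so the bound on \<open>U\<close> is enough.\<close>

lemma flow_bound_single:
  assumes "nested t" "fits U t" "test_bound \<theta> U B w" "B \<ge> 0"
  shows "flow_bound \<theta> B t (\<lambda>y. if y = x then w else 0)"
  using assms
proof (induction t arbitrary: U)
  case (Nd U' l r)
  have tot: "total t (\<lambda>y. if y = x then w else 0) = (if x \<in> leaves t then w else 0)" for t :: "('a, 'u) ctree"
    unfolding total_def by simp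
  have "test_bound \<theta> U' B w" using Nd.prems(2,3) by (auto simp: test_bound_def)
  then show ?case using Nd by (auto simp: tot intro: test_bound_zero)
qed auto

end

text \<open>For subspaces \<open>E\<close> of \<open>A\<close> this is codimension at most
  \<open>c\<close>. It is phrased through relations with bounded coefficients, because these are
  what test bounds can be applied to.\<close>

definition codim_le :: "nat \<Rightarrow> 'w::real_vector set \<Rightarrow> 'w set \<Rightarrow> bool"
  where "codim_le c A E \<longleftrightarrow> (\<forall>g. (\<forall>j\<le>c. g j \<in> A) \<longrightarrow>
    (\<exists>a. normalized (Suc c) a \<and> (\<Sum>j<Suc c. a j *\<^sub>R g j) \<in> E))"

text \<open>
  A flow whose total lies in the span of \<open>r = c + 1 - i\<close> functionals, with normalized coefficients,
  can be replaced by one of the same kind supported on \<open>2 ^ i\<close> leaves; the total may change.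
\<close>

definition sparsifies ::
    "('u \<Rightarrow> 'w::real_vector \<Rightarrow> real) \<Rightarrow> nat \<Rightarrow> nat \<Rightarrow> ('x, 'u) ctree \<Rightarrow> real \<Rightarrow> bool"
  where "sparsifies \<theta> c i t C \<longleftrightarrow> (\<forall>A U E \<phi> B g r v.
    subspace A \<longrightarrow> fits U t \<longrightarrow>
    (\<forall>x\<in>leaves t. subspace (E x) \<and> E x \<subseteq> A \<and> (E x \<noteq> {0} \<longrightarrow> codim_le c A (E x)) \<and> \<phi> x \<in> E x) \<longrightarrow>
    B \<ge> 0 \<longrightarrow> flow_bound \<theta> B t \<phi> \<longrightarrow> r + i = Suc c \<longrightarrow>
    (\<forall>j<r. g j \<in> A \<and> test_bound \<theta> U B (g j)) \<longrightarrow> normalized r v \<longrightarrow>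
    total t \<phi> = (\<Sum>j<r. v j *\<^sub>R g j) \<longrightarrow>
    (\<exists>R \<psi> a. R \<subseteq> leaves t \<and> card R \<le> 2 ^ i \<and> (\<forall>x\<in>leaves t. \<psi> x \<in> E x) \<and>
      (\<forall>x. x \<notin> R \<longrightarrow> \<psi> x = 0) \<and> flow_bound \<theta> (C * B) t \<psi> \<and> normalized r a \<and>
      total t \<psi> = (\<Sum>j<r. a j *\<^sub>R g j)))"

context linear_tests begin

lemma sparsifies_Lf:
  assumes "C \<ge> 1"
  shows "sparsifies \<theta> c i (Lf x) C"
  unfolding sparsifies_def
proof (intro allI impI, goal_cases)
  case (1 A U E \<phi> B g r v)
  then show ?case
    by (intro exI[of _ "{x}"] exI[of _ "\<lambda>y. if y = x then \<phi> x else 0"] exI[of _ v]) auto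
qed

text \<open>With \<open>c + 1\<close> functionals at hand one leaf suffices: some normalized
  combination of them lies in \<open>E x\<close> and is placed at \<open>x\<close>. The given flow
  serves only to find a leaf with \<open>E x\<close> different from \<open>{0}\<close>. The factor
  \<open>Suc c\<close> adds up the bounds of the functionals.\<close>

lemma sparsifies_0:
  assumes "nested t" "C \<ge> real (Suc c)"
  shows "sparsifies \<theta> c 0 t C"
  unfolding sparsifies_def
proof (intro allI impI, goal_cases)
  case (1 A U E \<phi> B g r v)
  note prems = this
  show ?case
  proof (cases "\<forall>x\<in>leaves t. \<phi> x = 0")
    case True
    then have "total t \<phi> = 0" by (simp add: total_zero)
    then show ?thesis using prems assms(2)
      by (intro exI[of _ "{}"] exI[of _ "\<lambda>_. 0"] exI[of _ v])
         (auto simp: total_zero subspace_0 intro!: flow_bound_zero)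
  next
    case False
    then obtain x where x: "x \<in> leaves t" "\<phi> x \<noteq> 0" by blast
    have r: "r = Suc c" using prems by simp
    have "codim_le c A (E x)" using prems(3) x by blast
    then obtain a where a: "normalized (Suc c) a" "(\<Sum>j<Suc c. a j *\<^sub>R g j) \<in> E x"
      unfolding codim_le_def using prems(7) r less_Suc_eq_le by blast
    define w where "w = (\<Sum>j<Suc c. a j *\<^sub>R g j)"
    have "test_bound \<theta> U (real (Suc c) * B) w"
      unfolding w_def by (rule test_bound_sum) (use prems r a in auto)
    moreover have "real (Suc c) * B \<le> C * B"
      using assms(2) prems(4) by (intro mult_right_mono) auto
    ultimately have "test_bound \<theta> U (C * B) w" unfolding test_bound_def using order_trans by blast
    then have "flow_bound \<theta> (C * B) t (\<lambda>y. if y = x then w else 0)"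
      using assms prems by (intro flow_bound_single[of t U]) auto
    moreover have "total t (\<lambda>y. if y = x then w else 0) = w"
      using x by (simp add: total_def)
    ultimately show ?thesis using a r x prems(3)
      by (intro exI[of _ "{x}"] exI[of _ "\<lambda>y. if y = x then w else 0"] exI[of _ a])
         (auto simp: w_def subspace_0)
  qed
qed

end

text \<open>In the application \<open>a\<close> and \<open>b\<close> are the coefficients of the
  sparsified totals of the two children, with index \<open>n\<close> for the left cluster sum
  \<open>h\<close>, and \<open>v\<close> belongs to the original total. The alternatives are what
  remains after cancelling \<open>h\<close> between the two sparse flows, within the left child, and
  within the right child. If the first two vectors are small, then \<open>a n\<close> has modulus 1
  and the entries of \<open>b\<close> below \<open>n\<close> stay under 2/3, so \<open>b n\<close>
  has modulus 1 as well; an entry of \<open>v\<close> of modulus 1 then leaves at least 1 - 2/3 =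
  1/3 in the third.\<close>

lemma normalized_trichotomy:
  assumes a: "normalized (Suc n) a" and b: "normalized (Suc n) b" and v: "normalized n v"
  shows "(\<exists>j<n. \<bar>b n * a j - a n * b j\<bar> \<ge> 1/3) \<or> (\<exists>j<n. \<bar>a j\<bar> \<ge> 1/3) \<or>
    (\<exists>j<n. \<bar>b j + b n * v j\<bar> \<ge> 1/3)"
proof (rule ccontr)
  assume "\<not> ?thesis"
  then have ab: "\<And>j. j < n \<Longrightarrow> \<bar>b n * a j - a n * b j\<bar> < 1/3"
    and a3: "\<And>j. j < n \<Longrightarrow> \<bar>a j\<bar> < 1/3" and bv: "\<And>j. j < n \<Longrightarrow> \<bar>b j + b n * v j\<bar> < 1/3"
    by (auto simp: not_le)
  obtain j where "j < Suc n" "\<bar>a j\<bar> = 1" using a by (auto simp: normalized_def)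
  then have an: "\<bar>a n\<bar> = 1" using a3[of j] by (cases "j = n") auto
  have bn: "\<bar>b n\<bar> \<le> 1" using b by (auto simp: normalized_def)
  have b3: "\<bar>b j\<bar> < 2/3" if "j < n" for j
  proof -
    have "\<bar>b n * a j\<bar> \<le> 1 * \<bar>a j\<bar>" unfolding abs_mult using bn by (intro mult_right_mono) auto
    moreover have "\<bar>a n * b j\<bar> = \<bar>b j\<bar>" using an by (simp add: abs_mult)
    ultimately show ?thesis using ab[OF that] a3[OF that] by linarith
  qed
  obtain i where "i < Suc n" "\<bar>b i\<bar> = 1" using b by (auto simp: normalized_def)
  then have "\<bar>b n\<bar> = 1" using b3[of i] by (cases "i = n") auto
  moreover obtain i where i: "i < n" "\<bar>v i\<bar> = 1" using v by (auto simp: normalized_def)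
  ultimately have "\<bar>b n * v i\<bar> = 1" by (simp add: abs_mult)
  then show False using bv[OF i(1)] b3[OF i(1)] by linarith
qed

lemma sum_scaleR_combine:
  fixes g :: "nat \<Rightarrow> 'w::real_vector"
  shows "s *\<^sub>R (\<Sum>j<n. a j *\<^sub>R g j) + t *\<^sub>R (\<Sum>j<n. b j *\<^sub>R g j) = (\<Sum>j<n. (s * a j + t * b j) *\<^sub>R g j)"
  by (simp add: scaleR_right.sum scaleR_left_distrib sum.distrib)

lemma sparsifiesE:
  assumes "sparsifies \<theta> c i t C" "subspace A" "fits U t"
    and "\<And>x. x \<in> leaves t \<Longrightarrow>
      subspace (E x) \<and> E x \<subseteq> A \<and> (E x \<noteq> {0} \<longrightarrow> codim_le c A (E x)) \<and> \<phi> x \<in> E x"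
    and "B \<ge> 0" "flow_bound \<theta> B t \<phi>" "r + i = Suc c"
    and "\<And>j. j < r \<Longrightarrow> g j \<in> A \<and> test_bound \<theta> U B (g j)" "normalized r v"
    and "total t \<phi> = (\<Sum>j<r. v j *\<^sub>R g j)"
  obtains R \<psi> a where "R \<subseteq> leaves t" "card R \<le> 2 ^ i" "\<And>x. x \<in> leaves t \<Longrightarrow> \<psi> x \<in> E x"
    "\<And>x. x \<notin> R \<Longrightarrow> \<psi> x = 0" "flow_bound \<theta> (C * B) t \<psi>" "normalized r a"
    "total t \<psi> = (\<Sum>j<r. a j *\<^sub>R g j)"
proof -
  have "\<exists>R \<psi> a. R \<subseteq> leaves t \<and> card R \<le> 2 ^ i \<and> (\<forall>x\<in>leaves t. \<psi> x \<in> E x) \<and>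
      (\<forall>x. x \<notin> R \<longrightarrow> \<psi> x = 0) \<and> flow_bound \<theta> (C * B) t \<psi> \<and> normalized r a \<and>
      total t \<psi> = (\<Sum>j<r. a j *\<^sub>R g j)"
    using assms(1) unfolding sparsifies_def
    by (elim allE[of _ A] allE[of _ U] allE[of _ E] allE[of _ \<phi>] allE[of _ B] allE[of _ g] allE[of _ r]
        allE[of _ v] impE) (use assms in simp_all)
  then show ?thesis using that by blast
qed

context linear_tests begin

text \<open>
  Both children are sparsified with the total \<open>h\<close> of the left child as an additional functional.
  If \<open>h\<close> cannot be eliminated from the two resulting totals without losing normalization, these
  are nearly parallel, and then eliminating \<open>h\<close> between one of them and the original flow on the
  same child succeeds, which reduces the problem to that child.
\<close>

lemma sparsifies_Nd:
  assumes nest: "nested (Nd U l r)"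
    and "sparsifies \<theta> c i l C\<^sub>0" "sparsifies \<theta> c i r C\<^sub>0"
    and "sparsifies \<theta> c (Suc i) l C\<^sub>1" "sparsifies \<theta> c (Suc i) r C\<^sub>1"
    and C: "C\<^sub>0 \<ge> 1" "C\<^sub>1 \<ge> 1" "C \<ge> 6 * C\<^sub>0" "C \<ge> 3 * real (Suc c)" "C \<ge> 3 * C\<^sub>1 * (C\<^sub>0 + 1)"
  shows "sparsifies \<theta> c (Suc i) (Nd U l r) C"
  unfolding sparsifies_def
proof (intro allI impI, goal_cases)
  case (1 A W E \<phi> B g n v)
  have A: "subspace A" and UW: "U \<subseteq> W" and B: "B \<ge> 0" and n: "n + Suc i = Suc c" and v: "normalized n v"
    and E: "\<And>x. x \<in> leaves l \<union> leaves r \<Longrightarrow> subspace (E x) \<and> E x \<subseteq> A \<and> (E x \<noteq> {0} \<longrightarrow> codim_le c A (E x)) \<and> \<phi> x \<in> E x"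
    and fl: "flow_bound \<theta> B l \<phi>" "flow_bound \<theta> B r \<phi>" "test_bound \<theta> U B (total l \<phi>)" "test_bound \<theta> U B (total r \<phi>)"
    and g: "\<And>j. j < n \<Longrightarrow> g j \<in> A" "\<And>j. j < n \<Longrightarrow> test_bound \<theta> W B (g j)"
    and tot: "total l \<phi> + total r \<phi> = (\<Sum>j<n. v j *\<^sub>R g j)"
    using 1 total_Nd[OF nest, of \<phi>] by auto
  have nl: "nested l" "nested r" "fits U l" "fits U r" "leaves l \<inter> leaves r = {}"
    using nest by auto
  have gU: "test_bound \<theta> U B (g j)" if "j < n" for j
    using g(2)[OF that] UW by (auto simp: test_bound_def)
  have ES: "subspace (E x)" and E\<phi>: "\<phi> x \<in> E x" if "x \<in> leaves l \<union> leaves r" for x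
    using E[OF that] by simp_all
  define h where "h = total l \<phi>"
  define g' where "g' = g(n := h)"
  have \<phi>A: "\<phi> x \<in> A" if "x \<in> leaves l \<union> leaves r" for x
    by (rule subsetD[of "E x"]) (simp_all add: E[OF that])
  have "h \<in> A" unfolding h_def total_def by (rule subspace_sum[OF A]) (simp add: \<phi>A)
  then have g': "\<forall>j<Suc n. g' j \<in> A \<and> test_bound \<theta> U B (g' j)"
    using g(1) gU fl(3) by (auto simp: g'_def h_def less_Suc_eq)
  have sum': "(\<Sum>j<Suc n. a j *\<^sub>R g' j) = (\<Sum>j<n. a j *\<^sub>R g j) + a n *\<^sub>R h" for a
    by (simp add: g'_def)
  have n': "Suc n + i = Suc c" using n by simp
  \<comment> \<open>On the left the original total is \<open>h\<close>, so its coefficient vector is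
    the last unit vector. On the right it is the combination of the \<open>g j\<close> given by
    \<open>v\<close>, minus \<open>h\<close>; hence the entry -1 in \<open>v2\<close>.\<close>
  have v1: "normalized (Suc n) (\<lambda>j. if j = n then 1 else 0)" by (auto simp: normalized_def)
  have tl: "total l \<phi> = (\<Sum>j<Suc n. (if j = n then 1 else 0) *\<^sub>R g' j)"
    unfolding sum' by (simp add: h_def)
  obtain R1 \<psi>1 a where 1: "R1 \<subseteq> leaves l" "card R1 \<le> 2 ^ i" "\<And>x. x \<in> leaves l \<Longrightarrow> \<psi>1 x \<in> E x"
      "\<And>x. x \<notin> R1 \<Longrightarrow> \<psi>1 x = 0" "flow_bound \<theta> (C\<^sub>0 * B) l \<psi>1" "normalized (Suc n) a"
      "total l \<psi>1 = (\<Sum>j<Suc n. a j *\<^sub>R g' j)"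
    by (rule sparsifiesE[OF assms(2) A nl(3), of E \<phi> B "Suc n" g' "\<lambda>j. if j = n then 1 else 0"];
      (rule that; assumption | use E B fl n' g' v1 tl in simp))
  have v2: "normalized (Suc n) (v(n := -1))" using v by (auto simp: normalized_def less_Suc_eq)
  have tr: "total r \<phi> = (\<Sum>j<Suc n. (v(n := -1)) j *\<^sub>R g' j)"
  proof -
    have "(\<Sum>j<n. (v(n := -1)) j *\<^sub>R g j) = (\<Sum>j<n. v j *\<^sub>R g j)" by (intro sum.cong) auto
    then show ?thesis unfolding sum' using tot by (simp add: h_def algebra_simps)
  qed
  obtain R2 \<psi>2 b where 2: "R2 \<subseteq> leaves r" "card R2 \<le> 2 ^ i" "\<And>x. x \<in> leaves r \<Longrightarrow> \<psi>2 x \<in> E x"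
      "\<And>x. x \<notin> R2 \<Longrightarrow> \<psi>2 x = 0" "flow_bound \<theta> (C\<^sub>0 * B) r \<psi>2" "normalized (Suc n) b"
      "total r \<psi>2 = (\<Sum>j<Suc n. b j *\<^sub>R g' j)"
    by (rule sparsifiesE[OF assms(3) A nl(4), of E \<phi> B "Suc n" g' "v(n := -1)"];
      (rule that; assumption | use E B fl n' g' v2 tr in simp))
  have z1: "\<psi>1 x = 0" if "x \<in> leaves r" for x using 1(1,4) nl(5) that by blast
  have z2: "\<psi>2 x = 0" if "x \<in> leaves l" for x using 2(1,4) nl(5) that by blast
  have C0B: "0 \<le> C\<^sub>0 * B" "0 \<le> C * B" "0 \<le> C" using C B by auto
  let ?goal = "\<exists>R \<psi> a. R \<subseteq> leaves (Nd U l r) \<and> card R \<le> 2 ^ Suc i \<and> (\<forall>x\<in>leaves (Nd U l r). \<psi> x \<in> E x) \<and>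
      (\<forall>x. x \<notin> R \<longrightarrow> \<psi> x = 0) \<and> flow_bound \<theta> (C * B) (Nd U l r) \<psi> \<and> normalized n a \<and>
      total (Nd U l r) \<psi> = (\<Sum>j<n. a j *\<^sub>R g j)"
  \<comment> \<open>A flow on one child whose total involves only the first \<open>n\<close>
    functionals is sparsified inside that child at level \<open>Suc i\<close> and extended by 0. Its
    total is a normalized combination of the \<open>g j\<close>, hence bounded on \<open>U\<close>,
    as the node requires.\<close>
  have lift: ?goal
    if s: "s = l \<or> s = r" and sp: "sparsifies \<theta> c (Suc i) s C\<^sub>1"
      and \<phi>': "\<forall>x\<in>leaves s. \<phi>' x \<in> E x" "flow_bound \<theta> (3 * (C\<^sub>0 + 1) * B) s \<phi>'"
      and w: "normalized n w" "total s \<phi>' = (\<Sum>j<n. w j *\<^sub>R g j)" for s \<phi>' w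
  proof -
    have B': "B \<le> 3 * (C\<^sub>0 + 1) * B" using B C(1) by (simp add: mult_le_cancel_right1)
    have gW: "test_bound \<theta> W (3 * (C\<^sub>0 + 1) * B) (g j)" if "j < n" for j
      using g(2)[OF that] B' unfolding test_bound_def using order_trans by blast
    have fW: "fits W s" using s nl(3,4) UW fits_mono by blast
    have B0: "0 \<le> 3 * (C\<^sub>0 + 1) * B" using B C by simp
    have Es: "subspace (E x) \<and> E x \<subseteq> A \<and> (E x \<noteq> {0} \<longrightarrow> codim_le c A (E x)) \<and> \<phi>' x \<in> E x"
      if "x \<in> leaves s" for x
      using E[of x] \<phi>'(1) s that by auto
    obtain R \<psi> a where R: "R \<subseteq> leaves s" "card R \<le> 2 ^ Suc i" "\<And>x. x \<in> leaves s \<Longrightarrow> \<psi> x \<in> E x"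
      "\<And>x. x \<notin> R \<Longrightarrow> \<psi> x = 0" "flow_bound \<theta> (C\<^sub>1 * (3 * (C\<^sub>0 + 1) * B)) s \<psi>" "normalized n a"
      "total s \<psi> = (\<Sum>j<n. a j *\<^sub>R g j)"
      by (rule sparsifiesE[OF sp A fW, of E \<phi>' "3 * (C\<^sub>0 + 1) * B" n g w];
        (rule that; assumption | use \<phi>'(2) n g(1) w gW B0 Es in simp))
    have "C\<^sub>1 * (3 * (C\<^sub>0 + 1) * B) \<le> C * B"
      using mult_right_mono[OF C(5) B] by (simp add: algebra_simps)
    then have fs: "flow_bound \<theta> (C * B) s \<psi>" using R(5) flow_bound_mono by blast
    have "test_bound \<theta> U (real n * B) (total s \<psi>)"
      unfolding R(7) by (rule test_bound_sum) (use gU R(6) B in auto)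
    moreover have "real n * B \<le> C * B" using C(4) n B by (intro mult_right_mono) auto
    ultimately have ts: "test_bound \<theta> U (C * B) (total s \<psi>)"
      unfolding test_bound_def using order_trans by blast
    have zero: "\<psi> x = 0" if "x \<in> leaves l \<union> leaves r" "x \<notin> leaves s" for x
      using R(1,4) that by blast
    have "flow_bound \<theta> (C * B) s' \<psi> \<and> test_bound \<theta> U (C * B) (total s' \<psi>) \<and> (s' \<noteq> s \<longrightarrow> total s' \<psi> = 0)"
      if "s' = l \<or> s' = r" for s'
    proof (cases "s' = s")
      case False
      then have "\<psi> x = 0" if "x \<in> leaves s'" for x
        using zero[of x] that s \<open>s' = l \<or> s' = r\<close> nl(5) by blast
      then show ?thesis using C0B by (simp add: total_zero flow_bound_zero test_bound_zero)
    qed (use fs ts in auto)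
    moreover have "l \<noteq> r" using nl(5) by (metis Int_absorb leaves_nonempty)
    ultimately have "flow_bound \<theta> (C * B) (Nd U l r) \<psi>" "total (Nd U l r) \<psi> = total s \<psi>"
      using s by (auto simp: total_Nd[OF nest])
    moreover have "\<psi> x \<in> E x" if x: "x \<in> leaves l \<union> leaves r" for x
    proof (cases "x \<in> leaves s")
      case False
      then show ?thesis using zero[OF x] E[OF x] by (simp add: subspace_0)
    qed (rule R(3))
    moreover have "R \<subseteq> leaves (Nd U l r)" using R(1) s by auto
    ultimately show ?thesis using R(2,4,6,7)
      by (intro exI[of _ R] exI[of _ \<psi>] exI[of _ a]) simp
  qed
  have \<alpha>: "\<bar>a n\<bar> \<le> 1" "\<bar>b n\<bar> \<le> 1" using 1(6) 2(6) by (auto simp: normalized_def)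
  \<comment> \<open>Divisors are at least 1/3 and the coefficients of \<open>h\<close> at most 1 in
    modulus: the source of the factors 3 in the conditions on \<open>C\<close>.\<close>
  have abs3: "\<bar>y / m\<bar> \<le> 3" if "\<bar>y\<bar> \<le> 1" "m \<ge> 1/3" for y m :: real
    using that by (simp add: abs_divide divide_le_eq)
  consider (both) "\<exists>j<n. \<bar>b n * a j - a n * b j\<bar> \<ge> 1/3" | (left) "\<exists>j<n. \<bar>a j\<bar> \<ge> 1/3"
    | (right) "\<exists>j<n. \<bar>b j + b n * v j\<bar> \<ge> 1/3"
    using normalized_trichotomy[OF 1(6) 2(6) v] by blast
  then show ?case
  proof cases
    case both
    then obtain m where m: "m \<ge> 1/3" "normalized n (\<lambda>j. (b n * a j - a n * b j) / m)"
      using normalized_divide[of n "1/3" "\<lambda>j. b n * a j - a n * b j"] by auto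
    \<comment> \<open>Cross multiplication cancels \<open>h\<close>, since it occurs with
      coefficient \<open>a n\<close> on the left and \<open>b n\<close> on the right.\<close>
    define \<psi> where "\<psi> x = (b n / m) *\<^sub>R \<psi>1 x + (- a n / m) *\<^sub>R \<psi>2 x" for x
    have sc: "\<bar>b n / m\<bar> \<le> 3" "\<bar>- a n / m\<bar> \<le> 3" using abs3 \<alpha> m(1) by auto
    have cR: "card (R1 \<union> R2) \<le> 2 ^ Suc i" using card_Un_le[of R1 R2] 1(2) 2(2) by simp
    have \<psi>E: "\<psi> x \<in> E x" if x: "x \<in> leaves l \<union> leaves r" for x
    proof -
      have "\<psi>1 x \<in> E x" using 1(3)[of x] z1[of x] subspace_0[OF ES[OF x]] x by fastforce
      moreover have "\<psi>2 x \<in> E x" using 2(3)[of x] z2[of x] subspace_0[OF ES[OF x]] x by fastforce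
      ultimately show ?thesis unfolding \<psi>_def
        using ES[OF x] by (intro subspace_add subspace_scale)
    qed
    have fs: "flow_bound \<theta> (C * B) s \<psi>" if s: "s = l \<or> s = r" for s
    proof -
      have "flow_bound \<theta> (C\<^sub>0 * B) s \<psi>1" "flow_bound \<theta> (C\<^sub>0 * B) s \<psi>2"
        using s 1(5) 2(5) flow_bound_zero[OF C0B(1), of r \<psi>1] flow_bound_zero[OF C0B(1), of l \<psi>2] z1 z2
        by auto
      then have "flow_bound \<theta> (3 * (C\<^sub>0 * B) + 3 * (C\<^sub>0 * B)) s \<psi>"
        unfolding \<psi>_def
        using mult_right_mono[OF sc(1) C0B(1)] mult_right_mono[OF sc(2) C0B(1)]
        by (intro flow_bound_add flow_bound_scale)
      moreover have "3 * (C\<^sub>0 * B) + 3 * (C\<^sub>0 * B) \<le> C * B"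
        using mult_right_mono[OF C(3) B] by (simp add: algebra_simps)
      ultimately show ?thesis using flow_bound_mono by blast
    qed
    have t1: "total l \<psi> = (b n / m) *\<^sub>R total l \<psi>1" "total r \<psi> = (- a n / m) *\<^sub>R total r \<psi>2"
      unfolding \<psi>_def total_add total_scale
      using total_zero[of r \<psi>1] total_zero[of l \<psi>2] z1 z2 by simp_all
    have "real (Suc n) * B \<le> real (Suc c) * B" using n B by (intro mult_right_mono) auto
    moreover have "3 * (real (Suc c) * B) \<le> C * B" using mult_right_mono[OF C(4) B] by (simp add: algebra_simps)
    ultimately have SB: "3 * (real (Suc n) * B) \<le> C * B" by linarith
    have le: "\<bar>y\<bar> * (real (Suc n) * B) \<le> C * B" if "\<bar>y\<bar> \<le> 3" for y
    proof -
      have "\<bar>y\<bar> * (real (Suc n) * B) \<le> 3 * (real (Suc n) * B)"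
        using that B by (intro mult_right_mono) auto
      then show ?thesis using SB by linarith
    qed
    have "test_bound \<theta> U (real (Suc n) * B) (total l \<psi>1)" "test_bound \<theta> U (real (Suc n) * B) (total r \<psi>2)"
      unfolding 1(7) 2(7) using g' by (intro test_bound_sum 1(6) 2(6) B; blast)+
    then have "test_bound \<theta> U (C * B) (total l \<psi>)" "test_bound \<theta> U (C * B) (total r \<psi>)"
      unfolding t1 using test_bound_scale le[OF sc(1)] le[OF sc(2)] by blast+
    then have "flow_bound \<theta> (C * B) (Nd U l r) \<psi>" using fs by simp
    moreover have "total (Nd U l r) \<psi> = (\<Sum>j<n. ((b n * a j - a n * b j) / m) *\<^sub>R g j)"
    proof -
      have "total (Nd U l r) \<psi> = ((b n / m) *\<^sub>R (\<Sum>j<n. a j *\<^sub>R g j) + (- a n / m) *\<^sub>R (\<Sum>j<n. b j *\<^sub>R g j)) +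
          ((b n / m * a n) *\<^sub>R h + (- a n / m * b n) *\<^sub>R h)"
        unfolding total_Nd[OF nest] t1 1(7) 2(7) sum' scaleR_add_right scaleR_scaleR by (simp only: ac_simps)
      also have "(b n / m * a n) *\<^sub>R h + (- a n / m * b n) *\<^sub>R h = 0"
        by (simp flip: scaleR_left_distrib)
      also have "(b n / m) *\<^sub>R (\<Sum>j<n. a j *\<^sub>R g j) + (- a n / m) *\<^sub>R (\<Sum>j<n. b j *\<^sub>R g j) =
          (\<Sum>j<n. ((b n * a j - a n * b j) / m) *\<^sub>R g j)"
        unfolding sum_scaleR_combine by (simp add: diff_divide_distrib)
      finally show ?thesis by simp
    qed
    moreover have "\<forall>x. x \<notin> R1 \<union> R2 \<longrightarrow> \<psi> x = 0" using 1(4) 2(4) by (auto simp: \<psi>_def)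
    ultimately show ?thesis using m(2) 1(1) 2(1) cR \<psi>E
      by (intro exI[of _ "R1 \<union> R2"] exI[of _ \<psi>] exI[of _ "\<lambda>j. (b n * a j - a n * b j) / m"]) auto
  next
    case left
    then obtain m where m: "m \<ge> 1/3" "normalized n (\<lambda>j. a j / m)"
      using normalized_divide[of n "1/3" a] by auto
    \<comment> \<open>On the left child the original flow has total \<open>h\<close>, so subtracting
      \<open>a n\<close> times this flow removes \<open>h\<close>.\<close>
    define \<phi>' where "\<phi>' x = (1 / m) *\<^sub>R \<psi>1 x + (- a n / m) *\<^sub>R \<phi> x" for x
    show ?thesis
    proof (rule lift[of l \<phi>' "\<lambda>j. a j / m"])
      show "\<forall>x\<in>leaves l. \<phi>' x \<in> E x" unfolding \<phi>'_def
        by (intro ballI subspace_add subspace_scale) (simp_all add: ES E\<phi> 1(3))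
      have "flow_bound \<theta> (3 * (C\<^sub>0 * B) + 3 * B) l \<phi>'"
        unfolding \<phi>'_def
        using mult_right_mono[OF abs3[OF _ m(1), of 1] C0B(1)] mult_right_mono[OF abs3[OF _ m(1), of "- a n"] B] \<alpha>
        by (intro flow_bound_add flow_bound_scale[OF 1(5)] flow_bound_scale[OF fl(1)]) simp_all
      then show "flow_bound \<theta> (3 * (C\<^sub>0 + 1) * B) l \<phi>'" by (simp add: algebra_simps)
      show "total l \<phi>' = (\<Sum>j<n. (a j / m) *\<^sub>R g j)"
        unfolding \<phi>'_def total_add total_scale 1(7) sum' h_def[symmetric]
        by (simp add: scaleR_add_right scaleR_right.sum)
    qed (use assms m in auto)
  next
    case right
    then obtain m where m: "m \<ge> 1/3" "normalized n (\<lambda>j. (b j + b n * v j) / m)"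
      using normalized_divide[of n "1/3" "\<lambda>j. b j + b n * v j"] by auto
    \<comment> \<open>On the right child \<open>h\<close> occurs in the original total with
      coefficient -1, so adding \<open>b n\<close> times the original flow removes it.\<close>
    define \<phi>' where "\<phi>' x = (1 / m) *\<^sub>R \<psi>2 x + (b n / m) *\<^sub>R \<phi> x" for x
    have tr': "total r \<phi> = (\<Sum>j<n. v j *\<^sub>R g j) - h" using tot by (simp add: h_def algebra_simps)
    show ?thesis
    proof (rule lift[of r \<phi>' "\<lambda>j. (b j + b n * v j) / m"])
      show "\<forall>x\<in>leaves r. \<phi>' x \<in> E x" unfolding \<phi>'_def
        by (intro ballI subspace_add subspace_scale) (simp_all add: ES E\<phi> 2(3))
      have "flow_bound \<theta> (3 * (C\<^sub>0 * B) + 3 * B) r \<phi>'"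
        unfolding \<phi>'_def
        using mult_right_mono[OF abs3[OF _ m(1), of 1] C0B(1)] mult_right_mono[OF abs3[OF _ m(1), of "b n"] B] \<alpha>
        by (intro flow_bound_add flow_bound_scale[OF 2(5)] flow_bound_scale[OF fl(2)]) simp_all
      then show "flow_bound \<theta> (3 * (C\<^sub>0 + 1) * B) r \<phi>'" by (simp add: algebra_simps)
      show "total r \<phi>' = (\<Sum>j<n. ((b j + b n * v j) / m) *\<^sub>R g j)"
      proof -
        have "total r \<phi>' = ((1 / m) *\<^sub>R (\<Sum>j<n. b j *\<^sub>R g j) + (b n / m) *\<^sub>R (\<Sum>j<n. v j *\<^sub>R g j)) +
            ((1 / m * b n) *\<^sub>R h - (b n / m) *\<^sub>R h)"
          unfolding \<phi>'_def total_add total_scale 2(7) sum' tr' scaleR_add_right scaleR_diff_right scaleR_scaleR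
          by (simp only: ac_simps add_diff_eq)
        then show ?thesis unfolding sum_scaleR_combine by (simp add: add_divide_distrib)
      qed
    qed (use assms m in auto)
  qed
qed

text \<open>Outer induction on the level \<open>i\<close>, inner induction on the size, because
  \<open>sparsifies_Nd\<close> needs both levels for the smaller children. One \<open>C\<close>
  serves all trees up to a given size, whatever bodies they carry.\<close>

lemma sparsifies_exists:
  "\<exists>C\<ge>1. \<forall>t :: ('x, 'u) ctree. nested t \<longrightarrow> size t \<le> n \<longrightarrow> sparsifies \<theta> c i t C"
proof (induction i arbitrary: n)
  case 0
  show ?case by (rule exI[of _ "real (Suc c)"]) (auto intro: sparsifies_0)
next
  case (Suc i)
  show ?case
  proof (induction n)
    case 0
    show ?case
    proof (intro exI[of _ 1] conjI allI impI)
      fix t :: "('x, 'u) ctree" assume "size t \<le> 0"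
      then obtain x where "t = Lf x" by (cases t) auto
      then show "sparsifies \<theta> c (Suc i) t 1" by (simp add: sparsifies_Lf)
    qed simp
  next
    case (Suc n)
    obtain C0 where C0: "C0 \<ge> 1" "\<And>t :: ('x, 'u) ctree. nested t \<Longrightarrow> size t \<le> n \<Longrightarrow> sparsifies \<theta> c i t C0"
      using Suc.IH \<open>\<And>n. \<exists>C\<ge>1. \<forall>t :: ('x, 'u) ctree. nested t \<longrightarrow> size t \<le> n \<longrightarrow> sparsifies \<theta> c i t C\<close> by blast
    obtain C1 where C1: "C1 \<ge> 1" "\<And>t :: ('x, 'u) ctree. nested t \<Longrightarrow> size t \<le> n \<Longrightarrow> sparsifies \<theta> c (Suc i) t C1"
      using Suc.IH by blast
    define C where "C = 6 * C0 + 3 * real (Suc c) + 3 * C1 * (C0 + 1)"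
    have "3 * C1 * (C0 + 1) \<ge> 0" using C0(1) C1(1) by simp
    then have C: "C \<ge> 6 * C0" "C \<ge> 3 * real (Suc c)" "C \<ge> 3 * C1 * (C0 + 1)" "C \<ge> 1"
      unfolding C_def using C0(1) C1(1) by linarith+
    show ?case
    proof (intro exI[of _ C] conjI allI impI)
      fix t :: "('x, 'u) ctree" assume t: "nested t" "size t \<le> Suc n"
      show "sparsifies \<theta> c (Suc i) t C"
      proof (cases t)
        case (Lf x)
        then show ?thesis using C(4) by (simp add: sparsifies_Lf)
      next
        case (Nd U l r)
        then show ?thesis using t C0 C1 C
          by (auto intro!: sparsifies_Nd[of U l r c i C0 C1 C])
      qed
    qed (use C in auto)
  qed
qed

end

section \<open>Certificates of unsolvability\<close>

lemma sum_fun_apply: "(\<Sum>x\<in>S. f x) u = (\<Sum>x\<in>S. f x u)"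
  for f :: "'a \<Rightarrow> 'b \<Rightarrow> 'c::comm_monoid_add"
  by (induction S rule: infinite_finite_induct) auto

lemma dependent_span:
  fixes f :: "nat \<Rightarrow> 'w::real_vector"
  assumes "finite S" "card S \<le> m" "\<And>j. j \<le> m \<Longrightarrow> f j \<in> span S"
  shows "\<exists>a. (\<exists>j\<le>m. a j \<noteq> 0) \<and> (\<Sum>j\<le>m. a j *\<^sub>R f j) = 0"
proof -
  have "\<exists>u. j \<le> m \<longrightarrow> f j = (\<Sum>s\<in>S. u s *\<^sub>R s)" for j
    using assms(3)[of j] span_finite[OF assms(1)] by auto
  then obtain u where u: "\<And>j. j \<le> m \<Longrightarrow> f j = (\<Sum>s\<in>S. u j s *\<^sub>R s)" by metis
  obtain h where h: "bij_betw h {0..<card S} S"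
    using ex_bij_betw_nat_finite[OF assms(1)] by blast
  obtain a where a: "\<exists>j\<le>m. a j \<noteq> 0" "\<forall>i<m. (\<Sum>j\<le>m. a j * u j (h i)) = 0"
    using dependent_rows[of m "\<lambda>j i. u j (h i)"] by blast
  have z: "(\<Sum>j\<le>m. a j * u j s) = 0" if s: "s \<in> S" for s
  proof -
    obtain i where "i < card S" "s = h i" using s bij_betw_imp_surj_on[OF h] by fastforce
    then show ?thesis using a(2) assms(2) by auto
  qed
  have "(\<Sum>j\<le>m. a j *\<^sub>R f j) = (\<Sum>j\<le>m. \<Sum>s\<in>S. (a j * u j s) *\<^sub>R s)"
    by (intro sum.cong) (auto simp: u scaleR_right.sum)
  also have "\<dots> = (\<Sum>s\<in>S. \<Sum>j\<le>m. (a j * u j s) *\<^sub>R s)" by (rule sum.swap)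
  also have "\<dots> = (\<Sum>s\<in>S. (\<Sum>j\<le>m. a j * u j s) *\<^sub>R s)" by (simp add: scaleR_left.sum)
  also have "\<dots> = 0" by (simp add: z)
  finally show ?thesis using a(1) by blast
qed

text \<open>The linear part of an affine functional. Flow bounds are thus blind to additive
  constants, which leaves these free in a certificate.\<close>

definition aff_test :: "'v::real_vector \<Rightarrow> ('v \<Rightarrow> real) \<Rightarrow> real"
  where "aff_test u h = h u - h 0"

interpretation linear_tests aff_test
  by standard (auto intro!: linearI simp: aff_test_def scaleR_fun_def algebra_simps)

section \<open>Affine functionals on a finite-dimensional space, and their certificates\<close>

locale fin_dim =
  fixes V B :: "'v::real_vector set"
  assumes fin: "finite B" and indep: "independent B" and V: "V = span B"
begin

text \<open>The affine functionals on \<open>V\<close>, as an explicit span whose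
  \<open>card B + 1\<close> generators bound its dimension. The functions are total, but affine
  behaviour is guaranteed only on \<open>V\<close>, as \<open>representation\<close> is 0 off the
  span.\<close>

definition Aff :: "('v \<Rightarrow> real) set"
  where "Aff = span (insert (\<lambda>_. 1) ((\<lambda>b v. representation B v b) ` B))"

lemma subspace_V: "subspace V" by (simp add: V)

lemma subspace_Aff: "subspace Aff" by (simp add: Aff_def)

lemma const_Aff: "(\<lambda>_. c) \<in> Aff"
proof -
  have "c *\<^sub>R (\<lambda>_ :: 'v. 1 :: real) \<in> Aff"
    unfolding Aff_def by (intro span_scale span_base) simp
  then show ?thesis by (simp add: scaleR_fun_def)
qed

lemma coord_Aff: "b \<in> B \<Longrightarrow> (\<lambda>v. representation B v b) \<in> Aff"
  unfolding Aff_def by (intro span_base) simp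

lemma Aff_affine:
  assumes "h \<in> Aff" "v \<in> V" "w \<in> V"
  shows "h (v + w) = h v + h w - h 0" "h (c *\<^sub>R v) = h 0 + c * (h v - h 0)"
proof -
  define P where "P h \<longleftrightarrow> (\<forall>v\<in>V. \<forall>w\<in>V. h (v + w) = h v + h w - h 0) \<and>
    (\<forall>v\<in>V. \<forall>c. h (c *\<^sub>R v) = h 0 + c * (h v - h 0))" for h :: "'v \<Rightarrow> real"
  have "P h" using assms(1) unfolding Aff_def
  proof (induction h rule: span_induct_alt)
    case base
    then show ?case by (simp add: P_def)
  next
    case (step c g h)
    have "P g"
      using step(1) indep unfolding P_def V
      by (auto simp: representation_add representation_scale representation_zero)
    have "(c *\<^sub>R g + h) (v + w) = (c *\<^sub>R g + h) v + (c *\<^sub>R g + h) w - (c *\<^sub>R g + h) 0"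
      if "v \<in> V" "w \<in> V" for v w
    proof -
      have eqs: "g (v + w) = g v + g w - g 0" "h (v + w) = h v + h w - h 0"
        using \<open>P g\<close> step(2) that by (auto simp: P_def)
      show ?thesis unfolding plus_fun_apply scaleR_fun_def real_scaleR_def eqs by (simp add: algebra_simps)
    qed
    moreover have "(c *\<^sub>R g + h) (d *\<^sub>R v) = (c *\<^sub>R g + h) 0 + d * ((c *\<^sub>R g + h) v - (c *\<^sub>R g + h) 0)"
      if "v \<in> V" for v d
    proof -
      have eqs: "g (d *\<^sub>R v) = g 0 + d * (g v - g 0)" "h (d *\<^sub>R v) = h 0 + d * (h v - h 0)"
        using \<open>P g\<close> step(2) that by (auto simp: P_def)
      show ?thesis unfolding plus_fun_apply scaleR_fun_def real_scaleR_def eqs by (simp add: algebra_simps)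
    qed
    ultimately show ?case unfolding P_def by blast
  qed
  then show "h (v + w) = h v + h w - h 0" "h (c *\<^sub>R v) = h 0 + c * (h v - h 0)"
    using assms by (auto simp: P_def)
qed

lemma Aff_diff:
  assumes "h \<in> Aff" "v \<in> V" "w \<in> V"
  shows "h v - h w = aff_test (v - w) h"
  using Aff_affine(1)[OF assms(1), of "v - w" w] assms subspace_diff[OF subspace_V]
  by (simp add: aff_test_def)

lemma Aff_zero_on_span:
  assumes h: "h \<in> Aff" and S: "S \<subseteq> V" "\<And>s. s \<in> S \<Longrightarrow> h s = h 0" and v: "v \<in> span S"
  shows "h v = h 0"
proof -
  have "v \<in> V \<and> h v = h 0" using v
  proof (induction v rule: span_induct_alt)
    case base
    then show ?case using subspace_0[OF subspace_V] by simp
  next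
    case (step c s v)
    then have s: "s \<in> V" "c *\<^sub>R s \<in> V" using S subspace_scale[OF subspace_V] by auto
    then show ?case
      using step S(2) Aff_affine(1)[OF h s(2), of v] Aff_affine(2)[OF h s(1) s(1), of c]
        subspace_add[OF subspace_V s(2), of v] by simp
  qed
  then show ?thesis by simp
qed

definition vanish :: "'v set \<Rightarrow> ('v \<Rightarrow> real) set"
  where "vanish X = {h \<in> Aff. \<forall>p\<in>X. h p = 0}"

lemma subspace_vanish: "subspace (vanish X)"
  unfolding vanish_def using subspace_Aff by (auto simp: subspace_def scaleR_fun_def)

text \<open>To vanish on \<open>X\<close> it suffices to vanish at one point and to have zero linear
  part on a basis of the direction space. These are at most \<open>l + 1\<close> linear conditions,
  one fewer than the \<open>l + 2\<close> functionals supplied by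
  \<open>codim_le (Suc l)\<close>.\<close>

lemma codim_vanish:
  assumes "X \<subseteq> V" "X \<noteq> {}" "affine_dim X \<le> l"
  shows "codim_le (Suc l) Aff (vanish X)"
  unfolding codim_le_def
proof (intro allI impI)
  fix g :: "nat \<Rightarrow> 'v \<Rightarrow> real" assume g: "\<forall>j\<le>Suc l. g j \<in> Aff"
  define W where "W = {p - q | p q. p \<in> affine hull X \<and> q \<in> affine hull X}"
  have "affine V" by (rule subspace_imp_affine[OF subspace_V])
  then have "affine hull X \<subseteq> V" using assms(1) by (rule hull_minimal[rotated])
  then have WV: "W \<subseteq> V" unfolding W_def using subspace_diff[OF subspace_V] by auto
  obtain B' where B': "B' \<subseteq> W" "independent B'" "W \<subseteq> span B'" "card B' = dim W"
    using basis_exists by blast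
  have "finite B'" using independent_span_bound[OF fin B'(2)] B'(1) WV V by blast
  obtain h where h: "bij_betw h {0..<card B'} B'"
    using ex_bij_betw_nat_finite[OF \<open>finite B'\<close>] by blast
  have cB: "card B' \<le> l" using assms(3) B'(4) by (simp add: affine_dim_def W_def)
  obtain p0 where p0: "p0 \<in> X" using assms(2) by blast
  \<comment> \<open>Column 0 is evaluation at \<open>p0\<close>, column \<open>i + 1\<close> the
    linear part along the basis vector \<open>h i\<close>. Columns beyond \<open>card B'\<close>
    only impose extra conditions.\<close>
  define F where "F j i = (if i = 0 then g j p0 else g j (h (i - 1)) - g j 0)" for j i
  obtain a where a: "\<exists>j\<le>Suc l. a j \<noteq> 0" "\<forall>i<Suc l. (\<Sum>j\<le>Suc l. a j * F j i) = 0"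
    using dependent_rows[of "Suc l" F] by blast
  have "\<exists>j<Suc (Suc l). a j \<noteq> 0" using a(1) by (simp add: less_Suc_eq_le)
  then obtain m where m: "m > 0" "normalized (Suc (Suc l)) (\<lambda>j. a j / m)"
    by (rule normalized_nonzero)
  define k where "k = (\<Sum>j\<le>Suc l. a j *\<^sub>R g j)"
  have kA: "k \<in> Aff" unfolding k_def
    by (rule subspace_sum[OF subspace_Aff], rule subspace_scale[OF subspace_Aff]) (use g in auto)
  have kv: "k v = (\<Sum>j\<le>Suc l. a j * g j v)" for v
    by (simp add: k_def sum_fun_apply scaleR_fun_def)
  have k0: "k p0 = 0" using a(2)[rule_format, of 0] by (simp add: kv F_def)
  have kb: "k b = k 0" if b: "b \<in> B'" for b
  proof -
    obtain i where i: "i < card B'" "b = h i" using b bij_betw_imp_surj_on[OF h] by fastforce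
    have "Suc i < Suc l" using i(1) cB by simp
    then have "(\<Sum>j\<le>Suc l. a j * F j (Suc i)) = 0" using a(2) by blast
    moreover have "(\<Sum>j\<le>Suc l. a j * F j (Suc i)) = (\<Sum>j\<le>Suc l. a j * g j b - a j * g j 0)"
      by (intro sum.cong) (simp_all add: F_def i(2) right_diff_distrib)
    ultimately show ?thesis unfolding kv sum_subtractf by simp
  qed
  have "k p = 0" if p: "p \<in> X" for p
  proof -
    have "p - p0 \<in> W" unfolding W_def using hull_inc[OF p] hull_inc[OF p0] by (intro CollectI exI[of _ p] exI[of _ p0]) simp
    then have "p - p0 \<in> span B'" using B'(3) by (rule subsetD[rotated])
    then have "k (p - p0) = k 0"
      by (rule Aff_zero_on_span[OF kA, rotated 2]) (use B'(1) WV kb in auto)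
    moreover have "k p - k p0 = aff_test (p - p0) k"
      by (rule Aff_diff[OF kA]) (use p p0 assms(1) in auto)
    ultimately show ?thesis using k0 by (simp add: aff_test_def)
  qed
  then have "k \<in> vanish X" using kA by (simp add: vanish_def)
  then have "(1 / m) *\<^sub>R k \<in> vanish X" by (rule subspace_scale[OF subspace_vanish])
  also have "(1 / m) *\<^sub>R k = (\<Sum>j<Suc (Suc l). (a j / m) *\<^sub>R g j)"
    unfolding k_def scaleR_right.sum lessThan_Suc_atMost by simp
  finally show "\<exists>a. normalized (Suc (Suc l)) a \<and> (\<Sum>j<Suc (Suc l). a j *\<^sub>R g j) \<in> vanish X"
    using m(2) by blast
qed

text \<open>Together with a nonzero \<open>e\<close> in \<open>E\<close>, \<open>card B + 1\<close>
  functionals are too many for a space of dimension at most \<open>card B + 1\<close>. In the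
  resulting relation they cannot all have coefficient 0, since \<open>e\<close> is nonzero.\<close>

lemma codim_nonzero:
  assumes E: "subspace E" "E \<subseteq> Aff" "E \<noteq> {0}"
  shows "codim_le (card B) Aff E"
  unfolding codim_le_def
proof (intro allI impI)
  fix g :: "nat \<Rightarrow> 'v \<Rightarrow> real" assume g: "\<forall>j\<le>card B. g j \<in> Aff"
  obtain e where e: "e \<in> E" "e \<noteq> 0" using E(3) subspace_0[OF E(1)] by blast
  define S where "S = insert (\<lambda>_. 1) ((\<lambda>b v. representation B v b) ` B)"
  have S: "finite S" "card S \<le> Suc (card B)"
    unfolding S_def using fin card_image_le[OF fin] by (auto simp: card_insert_if le_SucI)
  define f where "f = g(Suc (card B) := e)"
  have "f j \<in> span S" if "j \<le> Suc (card B)" for j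
    using g e(1) E(2) that by (auto simp: f_def S_def Aff_def[symmetric])
  then obtain a where a: "\<exists>j\<le>Suc (card B). a j \<noteq> 0" "(\<Sum>j\<le>Suc (card B). a j *\<^sub>R f j) = 0"
    using dependent_span[OF S] by blast
  have "(\<Sum>j\<le>card B. a j *\<^sub>R f j) = (\<Sum>j\<le>card B. a j *\<^sub>R g j)"
    by (intro sum.cong) (auto simp: f_def)
  then have eq: "(\<Sum>j\<le>card B. a j *\<^sub>R g j) = - (a (Suc (card B)) *\<^sub>R e)"
    using a(2) by (simp add: f_def eq_neg_iff_add_eq_0)
  have "\<exists>j\<le>card B. a j \<noteq> 0"
  proof (rule ccontr)
    assume no: "\<not> ?thesis"
    then have "a (Suc (card B)) *\<^sub>R e = 0" using eq by simp
    then show False using no a(1) e(2) by (auto simp: le_Suc_eq)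
  qed
  then have "\<exists>j<Suc (card B). a j \<noteq> 0" by (simp add: less_Suc_eq_le)
  then obtain m where m: "m > 0" "normalized (Suc (card B)) (\<lambda>j. a j / m)"
    by (rule normalized_nonzero)
  have "(1 / m) *\<^sub>R (\<Sum>j\<le>card B. a j *\<^sub>R g j) \<in> E"
    unfolding eq by (intro subspace_scale subspace_neg E(1) e(1))
  also have "(1 / m) *\<^sub>R (\<Sum>j\<le>card B. a j *\<^sub>R g j) = (\<Sum>j<Suc (card B). (a j / m) *\<^sub>R g j)"
    unfolding scaleR_right.sum lessThan_Suc_atMost by simp
  finally show "\<exists>a. normalized (Suc (card B)) a \<and> (\<Sum>j<Suc (card B). a j *\<^sub>R g j) \<in> E"
    using m(2) by blast
qed

lemma codim_le_mono: "codim_le c A E \<Longrightarrow> E \<subseteq> E' \<Longrightarrow> codim_le c A E'"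
  unfolding codim_le_def by blast

text \<open>A dual obstruction: for a selection \<open>P\<close> the sum of the
  \<open>\<phi> x (P x)\<close> is nonnegative, whereas moving all \<open>P x\<close> to a common
  point of \<open>V\<close> turns the sum into -1. The flow bound controls the cost of this move, so
  a small \<epsilon> excludes selections with a moderate Lipschitz constant.\<close>

definition certificate :: "('x, 'v) ctree \<Rightarrow> ('x \<Rightarrow> 'v set) \<Rightarrow> real \<Rightarrow> ('x \<Rightarrow> 'v \<Rightarrow> real) \<Rightarrow> bool"
  where "certificate t G \<epsilon> \<phi> \<longleftrightarrow> (\<forall>x\<in>leaves t. \<phi> x \<in> Aff \<and> (\<forall>p\<in>G x. \<phi> x p \<ge> 0)) \<and>
    total t \<phi> = (\<lambda>_. -1) \<and> flow_bound aff_test \<epsilon> t \<phi>"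

text \<open>
  The sparse flow \<open>\<psi>\<close> need not be nonnegative on the sets \<open>G x\<close>, as \<open>\<phi> x\<close> may enter it with a
  negative coefficient. Then \<open>\<phi> + \<tau> \<psi>\<close> is followed until the first of the functionals vanishes on
  its set.
\<close>

lemma sparse_certificate_step:
  fixes t :: "('x, 'v) ctree"
  assumes nest: "nested t"
    and G: "\<And>x. x \<in> leaves t \<Longrightarrow> G x \<subseteq> V \<and> G x \<noteq> {} \<and> affine_dim (G x) \<le> l"
    and c: "c = min (l + 1) (card B)"
    and sp: "sparsifies aff_test c c t C" and C: "C \<ge> 1" and \<epsilon>: "\<epsilon> \<ge> 0"
    and cert: "certificate t G \<epsilon> \<phi>"
  shows "(\<exists>R \<psi>. R \<subseteq> leaves t \<and> card R \<le> 2 ^ c \<and> (\<forall>x. x \<notin> R \<longrightarrow> \<psi> x = 0) \<and> certificate t G (C * \<epsilon>) \<psi>) \<or>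
    (\<exists>\<phi>'. certificate t G (C * \<epsilon>) \<phi>' \<and>
      {x \<in> leaves t. \<phi>' x \<notin> vanish (G x)} \<subset> {x \<in> leaves t. \<phi> x \<notin> vanish (G x)})"
proof -
  have \<phi>: "\<And>x. x \<in> leaves t \<Longrightarrow> \<phi> x \<in> Aff" "\<And>x p. x \<in> leaves t \<Longrightarrow> p \<in> G x \<Longrightarrow> \<phi> x p \<ge> 0"
    "total t \<phi> = (\<lambda>_. -1)" "flow_bound aff_test \<epsilon> t \<phi>"
    using cert by (auto simp: certificate_def)
  \<comment> \<open>On \<open>G x\<close> every member of \<open>E x\<close> is a multiple of
    \<open>\<phi> x\<close>, so its sign there is governed by one number.\<close>
  define E where "E x = span (insert (\<phi> x) (vanish (G x)))" for x
  have E_iff: "h \<in> E x \<longleftrightarrow> (\<exists>k. h - k *\<^sub>R \<phi> x \<in> vanish (G x))" for h x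
  proof -
    have eq: "span (vanish (G x)) = vanish (G x)" using subspace_vanish span_eq_iff by blast
    show ?thesis unfolding E_def span_insert eq by simp
  qed
  have EA: "E x \<subseteq> Aff" if "x \<in> leaves t" for x
    unfolding E_def using \<phi>(1)[OF that]
    by (intro span_minimal subspace_Aff) (auto simp: vanish_def)
  have Ecod: "codim_le c Aff (E x)" if x: "x \<in> leaves t" and ne: "E x \<noteq> {0}" for x
  proof (cases "l + 1 \<le> card B")
    case True
    have "codim_le (Suc l) Aff (vanish (G x))" using G[OF x] by (intro codim_vanish) auto
    then show ?thesis using True c
      by (auto simp: E_def intro!: codim_le_mono[of "Suc l" Aff "vanish (G x)"] span_base)
  next
    case False
    then show ?thesis using codim_nonzero[of "E x"] EA[OF x] ne c by (simp add: E_def)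
  qed
  \<comment> \<open>The only functional at the root is the constant -1; its linear part is 0, so
    every test set is admissible. With \<open>r = 1\<close> and \<open>i = c\<close> the count
    \<open>r + i = Suc c\<close> is met.\<close>
  have tb: "test_bound aff_test UNIV \<epsilon> (\<lambda>_. -1)" using \<epsilon> by (simp add: test_bound_def aff_test_def)
  obtain R \<psi>0 a where R: "R \<subseteq> leaves t" "card R \<le> 2 ^ c" "\<And>x. x \<in> leaves t \<Longrightarrow> \<psi>0 x \<in> E x"
      "\<And>x. x \<notin> R \<Longrightarrow> \<psi>0 x = 0" "flow_bound aff_test (C * \<epsilon>) t \<psi>0" "normalized 1 a"
      "total t \<psi>0 = (\<Sum>j<1. a j *\<^sub>R (\<lambda>_. -1))"
  proof (rule sparsifiesE[OF sp subspace_Aff, of UNIV E \<phi> \<epsilon> 1 "\<lambda>_ _. -1" "\<lambda>_. 1"])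
    show "fits UNIV t" by (cases t) auto
    fix x assume x: "x \<in> leaves t"
    have "\<phi> x \<in> E x" unfolding E_def by (intro span_base) simp
    then show "subspace (E x) \<and> E x \<subseteq> Aff \<and> (E x \<noteq> {0} \<longrightarrow> codim_le c Aff (E x)) \<and> \<phi> x \<in> E x"
      using EA[OF x] Ecod[OF x] by (simp add: E_def)
  qed (use \<phi> \<epsilon> tb const_Aff in \<open>auto simp: normalized_def\<close>)
  have a0: "\<bar>a 0\<bar> = 1" using R(6) by (auto simp: normalized_def)
  then have aa: "a 0 * a 0 = 1" by (metis abs_mult_self_eq mult_1)
  \<comment> \<open>The coefficient \<open>a 0\<close> is 1 or -1; multiplying by it restores the
    total -1.\<close>
  define \<psi> where "\<psi> x = a 0 *\<^sub>R \<psi>0 x" for x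
  have \<psi>E: "\<psi> x \<in> E x" if "x \<in> leaves t" for x
    unfolding \<psi>_def using R(3)[OF that] by (simp add: E_def span_scale)
  have \<psi>tot: "total t \<psi> = (\<lambda>_. -1)"
    unfolding \<psi>_def total_scale R(7) using aa by (simp add: scaleR_fun_def)
  have \<psi>flow: "flow_bound aff_test (C * \<epsilon>) t \<psi>"
    unfolding \<psi>_def by (rule flow_bound_scale[OF R(5)]) (simp add: a0)
  \<comment> \<open>Where \<open>\<phi> x\<close> vanishes on \<open>G x\<close>, every
    \<open>k\<close> would do. The choice 0 forces the most negative \<open>k\<close> to occur where
    \<open>\<phi> x\<close> does not vanish, which makes the inclusion at the end strict.\<close>
  have "\<exists>k. x \<in> leaves t \<longrightarrow> \<psi> x - k *\<^sub>R \<phi> x \<in> vanish (G x) \<and> (\<phi> x \<in> vanish (G x) \<longrightarrow> k = 0)" for x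
  proof (cases "x \<in> leaves t \<and> \<phi> x \<in> vanish (G x)")
    case True
    then obtain k where "\<psi> x - k *\<^sub>R \<phi> x \<in> vanish (G x)" using \<psi>E[of x] E_iff by metis
    then have "(\<psi> x - k *\<^sub>R \<phi> x) + k *\<^sub>R \<phi> x \<in> vanish (G x)"
      using True by (intro subspace_add subspace_scale subspace_vanish) auto
    then show ?thesis by (intro exI[of _ 0]) simp
  next
    case False
    then show ?thesis using \<psi>E[of x] E_iff[of "\<psi> x" x] by auto
  qed
  then obtain k where k: "\<And>x. x \<in> leaves t \<Longrightarrow> \<psi> x - k x *\<^sub>R \<phi> x \<in> vanish (G x)"
    "\<And>x. x \<in> leaves t \<Longrightarrow> \<phi> x \<in> vanish (G x) \<Longrightarrow> k x = 0" by metis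
  have \<psi>G: "\<psi> x p = k x * \<phi> x p" if "x \<in> leaves t" "p \<in> G x" for x p
    using k(1)[OF that(1)] that(2) by (auto simp: vanish_def scaleR_fun_def)
  have \<psi>A: "\<psi> x \<in> Aff" if "x \<in> leaves t" for x using \<psi>E[OF that] EA[OF that] by (rule subsetD[rotated])
  show ?thesis
  proof (cases "\<forall>x\<in>leaves t. k x \<ge> 0")
    case True
    then have "certificate t G (C * \<epsilon>) \<psi>"
      unfolding certificate_def using \<psi>A \<psi>tot \<psi>flow \<psi>G \<phi>(2) by simp
    moreover have "\<forall>x. x \<notin> R \<longrightarrow> \<psi> x = 0" using R(4) by (simp add: \<psi>_def)
    ultimately show ?thesis using R(1,2) by metis
  next
    case False
    define m where "m = Max ((\<lambda>x. - k x) ` leaves t)"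
    have m_ge: "- k x \<le> m" if "x \<in> leaves t" for x
      unfolding m_def using that by (intro Max_ge) auto
    have "m \<in> (\<lambda>x. - k x) ` leaves t" unfolding m_def by (rule Max_in) auto
    then obtain x0 where x0: "x0 \<in> leaves t" "m = - k x0" by auto
    have "m > 0" using False m_ge by force
    \<comment> \<open>The first parameter at which some \<open>1 + \<tau> * k x\<close> reaches
      0.\<close>
    define \<tau> where "\<tau> = 1 / m"
    have \<tau>: "\<tau> > 0" "1 + \<tau> * k x0 = 0" using \<open>m > 0\<close> x0 by (auto simp: \<tau>_def)
    have \<tau>k: "1 + \<tau> * k x \<ge> 0" if "x \<in> leaves t" for x
      using m_ge[OF that] \<open>m > 0\<close> by (simp add: \<tau>_def field_simps)
    \<comment> \<open>Dividing \<open>\<phi> + \<tau> \<psi>\<close> by \<open>1 + \<tau>\<close>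
      restores the total -1 and makes it a convex combination, so the flow bound stays at
      \<open>C * \<epsilon>\<close>.\<close>
    define \<phi>' where "\<phi>' x = (1 / (1 + \<tau>)) *\<^sub>R \<phi> x + (\<tau> / (1 + \<tau>)) *\<^sub>R \<psi> x" for x
    have \<phi>'A: "\<phi>' x \<in> Aff" if "x \<in> leaves t" for x
      unfolding \<phi>'_def by (intro subspace_add subspace_scale subspace_Aff \<phi>(1) \<psi>A that)
    have \<phi>'G: "\<phi>' x p = (1 + \<tau> * k x) / (1 + \<tau>) * \<phi> x p" if "x \<in> leaves t" "p \<in> G x" for x p
      unfolding \<phi>'_def using \<psi>G[OF that] \<tau>(1)
      by (simp add: scaleR_fun_def divide_simps) (simp add: algebra_simps)
    have "certificate t G (C * \<epsilon>) \<phi>'" unfolding certificate_def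
    proof (intro conjI ballI)
      show "\<phi>' x \<in> Aff" if "x \<in> leaves t" for x by (rule \<phi>'A[OF that])
      show "\<phi>' x p \<ge> 0" if "x \<in> leaves t" "p \<in> G x" for x p
        unfolding \<phi>'G[OF that] using \<tau>k[OF that(1)] \<phi>(2)[OF that] \<tau>(1) by simp
      show "total t \<phi>' = (\<lambda>_. -1)"
        unfolding \<phi>'_def total_add total_scale \<phi>(3) \<psi>tot
        using \<tau>(1) by (auto simp: fun_eq_iff scaleR_fun_def divide_simps)
      have "flow_bound aff_test (1 / (1 + \<tau>) * \<epsilon> + \<tau> / (1 + \<tau>) * (C * \<epsilon>)) t \<phi>'"
        unfolding \<phi>'_def using \<tau>(1)
        by (intro flow_bound_add flow_bound_scale[OF \<phi>(4)] flow_bound_scale[OF \<psi>flow]) auto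
      moreover have "1 / (1 + \<tau>) * \<epsilon> + \<tau> / (1 + \<tau>) * (C * \<epsilon>) \<le> C * \<epsilon>"
      proof -
        have "1 * \<epsilon> \<le> C * \<epsilon>" using C \<epsilon> by (rule mult_right_mono)
        then have "1 / (1 + \<tau>) * \<epsilon> \<le> 1 / (1 + \<tau>) * (C * \<epsilon>)" using \<tau>(1) by (intro mult_left_mono) auto
        moreover have "1 / (1 + \<tau>) * (C * \<epsilon>) + \<tau> / (1 + \<tau>) * (C * \<epsilon>) = C * \<epsilon>"
        proof -
          have "1 / (1 + \<tau>) * (C * \<epsilon>) + \<tau> / (1 + \<tau>) * (C * \<epsilon>) = (1 + \<tau>) / (1 + \<tau>) * (C * \<epsilon>)"
            by (simp only: add_divide_distrib distrib_right)
          then show ?thesis using \<tau>(1) by simp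
        qed
        ultimately show ?thesis by linarith
      qed
      ultimately show "flow_bound aff_test (C * \<epsilon>) t \<phi>'" by (rule flow_bound_mono)
    qed
    moreover have "{x \<in> leaves t. \<phi>' x \<notin> vanish (G x)} \<subset> {x \<in> leaves t. \<phi> x \<notin> vanish (G x)}"
    proof (rule psubsetI)
      show "{x \<in> leaves t. \<phi>' x \<notin> vanish (G x)} \<subseteq> {x \<in> leaves t. \<phi> x \<notin> vanish (G x)}"
        using \<phi>'A \<phi>'G by (auto simp: vanish_def)
      have "\<phi>' x0 \<in> vanish (G x0)" using \<phi>'A[OF x0(1)] \<phi>'G[OF x0(1)] \<tau>(2) by (simp add: vanish_def)
      moreover have "\<phi> x0 \<notin> vanish (G x0)" using k(2)[OF x0(1)] x0(2) \<open>m > 0\<close> by auto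
      ultimately show "{x \<in> leaves t. \<phi>' x \<notin> vanish (G x)} \<noteq> {x \<in> leaves t. \<phi> x \<notin> vanish (G x)}"
        using x0(1) by blast
    qed
    ultimately show ?thesis by blast
  qed
qed

text \<open>Each unsuccessful round costs a factor \<open>C\<close> and makes at least one more
  functional vanish on its set. There are at most \<open>card (leaves t)\<close> of them before the
  sparse one, which explains the exponent.\<close>

lemma sparse_certificate:
  fixes t :: "('x, 'v) ctree"
  assumes nest: "nested t"
    and G: "\<And>x. x \<in> leaves t \<Longrightarrow> G x \<subseteq> V \<and> G x \<noteq> {} \<and> affine_dim (G x) \<le> l"
    and c: "c = min (l + 1) (card B)"
    and sp: "sparsifies aff_test c c t C" and C: "C \<ge> 1" and \<epsilon>: "\<epsilon> \<ge> 0"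
    and cert: "certificate t G \<epsilon> \<phi>"
  shows "\<exists>R \<psi>. R \<subseteq> leaves t \<and> card R \<le> 2 ^ c \<and> (\<forall>x. x \<notin> R \<longrightarrow> \<psi> x = 0) \<and>
    certificate t G (C ^ Suc (card (leaves t)) * \<epsilon>) \<psi>"
proof -
  define bad where "bad \<phi> = {x \<in> leaves t. \<phi> x \<notin> vanish (G x)}" for \<phi>
  have mono: "certificate t G \<epsilon>' \<psi>" if "certificate t G \<epsilon> \<psi>" "\<epsilon> \<le> \<epsilon>'" for \<epsilon> \<epsilon>' \<psi>
    unfolding certificate_def
  proof (intro conjI)
    show "flow_bound aff_test \<epsilon>' t \<psi>"
      using that(1) unfolding certificate_def by (intro flow_bound_mono[OF _ that(2)]) simp
  qed (use that(1) in \<open>simp_all add: certificate_def\<close>)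
  have "\<exists>R \<psi>. R \<subseteq> leaves t \<and> card R \<le> 2 ^ c \<and> (\<forall>x. x \<notin> R \<longrightarrow> \<psi> x = 0) \<and>
      certificate t G (C ^ Suc (card (bad \<phi>)) * \<epsilon>) \<psi>"
    if "certificate t G \<epsilon> \<phi>" "\<epsilon> \<ge> 0" for \<epsilon> \<phi>
    using that
  proof (induction "card (bad \<phi>)" arbitrary: \<phi> \<epsilon> rule: less_induct)
    case less
    have C\<epsilon>: "C * \<epsilon> \<ge> 0" using C less.prems(2) by simp
    have "(\<exists>R \<psi>. R \<subseteq> leaves t \<and> card R \<le> 2 ^ c \<and> (\<forall>x. x \<notin> R \<longrightarrow> \<psi> x = 0) \<and> certificate t G (C * \<epsilon>) \<psi>) \<or>
        (\<exists>\<phi>'. certificate t G (C * \<epsilon>) \<phi>' \<and> bad \<phi>' \<subset> bad \<phi>)"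
      unfolding bad_def by (rule sparse_certificate_step[OF nest G c sp C less.prems(2,1)])
    then show ?case
    proof (elim disjE exE conjE, goal_cases)
      case (1 R \<psi>)
      have "1 * (C * \<epsilon>) \<le> C ^ card (bad \<phi>) * (C * \<epsilon>)"
        using C by (intro mult_right_mono[OF _ C\<epsilon>] one_le_power)
      then have "C * \<epsilon> \<le> C ^ Suc (card (bad \<phi>)) * \<epsilon>" by (simp only: power_Suc2 mult.assoc mult_1)
      then have "certificate t G (C ^ Suc (card (bad \<phi>)) * \<epsilon>) \<psi>" by (rule mono[OF 1(4)])
      with 1(1-3) show ?case by (intro exI[of _ R] exI[of _ \<psi>] conjI)
    next
      case (2 \<phi>')
      have "finite (bad \<phi>)" by (simp add: bad_def)
      then have lt: "card (bad \<phi>') < card (bad \<phi>)" using 2(2) by (rule psubset_card_mono)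
      obtain R \<psi> where R: "R \<subseteq> leaves t" "card R \<le> 2 ^ c" "\<forall>x. x \<notin> R \<longrightarrow> \<psi> x = 0"
        "certificate t G (C ^ Suc (card (bad \<phi>')) * (C * \<epsilon>)) \<psi>"
        using less.hyps[OF lt 2(1) C\<epsilon>] by blast
      have "C ^ Suc (card (bad \<phi>')) * (C * \<epsilon>) \<le> C ^ card (bad \<phi>) * (C * \<epsilon>)"
        using C lt by (intro mult_right_mono[OF _ C\<epsilon>] power_increasing) auto
      then have "C ^ Suc (card (bad \<phi>')) * (C * \<epsilon>) \<le> C ^ Suc (card (bad \<phi>)) * \<epsilon>"
        by (simp only: power_Suc2 mult.assoc)
      then have "certificate t G (C ^ Suc (card (bad \<phi>)) * \<epsilon>) \<psi>" by (rule mono[OF R(4)])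
      with R(1-3) show ?case by (intro exI[of _ R] exI[of _ \<psi>] conjI)
    qed
  qed
  then obtain R \<psi> where R: "R \<subseteq> leaves t" "card R \<le> 2 ^ c" "\<forall>x. x \<notin> R \<longrightarrow> \<psi> x = 0"
    "certificate t G (C ^ Suc (card (bad \<phi>)) * \<epsilon>) \<psi>"
    using cert \<epsilon> by blast
  have "card (bad \<phi>) \<le> card (leaves t)" by (intro card_mono) (auto simp: bad_def)
  then have "C ^ Suc (card (bad \<phi>)) * \<epsilon> \<le> C ^ Suc (card (leaves t)) * \<epsilon>"
    using C by (intro mult_right_mono[OF _ \<epsilon>] power_increasing) auto
  then have "certificate t G (C ^ Suc (card (leaves t)) * \<epsilon>) \<psi>" by (rule mono[OF R(4)])
  with R(1-3) show ?thesis by (intro exI[of _ R] exI[of _ \<psi>] conjI)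
qed

end

section \<open>Lipschitz families on trees and their duality with certificates\<close>

primrec nodes :: "('x, 'u) ctree \<Rightarrow> 'u set set" where
  "nodes (Lf x) = {}"
| "nodes (Nd U l r) = insert U (nodes l \<union> nodes r)"

text \<open>Two points are constrained only at the node separating them. The parameter
  \<open>R\<close> restricts the condition to a subset while the tree stays the same. One order of
  \<open>x\<close> and \<open>y\<close> is enough for the symmetric bodies considered.\<close>

primrec lipschitz_on_tree :: "'x set \<Rightarrow> real \<Rightarrow> ('x, 'v::real_vector) ctree \<Rightarrow> ('x \<Rightarrow> 'v) \<Rightarrow> bool" where
  "lipschitz_on_tree R K (Lf x) Q \<longleftrightarrow> True"
| "lipschitz_on_tree R K (Nd U l r) Q \<longleftrightarrow> lipschitz_on_tree R K l Q \<and> lipschitz_on_tree R K r Q \<and>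
    (\<forall>x\<in>leaves l \<inter> R. \<forall>y\<in>leaves r \<inter> R. (1 / K) *\<^sub>R (Q x - Q y) \<in> U)"

text \<open>A convex, symmetric, absorbing set: the unit ball of a seminorm on \<open>V\<close>, up
  to its boundary.\<close>

definition ball_like :: "'v::real_vector set \<Rightarrow> 'v set \<Rightarrow> bool"
  where "ball_like V U \<longleftrightarrow> U \<subseteq> V \<and> convex U \<and> 0 \<in> U \<and> (\<forall>u\<in>U. - u \<in> U) \<and>
    (\<forall>v\<in>V. \<exists>\<tau>>0. \<tau> *\<^sub>R v \<in> U)"

lemma finite_nodes [simp]: "finite (nodes t)"
  by (induction t) auto

lemma ball_like_self: "subspace V \<Longrightarrow> ball_like V V"
  unfolding ball_like_def
  by (auto simp: subspace_0 subspace_neg subspace_imp_convex intro!: exI[of _ 1])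

lemma lipschitz_on_tree_cong:
  "(\<And>x. x \<in> leaves t \<Longrightarrow> P x = Q x) \<Longrightarrow> lipschitz_on_tree R K t P = lipschitz_on_tree R K t Q"
proof (induction t)
  case (Nd U l r)
  then show ?case by simp
qed auto

lemma lipschitz_on_tree_const:
  assumes "\<forall>U\<in>nodes t. ball_like V U" "\<And>x. x \<in> leaves t \<Longrightarrow> Q x = v"
  shows "lipschitz_on_tree R K t Q"
  using assms by (induction t) (auto simp: ball_like_def)

lemma lipschitz_on_tree_convex:
  assumes "\<forall>U\<in>nodes t. ball_like V U" "lipschitz_on_tree R K t P" "lipschitz_on_tree R K t Q"
    "a \<ge> 0" "b \<ge> 0" "a + b = (1 :: real)"
  shows "lipschitz_on_tree R K t (\<lambda>x. a *\<^sub>R P x + b *\<^sub>R Q x)"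
  using assms
proof (induction t)
  case (Nd U l r)
  have "(1 / K) *\<^sub>R ((a *\<^sub>R P x + b *\<^sub>R Q x) - (a *\<^sub>R P y + b *\<^sub>R Q y)) \<in> U"
    if "x \<in> leaves l \<inter> R" "y \<in> leaves r \<inter> R" for x y
  proof -
    have "convex U" using Nd.prems(1) by (simp add: ball_like_def)
    then have "a *\<^sub>R ((1 / K) *\<^sub>R (P x - P y)) + b *\<^sub>R ((1 / K) *\<^sub>R (Q x - Q y)) \<in> U"
      by (rule convexD) (use Nd.prems that in auto)
    then show ?thesis by (simp add: algebra_simps)
  qed
  then show ?case using Nd by simp
qed auto

lemma ball_like_scale:
  assumes "ball_like V U" "u \<in> U" "0 \<le> s" "s \<le> 1"
  shows "s *\<^sub>R u \<in> U"
proof -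
  have "s *\<^sub>R u + (1 - s) *\<^sub>R 0 \<in> U"
    using assms unfolding ball_like_def convex_def by (metis add_diff_cancel_left' diff_add_cancel diff_ge_0_iff_ge)
  then show ?thesis by simp
qed

lemma ball_like_common_scale:
  assumes "finite \<U>" "\<forall>U\<in>\<U>. ball_like V U" "v \<in> V"
  shows "\<exists>\<tau>>0. \<forall>U\<in>\<U>. \<tau> *\<^sub>R v \<in> U"
  using assms
proof (induction \<U>)
  case empty
  show ?case by (rule exI[of _ 1]) simp
next
  case (insert U \<U>)
  obtain \<tau> where \<tau>: "\<tau> > 0" "\<forall>U\<in>\<U>. \<tau> *\<^sub>R v \<in> U" using insert by auto
  obtain \<sigma> where \<sigma>: "\<sigma> > 0" "\<sigma> *\<^sub>R v \<in> U" using insert.prems by (auto simp: ball_like_def)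
  define \<rho> where "\<rho> = min \<tau> \<sigma>"
  have \<rho>: "\<rho> > 0" "\<rho> / \<tau> \<le> 1" "\<rho> / \<sigma> \<le> 1" using \<tau>(1) \<sigma>(1) by (auto simp: \<rho>_def)
  have "\<rho> *\<^sub>R v \<in> U'" if "U' \<in> \<U>" for U'
    using ball_like_scale[of V U' "\<tau> *\<^sub>R v" "\<rho> / \<tau>"] insert.prems that \<tau> \<rho> by simp
  moreover have "\<rho> *\<^sub>R v \<in> U"
    using ball_like_scale[of V U "\<sigma> *\<^sub>R v" "\<rho> / \<sigma>"] insert.prems \<sigma> \<rho> by simp
  ultimately show ?case using \<rho>(1) by blast
qed

lemma lipschitz_on_tree_single:
  assumes "\<forall>U\<in>nodes t. ball_like V U \<and> (1 / K) *\<^sub>R v \<in> U"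
  shows "lipschitz_on_tree R K t (\<lambda>y. if y = x then v else 0)"
  using assms
proof (induction t)
  case (Nd U l r)
  have "ball_like V U" "(1 / K) *\<^sub>R v \<in> U" using Nd.prems by auto
  then have "0 \<in> U" "(1 / K) *\<^sub>R v \<in> U" "(1 / K) *\<^sub>R (0 - v) \<in> U" by (auto simp: ball_like_def)
  then show ?case using Nd by auto
qed auto

context fin_dim begin

text \<open>
  Flows are recovered from the separating functional by testing it against families that are
  constant on one cluster and zero elsewhere.
\<close>

lemma dual_flow_bound:
  fixes t :: "('x, 'v) ctree"
  assumes "nested t" "\<forall>U\<in>nodes t. ball_like V U" "fits W t" "ball_like V W" "\<kappa> > 0"
    and lin: "\<And>x. x \<in> leaves t \<Longrightarrow> \<phi> x \<in> Aff \<and> \<phi> x 0 = 0"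
    and bound: "\<And>Q. lipschitz_on_tree UNIV \<kappa> t Q \<Longrightarrow> (\<And>x. x \<in> leaves t \<Longrightarrow> (1 / \<kappa>) *\<^sub>R Q x \<in> W) \<Longrightarrow>
      (\<Sum>x\<in>leaves t. \<phi> x (Q x)) \<le> m"
  shows "flow_bound aff_test (m / \<kappa>) t \<phi>"
  using assms
proof (induction t arbitrary: W)
  case (Nd U l r)
  have U: "ball_like V U" and UW: "U \<subseteq> W" using Nd.prems(2,3) by auto
  have nest: "nested l" "nested r" "fits U l" "fits U r" "leaves l \<inter> leaves r = {}"
    using Nd.prems(1) by auto
  have balls: "\<forall>U\<in>nodes l. ball_like V U" "\<forall>U\<in>nodes r. ball_like V U" using Nd.prems(2) by auto
  have sub: "(\<Sum>x\<in>leaves s. \<phi> x (Q x)) \<le> m"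
    if s: "s = l \<or> s = r" and Q: "lipschitz_on_tree UNIV \<kappa> s Q"
      "\<And>x. x \<in> leaves s \<Longrightarrow> (1 / \<kappa>) *\<^sub>R Q x \<in> U" for s Q
  proof -
    \<comment> \<open>Extension by 0 to the other child. Across the node one of the two values is 0,
      so the constraint there reduces to membership in \<open>U\<close>, and
      \<open>U \<subseteq> W\<close> takes care of the outer constraint.\<close>
    define Q' where "Q' x = (if x \<in> leaves s then Q x else 0)" for x
    have "lipschitz_on_tree UNIV \<kappa> s Q'"
      using Q(1) lipschitz_on_tree_cong[of s Q' Q] by (simp add: Q'_def)
    moreover have "lipschitz_on_tree UNIV \<kappa> s' Q'" if "s' = l \<or> s' = r" "s' \<noteq> s" for s'
    proof (rule lipschitz_on_tree_const[of s' V Q' 0])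
      show "\<forall>U\<in>nodes s'. ball_like V U" using that(1) balls by blast
      show "Q' x = 0" if "x \<in> leaves s'" for x
        using that s \<open>s' = l \<or> s' = r\<close> \<open>s' \<noteq> s\<close> nest(5) by (auto simp: Q'_def)
    qed
    ultimately have lr: "lipschitz_on_tree UNIV \<kappa> l Q'" "lipschitz_on_tree UNIV \<kappa> r Q'" by metis+
    have Q'U: "(1 / \<kappa>) *\<^sub>R Q' x \<in> U" "- ((1 / \<kappa>) *\<^sub>R Q' x) \<in> U" for x
      using Q(2)[of x] U by (auto simp: Q'_def ball_like_def)
    have "(1 / \<kappa>) *\<^sub>R (Q' x - Q' y) \<in> U" if "x \<in> leaves l" "y \<in> leaves r" for x y
    proof -
      have "Q' x = 0 \<or> Q' y = 0" using that s nest(5) by (auto simp: Q'_def)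
      then show ?thesis using Q'U(1)[of x] Q'U(2)[of y] by (auto simp: scaleR_diff_right)
    qed
    then have "lipschitz_on_tree UNIV \<kappa> (Nd U l r) Q'" using lr by simp
    then have "(\<Sum>x\<in>leaves (Nd U l r). \<phi> x (Q' x)) \<le> m"
      by (rule Nd.prems(7)) (use Q'U(1) UW in blast)
    moreover have "(\<Sum>x\<in>leaves (Nd U l r). \<phi> x (Q' x)) = (\<Sum>x\<in>leaves s. \<phi> x (Q x))"
      by (rule sum.mono_neutral_cong_right) (use s Nd.prems(6) in \<open>auto simp: Q'_def\<close>)
    ultimately show ?thesis by simp
  qed
  have fb: "flow_bound aff_test (m / \<kappa>) l \<phi>" "flow_bound aff_test (m / \<kappa>) r \<phi>"
    by (rule Nd.IH(1)[OF nest(1) balls(1) nest(3) U Nd.prems(5)]; use Nd.prems(6) sub[of l] in simp)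
      (rule Nd.IH(2)[OF nest(2) balls(2) nest(4) U Nd.prems(5)]; use Nd.prems(6) sub[of r] in simp)
  have tb: "test_bound aff_test U (m / \<kappa>) (total s \<phi>)" if s: "s = l \<or> s = r" for s
    unfolding test_bound_def
  proof
    have le: "total s \<phi> u \<le> m / \<kappa>" if u: "u \<in> U" for u
    proof -
      have uV: "u \<in> V" using U u by (auto simp: ball_like_def)
      \<comment> \<open>A constant family meets all constraints inside the cluster, so testing with
        it bounds the cluster total at \<open>u\<close>.\<close>
      have "(\<Sum>x\<in>leaves s. \<phi> x (\<kappa> *\<^sub>R u)) \<le> m"
        by (rule sub[OF s]) (use lipschitz_on_tree_const[of s V] s balls u Nd.prems(5) in auto)
      moreover have "\<phi> x (\<kappa> *\<^sub>R u) = \<kappa> * \<phi> x u" if "x \<in> leaves s" for x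
        using Aff_affine(2)[of "\<phi> x" u u \<kappa>] Nd.prems(6)[of x] that s uV by auto
      ultimately have "\<kappa> * total s \<phi> u \<le> m"
        by (simp add: total_def sum_fun_apply sum_distrib_left)
      then show ?thesis using Nd.prems(5) by (simp add: field_simps)
    qed
    have z: "total s \<phi> 0 = 0" using Nd.prems(6) s by (auto simp: total_def sum_fun_apply intro!: sum.neutral)
    fix u assume u: "u \<in> U"
    then have mu: "- u \<in> U" "u \<in> V" using U by (auto simp: ball_like_def)
    have "total s \<phi> (- u) = - total s \<phi> u"
      unfolding total_def sum_fun_apply sum_negf[symmetric]
    proof (rule sum.cong)
      fix x assume "x \<in> leaves s"
      then show "\<phi> x (- u) = - \<phi> x u"
        using Aff_affine(2)[of "\<phi> x" u u "-1"] Nd.prems(6)[of x] s mu(2) by auto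
    qed simp
    then show "\<bar>aff_test u (total s \<phi>)\<bar> \<le> m / \<kappa>"
      using le[OF u] le[OF mu(1)] z by (simp add: aff_test_def)
  qed
  show ?case using fb tb by simp
qed auto

text \<open>Without a selection, the convex set of differences between selections and Lipschitz
  families avoids 0, and separation yields linear functionals \<open>\<phi>0 x\<close>. Constant
  families are Lipschitz however large they are, so the \<open>\<phi>0 x\<close> add up to 0.
  Subtracting the infima over the sets \<open>G x\<close> and dividing by the sum \<open>m\<close>
  of these infima gives the total -1.\<close>

lemma certificate_exists:
  fixes t :: "('x, 'v) ctree"
  assumes nest: "nested t" and balls: "\<forall>U\<in>nodes t. ball_like V U" and \<kappa>: "\<kappa> > 0"
    and G: "\<And>x. x \<in> leaves t \<Longrightarrow> G x \<subseteq> V \<and> G x \<noteq> {} \<and> convex (G x)"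
    and no: "\<not> (\<exists>P. (\<forall>x\<in>leaves t. P x \<in> G x) \<and> lipschitz_on_tree UNIV \<kappa> t P)"
  shows "\<exists>\<phi>. certificate t G (1 / \<kappa>) \<phi>"
proof -
  define L where "L = leaves t"
  have finL: "finite L" by (simp add: L_def)
  define sel where "sel P \<longleftrightarrow> (\<forall>x\<in>L. P x \<in> G x)" for P
  define lip where "lip Q \<longleftrightarrow> lipschitz_on_tree UNIV \<kappa> t Q \<and> (\<forall>x\<in>L. Q x \<in> V)" for Q
  define co where "co P Q = (\<lambda>(x, b). if x \<in> L then representation B (P x - Q x) b else 0)" for P Q :: "'x \<Rightarrow> 'v"
  define A where "A = {co P Q | P Q. sel P \<and> lip Q}"
  have "\<exists>p. x \<in> L \<longrightarrow> p \<in> G x" for x using G[of x] by (auto simp: L_def)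
  then obtain P0 where P0: "sel P0" unfolding sel_def by metis
  have lip0: "lip (\<lambda>_. 0)"
    unfolding lip_def using lipschitz_on_tree_const[OF balls] subspace_0[OF subspace_V] by auto
  have selV: "P x \<in> V" if "sel P" "x \<in> L" for P x
    using that G[of x] by (auto simp: sel_def L_def)
  have lipV: "Q x \<in> V" if "lip Q" "x \<in> L" for Q x using that by (simp add: lip_def)
  have rep_V: "v \<in> V \<Longrightarrow> v \<in> span B" for v by (simp add: V)
  have conv: "convex A"
    unfolding convex_def
  proof (intro ballI allI impI)
    fix f g :: "'x \<times> 'v \<Rightarrow> real" and a b :: real
    assume fg: "f \<in> A" "g \<in> A" and ab: "0 \<le> a" "0 \<le> b" "a + b = 1"
    obtain P Q where PQ: "f = co P Q" "sel P" "lip Q" using fg(1) by (auto simp: A_def)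
    obtain P' Q' where PQ': "g = co P' Q'" "sel P'" "lip Q'" using fg(2) by (auto simp: A_def)
    have "sel (\<lambda>x. a *\<^sub>R P x + b *\<^sub>R P' x)"
      using PQ(2) PQ'(2) G ab unfolding sel_def L_def convex_def by simp
    moreover have "lip (\<lambda>x. a *\<^sub>R Q x + b *\<^sub>R Q' x)"
      using PQ(3) PQ'(3) lipschitz_on_tree_convex[OF balls _ _ ab] subspace_add[OF subspace_V] subspace_scale[OF subspace_V]
      unfolding lip_def by simp
    moreover have "a *\<^sub>R f + b *\<^sub>R g = co (\<lambda>x. a *\<^sub>R P x + b *\<^sub>R P' x) (\<lambda>x. a *\<^sub>R Q x + b *\<^sub>R Q' x)"
    proof (rule ext, clarify)
      fix x c
      show "(a *\<^sub>R f + b *\<^sub>R g) (x, c) = co (\<lambda>x. a *\<^sub>R P x + b *\<^sub>R P' x) (\<lambda>x. a *\<^sub>R Q x + b *\<^sub>R Q' x) (x, c)"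
      proof (cases "x \<in> L")
        case True
        have "P x - Q x \<in> span B" "P' x - Q' x \<in> span B"
          using selV lipV PQ PQ' True subspace_diff[OF subspace_V] by (auto simp: V)
        then have "representation B (a *\<^sub>R (P x - Q x) + b *\<^sub>R (P' x - Q' x)) =
          (\<lambda>c. a * representation B (P x - Q x) c + b * representation B (P' x - Q' x) c)"
          using indep by (simp add: representation_add representation_scale span_scale)
        moreover have "a *\<^sub>R (P x - Q x) + b *\<^sub>R (P' x - Q' x) = (a *\<^sub>R P x + b *\<^sub>R P' x) - (a *\<^sub>R Q x + b *\<^sub>R Q' x)"
          by (simp add: algebra_simps)
        ultimately show ?thesis using True by (simp add: PQ(1) PQ'(1) co_def scaleR_fun_def)
      qed (simp add: PQ(1) PQ'(1) co_def scaleR_fun_def)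
    qed
    ultimately show "a *\<^sub>R f + b *\<^sub>R g \<in> A" unfolding A_def by blast
  qed
  have ne: "A \<noteq> {}" using P0 lip0 by (auto simp: A_def)
  have nz: "\<exists>i\<in>L \<times> B. f i \<noteq> 0" if f: "f \<in> A" for f
  proof (rule ccontr)
    assume z: "\<not> ?thesis"
    obtain P Q where PQ: "f = co P Q" "sel P" "lip Q" using f by (auto simp: A_def)
    have "P x = Q x" if x: "x \<in> L" for x
    proof -
      have "P x - Q x \<in> span B"
        using subspace_diff[OF subspace_V selV[OF PQ(2) x] lipV[OF PQ(3) x]] by (simp add: V)
      then have "(\<Sum>b\<in>B. representation B (P x - Q x) b *\<^sub>R b) = P x - Q x"
        using sum_representation_eq[OF indep _ fin] by blast
      moreover have "representation B (P x - Q x) b = 0" if "b \<in> B" for b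
        using z that x by (auto simp: PQ(1) co_def)
      ultimately show ?thesis by simp
    qed
    then have "lipschitz_on_tree UNIV \<kappa> t P"
      using PQ(3) lipschitz_on_tree_cong[of t P Q] by (simp add: L_def lip_def)
    then show False using no PQ(2) by (auto simp: sel_def L_def)
  qed
  obtain c where c: "\<exists>i\<in>L \<times> B. c i \<noteq> 0" "\<forall>f\<in>A. (\<Sum>i\<in>L \<times> B. c i * f i) \<ge> 0"
    using separation_finite_dim[OF _ conv ne nz] finL fin by blast
  define \<phi>0 where "\<phi>0 x = (\<Sum>b\<in>B. c (x, b) *\<^sub>R (\<lambda>v. representation B v b))" for x
  have \<phi>0v: "\<phi>0 x v = (\<Sum>b\<in>B. c (x, b) * representation B v b)" for x v
    by (simp add: \<phi>0_def sum_fun_apply scaleR_fun_def)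
  have \<phi>0A: "\<phi>0 x \<in> Aff" for x
    unfolding \<phi>0_def by (rule subspace_sum[OF subspace_Aff], rule subspace_scale[OF subspace_Aff], rule coord_Aff)
  have \<phi>00: "\<phi>0 x 0 = 0" for x by (simp add: \<phi>0v representation_zero)
  have \<phi>0d: "\<phi>0 x (v - w) = \<phi>0 x v - \<phi>0 x w" if "v \<in> V" "w \<in> V" for x v w
    using Aff_diff[OF \<phi>0A that, of x] \<phi>00 by (simp add: aff_test_def)
  have \<phi>0s: "\<phi>0 x (a *\<^sub>R v) = a * \<phi>0 x v" if "v \<in> V" for x v a
    using Aff_affine(2)[OF \<phi>0A that that, of x a] \<phi>00 by simp
  have \<phi>0b: "\<phi>0 x b = c (x, b)" if "b \<in> B" for x b
    using that indep fin by (simp add: \<phi>0v representation_basis if_distrib[of "\<lambda>y. _ * y"] cong: if_cong)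
  have sep: "(\<Sum>x\<in>L. \<phi>0 x (Q x)) \<le> (\<Sum>x\<in>L. \<phi>0 x (P x))" if PQ: "sel P" "lip Q" for P Q
  proof -
    have "0 \<le> (\<Sum>i\<in>L \<times> B. c i * co P Q i)" using c(2) PQ by (auto simp: A_def)
    also have "\<dots> = (\<Sum>(x, b)\<in>L \<times> B. c (x, b) * representation B (P x - Q x) b)"
      by (intro sum.cong) (auto simp: co_def)
    also have "\<dots> = (\<Sum>x\<in>L. \<phi>0 x (P x - Q x))"
      by (simp add: sum.cartesian_product[symmetric] \<phi>0v)
    also have "\<dots> = (\<Sum>x\<in>L. \<phi>0 x (P x) - \<phi>0 x (Q x))"
      using selV[OF PQ(1)] lipV[OF PQ(2)] by (intro sum.cong) (auto simp: \<phi>0d)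
    finally show ?thesis by (simp add: sum_subtractf)
  qed
  \<comment> \<open>Vary a selection at \<open>x\<close> alone and compare it with the zero
    family.\<close>
  have bdd: "bdd_below (\<phi>0 x ` G x)" if x: "x \<in> L" for x
  proof (rule bdd_belowI2)
    fix p assume p: "p \<in> G x"
    have "sel (P0(x := p))" using P0 p by (auto simp: sel_def)
    then have "(\<Sum>y\<in>L. \<phi>0 y 0) \<le> (\<Sum>y\<in>L. \<phi>0 y ((P0(x := p)) y))" using sep lip0 by fastforce
    also have "\<dots> = \<phi>0 x p + (\<Sum>y\<in>L - {x}. \<phi>0 y (P0 y))"
      using x finL by (simp add: sum.remove)
    finally show "- (\<Sum>y\<in>L - {x}. \<phi>0 y (P0 y)) \<le> \<phi>0 x p" by (simp add: \<phi>00)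
  qed
  define s where "s x = Inf (\<phi>0 x ` G x)" for x
  define m where "m = sum s L"
  have s_le: "s x \<le> \<phi>0 x p" if "x \<in> L" "p \<in> G x" for x p
    unfolding s_def using bdd[OF that(1)] that(2) by (intro cInf_lower) auto
  have m_ge: "(\<Sum>x\<in>L. \<phi>0 x (Q x)) \<le> m" if Q: "lip Q" for Q
  proof (rule field_le_epsilon)
    fix e :: real assume e: "e > 0"
    \<comment> \<open>The infima need not be attained: each point is chosen within \<open>d\<close>
      of its infimum, and the errors add up to at most \<open>e\<close>.\<close>
    define d where "d = e / (real (card L) + 1)"
    have d: "d > 0" using e by (simp add: d_def)
    have "\<exists>p. x \<in> L \<longrightarrow> p \<in> G x \<and> \<phi>0 x p < s x + d" for x
    proof (cases "x \<in> L")
      case True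
      then have "\<phi>0 x ` G x \<noteq> {}" using G by (auto simp: L_def)
      then have "\<exists>y\<in>\<phi>0 x ` G x. y < s x + d"
        unfolding s_def using d by (intro cInf_lessD) auto
      then show ?thesis by blast
    qed simp
    then obtain P where P: "\<And>x. x \<in> L \<Longrightarrow> P x \<in> G x \<and> \<phi>0 x (P x) < s x + d" by metis
    have "(\<Sum>x\<in>L. \<phi>0 x (Q x)) \<le> (\<Sum>x\<in>L. \<phi>0 x (P x))" using sep[OF _ Q] P by (simp add: sel_def)
    also have "\<dots> \<le> (\<Sum>x\<in>L. s x + d)" using P by (intro sum_mono less_imp_le) auto
    also have "\<dots> = m + real (card L) * d" by (simp add: m_def sum.distrib)
    also have "real (card L) * d \<le> e" using e by (simp add: d_def field_simps)
    finally show "(\<Sum>x\<in>L. \<phi>0 x (Q x)) \<le> m + e" by simp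
  qed
  have BV: "B \<subseteq> V" by (simp add: V span_superset)
  \<comment> \<open>As the bodies are absorbing, a small multiple of a basis vector at a single leaf
    is a Lipschitz family; its sign is chosen to make the functional positive there.\<close>
  have m: "m > 0"
  proof -
    obtain x b where xb: "x \<in> L" "b \<in> B" "c (x, b) \<noteq> 0" using c(1) by auto
    have bV: "(1 / \<kappa> * sgn (c (x, b))) *\<^sub>R b \<in> V" using xb(2) BV subspace_scale[OF subspace_V] by blast
    obtain \<tau> where \<tau>: "\<tau> > 0" "\<forall>U\<in>nodes t. \<tau> *\<^sub>R (1 / \<kappa> * sgn (c (x, b))) *\<^sub>R b \<in> U"
      using ball_like_common_scale[OF finite_nodes balls bV] by auto
    define q where "q = (\<tau> * sgn (c (x, b))) *\<^sub>R b"
    have qV: "q \<in> V" unfolding q_def using xb(2) BV subspace_scale[OF subspace_V] by blast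
    have "\<tau> *\<^sub>R (1 / \<kappa> * sgn (c (x, b))) *\<^sub>R b = (1 / \<kappa>) *\<^sub>R q" by (simp add: q_def ac_simps)
    then have "\<forall>U\<in>nodes t. ball_like V U \<and> (1 / \<kappa>) *\<^sub>R q \<in> U" using balls \<tau>(2) by simp
    then have "lip (\<lambda>y. if y = x then q else 0)"
      unfolding lip_def using lipschitz_on_tree_single qV subspace_0[OF subspace_V] by auto
    then have "(\<Sum>y\<in>L. \<phi>0 y (if y = x then q else 0)) \<le> m" by (rule m_ge)
    also have "(\<Sum>y\<in>L. \<phi>0 y (if y = x then q else 0)) = (\<Sum>y\<in>L. if y = x then \<phi>0 y q else 0)"
      by (intro sum.cong) (auto simp: \<phi>00)
    also have "\<dots> = \<phi>0 x q" using xb(1) finL by simp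
    also have "\<phi>0 x q = \<tau> * \<bar>c (x, b)\<bar>"
      using xb(2) BV by (auto simp: q_def \<phi>0s \<phi>0b abs_sgn mult.assoc)
    finally show ?thesis using \<tau>(1) xb(3) by (smt (verit) mult_pos_pos zero_less_abs_iff)
  qed
  have zero: "(\<Sum>x\<in>L. c (x, b)) = 0" if b: "b \<in> B" for b
  proof (rule ccontr)
    assume n: "(\<Sum>x\<in>L. c (x, b)) \<noteq> 0"
    \<comment> \<open>With this multiple of \<open>b\<close> the constant family would reach the
      value \<open>m + 1\<close>, above the bound \<open>m\<close>.\<close>
    define T where "T = (m + 1) / (\<Sum>x\<in>L. c (x, b))"
    have bV: "b \<in> V" using b BV by blast
    have "lip (\<lambda>_. T *\<^sub>R b)"
      unfolding lip_def using lipschitz_on_tree_const[OF balls] bV subspace_scale[OF subspace_V] by auto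
    then have "(\<Sum>x\<in>L. \<phi>0 x (T *\<^sub>R b)) \<le> m" by (rule m_ge)
    then have "T * (\<Sum>x\<in>L. c (x, b)) \<le> m" by (simp add: \<phi>0s[OF bV] \<phi>0b[OF b] sum_distrib_left)
    then show False using n by (simp add: T_def)
  qed
  have tot0: "total t \<phi>0 = 0"
  proof
    fix v
    have "total t \<phi>0 v = (\<Sum>x\<in>L. \<Sum>b\<in>B. c (x, b) * representation B v b)"
      by (simp add: total_def sum_fun_apply \<phi>0v L_def)
    also have "\<dots> = (\<Sum>b\<in>B. (\<Sum>x\<in>L. c (x, b)) * representation B v b)"
      by (subst sum.swap) (simp add: sum_distrib_right)
    also have "\<dots> = 0" by (simp add: zero)
    finally show "total t \<phi>0 v = 0 v" by simp
  qed
  have "flow_bound aff_test (m / \<kappa>) t \<phi>0"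
  proof (rule dual_flow_bound[OF nest balls _ ball_like_self[OF subspace_V] \<kappa>])
    show "fits V t" using balls by (cases t) (auto simp: ball_like_def)
    fix Q assume Q: "lipschitz_on_tree UNIV \<kappa> t Q" "\<And>x. x \<in> leaves t \<Longrightarrow> (1 / \<kappa>) *\<^sub>R Q x \<in> V"
    have "Q x \<in> V" if "x \<in> leaves t" for x
      using subspace_scale[OF subspace_V Q(2)[OF that], of \<kappa>] \<kappa> by simp
    then have "lip Q" using Q(1) by (simp add: lip_def L_def)
    then show "(\<Sum>x\<in>leaves t. \<phi>0 x (Q x)) \<le> m" using m_ge by (simp add: L_def)
  qed (use \<phi>0A \<phi>00 in auto)
  then have fl: "flow_bound aff_test (1 / \<kappa>) t (\<lambda>x. (1 / m) *\<^sub>R \<phi>0 x)"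
    by (rule flow_bound_scale) (use m in simp)
  have fl0: "flow_bound aff_test 0 s (\<lambda>x _. k x)" for s :: "('x, 'v) ctree" and k
    by (induction s) (auto simp: test_bound_def aff_test_def total_def sum_fun_apply)
  define \<phi> where "\<phi> x = (1 / m) *\<^sub>R \<phi>0 x + (\<lambda>_. - s x / m)" for x
  have \<phi>v: "\<phi> x v = (\<phi>0 x v - s x) / m" for x v
    by (simp add: \<phi>_def scaleR_fun_def diff_divide_distrib)
  have "certificate t G (1 / \<kappa>) \<phi>" unfolding certificate_def
  proof (intro conjI ballI)
    show "\<phi> x \<in> Aff" for x
      unfolding \<phi>_def by (intro subspace_add subspace_scale subspace_Aff \<phi>0A const_Aff)
    show "\<phi> x p \<ge> 0" if "x \<in> leaves t" "p \<in> G x" for x p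
      using s_le that m by (simp add: \<phi>v L_def)
    show "total t \<phi> = (\<lambda>_. -1)"
    proof
      fix v
      have "total t \<phi> v = (\<Sum>x\<in>L. (\<phi>0 x v - s x) / m)"
        by (simp add: total_def sum_fun_apply \<phi>v L_def)
      also have "\<dots> = (total t \<phi>0 v - m) / m"
        by (simp add: sum_divide_distrib[symmetric] sum_subtractf m_def total_def sum_fun_apply L_def)
      finally show "total t \<phi> v = -1" using m tot0 by simp
    qed
    have "flow_bound aff_test (1 / \<kappa> + 0) t (\<lambda>x. (1 / m) *\<^sub>R \<phi>0 x + (\<lambda>_. - s x / m))"
      by (rule flow_bound_add[OF fl fl0])
    then show "flow_bound aff_test (1 / \<kappa>) t \<phi>" unfolding \<phi>_def by simp
  qed
  then show ?thesis by blast
qed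

end

section \<open>Selections on cluster trees\<close>

lemma card_leaves_le: "card (leaves t) \<le> Suc (size t)"
proof (induction t)
  case (Nd U l r)
  then show ?case using card_Un_le[of "leaves l" "leaves r"] by simp
qed simp

context fin_dim begin

lemma test_bound_diff:
  assumes "h \<in> Aff" "test_bound aff_test U \<epsilon> h" "v \<in> V" "w \<in> V" "(1 / K) *\<^sub>R (v - w) \<in> U" "K > 0"
  shows "\<bar>h v - h w\<bar> \<le> K * \<epsilon>"
proof -
  define u where "u = (1 / K) *\<^sub>R (v - w)"
  have u: "u \<in> V" "v - w = K *\<^sub>R u"
    using assms(3,4,6) subspace_V by (auto simp: u_def subspace_diff subspace_scale)
  have "h v - h w = K * aff_test u h"
    using Aff_diff[OF assms(1,3,4)] Aff_affine(2)[OF assms(1) u(1) u(1), of K]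
    by (simp add: aff_test_def u(2))
  moreover have "\<bar>aff_test u h\<bar> \<le> \<epsilon>" using assms(2,5) by (auto simp: test_bound_def u_def)
  ultimately show ?thesis using assms(6) by (simp add: abs_mult)
qed

text \<open>Evaluate each cluster at one of its points in \<open>R\<close>. At a node only the child
  not containing \<open>z\<close> has to change its point, at cost \<open>K * \<epsilon>\<close> by
  the bound on its total; a child without points of \<open>R\<close> carries no flow. This makes at
  most one error per node.\<close>

lemma flow_telescope:
  fixes t :: "('x, 'v) ctree"
  assumes "nested t" "\<And>x. x \<in> leaves t \<Longrightarrow> \<psi> x \<in> Aff" "\<And>x. x \<notin> R \<Longrightarrow> \<psi> x = 0"
    and "flow_bound aff_test \<epsilon> t \<psi>" "lipschitz_on_tree R K t P" "K > 0" "\<epsilon> \<ge> 0"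
    and "\<And>x. x \<in> leaves t \<inter> R \<Longrightarrow> P x \<in> V" "z \<in> leaves t \<inter> R"
    and "\<forall>U\<in>nodes t. ball_like V U"
  shows "\<bar>(\<Sum>x\<in>leaves t. \<psi> x (P x)) - total t \<psi> (P z)\<bar> \<le> real (size t) * (K * \<epsilon>)"
  using assms
proof (induction t arbitrary: z)
  case (Nd U l r)
  have nest: "nested l" "nested r" "leaves l \<inter> leaves r = {}" using Nd.prems(1) by auto
  have IH: "\<bar>(\<Sum>x\<in>leaves s. \<psi> x (P x)) - total s \<psi> (P z)\<bar> \<le> real (size s) * (K * \<epsilon>)"
    if "s = l \<or> s = r" "z \<in> leaves s \<inter> R" for s z
    using that(1)
  proof
    assume "s = l"
    then show ?thesis using Nd.IH(1)[of z] Nd.prems that(2) by simp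
  next
    assume "s = r"
    then show ?thesis using Nd.IH(2)[of z] Nd.prems that(2) by simp
  qed
  have tb: "test_bound aff_test U \<epsilon> (total s \<psi>)" "total s \<psi> \<in> Aff" if s: "s = l \<or> s = r" for s
  proof -
    show "test_bound aff_test U \<epsilon> (total s \<psi>)" using s Nd.prems(4) by auto
    show "total s \<psi> \<in> Aff"
      unfolding total_def by (rule subspace_sum[OF subspace_Aff]) (use s Nd.prems(2) in auto)
  qed
  have PV: "P x \<in> V" if "x \<in> leaves l \<inter> R \<or> x \<in> leaves r \<inter> R" for x
    using Nd.prems(8) that by auto
  have K\<epsilon>: "K * \<epsilon> \<ge> 0" using Nd.prems(6,7) by simp
  have U: "(1 / K) *\<^sub>R (P x - P y) \<in> U \<and> (1 / K) *\<^sub>R (P y - P x) \<in> U"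
    if "x \<in> leaves l \<inter> R" "y \<in> leaves r \<inter> R" for x y
  proof -
    have *: "(1 / K) *\<^sub>R (P x - P y) \<in> U" using Nd.prems(5) that by auto
    then have "- ((1 / K) *\<^sub>R (P x - P y)) \<in> U" using Nd.prems(10) by (auto simp: ball_like_def)
    with * show ?thesis by (simp add: algebra_simps)
  qed
  have other: "\<bar>(\<Sum>x\<in>leaves s. \<psi> x (P x)) - total s \<psi> (P z)\<bar> \<le> real (size s) * (K * \<epsilon>) + K * \<epsilon>"
    if s: "s = l \<and> z \<in> leaves r \<inter> R \<or> s = r \<and> z \<in> leaves l \<inter> R" for s z
  proof (cases "leaves s \<inter> R = {}")
    case True
    then have "\<psi> x = 0" if "x \<in> leaves s" for x using Nd.prems(3)[of x] that by blast
    then show ?thesis using K\<epsilon> by (simp add: total_zero)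
  next
    case False
    then obtain y where y: "y \<in> leaves s \<inter> R" by blast
    have "(1 / K) *\<^sub>R (P y - P z) \<in> U" using s y U[of y z] U[of z y] by auto
    then have "\<bar>total s \<psi> (P y) - total s \<psi> (P z)\<bar> \<le> K * \<epsilon>"
      using test_bound_diff[of "total s \<psi>" U \<epsilon> "P y" "P z" K] tb[of s] PV s y Nd.prems(6) by auto
    then show ?thesis using IH[of s y] s y by fastforce
  qed
  have sum: "(\<Sum>x\<in>leaves (Nd U l r). \<psi> x (P x)) = (\<Sum>x\<in>leaves l. \<psi> x (P x)) + (\<Sum>x\<in>leaves r. \<psi> x (P x))"
    using nest(3) by (simp add: sum.union_disjoint)
  have "total (Nd U l r) \<psi> (P z) = total l \<psi> (P z) + total r \<psi> (P z)"
    using total_Nd[OF Nd.prems(1), of \<psi>] by simp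
  moreover have "real (size (Nd U l r)) * (K * \<epsilon>) =
      real (size l) * (K * \<epsilon>) + (real (size r) * (K * \<epsilon>) + K * \<epsilon>)"
    by (simp add: algebra_simps)
  moreover consider "z \<in> leaves l \<inter> R" | "z \<in> leaves r \<inter> R" using Nd.prems(9) by auto
  then have "\<bar>(\<Sum>x\<in>leaves l. \<psi> x (P x)) - total l \<psi> (P z)\<bar> + \<bar>(\<Sum>x\<in>leaves r. \<psi> x (P x)) - total r \<psi> (P z)\<bar>
      \<le> real (size l) * (K * \<epsilon>) + (real (size r) * (K * \<epsilon>) + K * \<epsilon>)"
  proof cases
    case 1
    then show ?thesis using IH[of l z] other[of r z] by simp
  next
    case 2
    then show ?thesis using IH[of r z] other[of l z] by simp
  qed
  ultimately show ?case unfolding sum by linarith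
qed simp

text \<open>Otherwise some certificate with bound \<open>1 / (C * K)\<close> exists, and a sparse
  one lives on a set \<open>R\<close> of at most \<open>2 ^ c\<close> points. For the selection
  given on \<open>R\<close>, the sum of the \<open>\<psi> x (P x)\<close> is nonnegative, yet by
  telescoping it is at most \<open>-1 + size t * (K * \<epsilon>) < 0\<close>. Here \<open>C\<close>
  is chosen before \<open>l\<close>, which matters only through \<open>c\<close>.\<close>

theorem tree_selection:
  "\<exists>C\<ge>1. \<forall>(t :: ('x, 'v) ctree) G l K.
    nested t \<longrightarrow> size t \<le> n \<longrightarrow> (\<forall>U\<in>nodes t. ball_like V U) \<longrightarrow>
    (\<forall>x\<in>leaves t. G x \<subseteq> V \<and> convex (G x) \<and> affine_dim (G x) \<le> l) \<longrightarrow>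
    c = min (l + 1) (card B) \<longrightarrow> K > 0 \<longrightarrow>
    (\<forall>R\<subseteq>leaves t. card R \<le> 2 ^ c \<longrightarrow> (\<exists>P. (\<forall>x\<in>R. P x \<in> G x) \<and> lipschitz_on_tree R K t P)) \<longrightarrow>
    (\<exists>P. (\<forall>x\<in>leaves t. P x \<in> G x) \<and> lipschitz_on_tree UNIV (C * K) t P)"
proof -
  obtain C0 where C0: "C0 \<ge> 1"
    "\<And>t :: ('x, 'v) ctree. nested t \<Longrightarrow> size t \<le> n \<Longrightarrow> sparsifies aff_test c c t C0"
    using sparsifies_exists[of n c c] by blast
  \<comment> \<open>The power absorbs the loss of sparsification, as
    \<open>Suc (card (leaves t)) \<le> n + 2\<close>; the factor \<open>Suc n\<close> exceeds the
    number of telescoping errors, at most \<open>size t\<close>.\<close>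
  define C where "C = real (Suc n) * C0 ^ (n + 2)"
  have C0p: "C0 ^ (n + 2) \<ge> 1" using C0(1) by (rule one_le_power)
  have C: "C \<ge> 1" unfolding C_def using mult_mono[of 1 "real (Suc n)" 1 "C0 ^ (n + 2)"] C0p by simp
  show ?thesis
  proof (intro exI[of _ C] conjI allI impI)
    fix t :: "('x, 'v) ctree" and G l and K :: real
    assume nest: "nested t" and size: "size t \<le> n" and balls: "\<forall>U\<in>nodes t. ball_like V U"
      and G: "\<forall>x\<in>leaves t. G x \<subseteq> V \<and> convex (G x) \<and> affine_dim (G x) \<le> l"
      and c: "c = min (l + 1) (card B)" and K: "K > 0"
      and sub: "\<forall>R\<subseteq>leaves t. card R \<le> 2 ^ c \<longrightarrow> (\<exists>P. (\<forall>x\<in>R. P x \<in> G x) \<and> lipschitz_on_tree R K t P)"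
    \<comment> \<open>One-point subsets are among those covered by the hypothesis, since
      \<open>1 \<le> 2 ^ c\<close>.\<close>
    have Gne: "G x \<noteq> {}" if "x \<in> leaves t" for x
    proof -
      have "\<exists>P. (\<forall>x\<in>{x}. P x \<in> G x) \<and> lipschitz_on_tree {x} K t P"
        using sub that by (intro sub[rule_format]) auto
      then show ?thesis by auto
    qed
    show "\<exists>P. (\<forall>x\<in>leaves t. P x \<in> G x) \<and> lipschitz_on_tree UNIV (C * K) t P"
    proof (rule ccontr)
      assume no: "\<not> ?thesis"
      have CK: "C * K > 0" using C K by simp
      obtain \<phi> where \<phi>: "certificate t G (1 / (C * K)) \<phi>"
        using certificate_exists[OF nest balls CK _ no] G Gne by blast
      have G': "G x \<subseteq> V \<and> G x \<noteq> {} \<and> affine_dim (G x) \<le> l" if "x \<in> leaves t" for x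
        using G Gne[OF that] that by simp
      obtain R \<psi> where R: "R \<subseteq> leaves t" "card R \<le> 2 ^ c" "\<forall>x. x \<notin> R \<longrightarrow> \<psi> x = 0"
        "certificate t G (C0 ^ Suc (card (leaves t)) * (1 / (C * K))) \<psi>"
        using sparse_certificate[OF nest G' c C0(2)[OF nest size] C0(1) _ \<phi>] CK by auto
      define \<epsilon> where "\<epsilon> = C0 ^ Suc (card (leaves t)) * (1 / (C * K))"
      have \<psi>: "\<And>x. x \<in> leaves t \<Longrightarrow> \<psi> x \<in> Aff" "\<And>x p. x \<in> leaves t \<Longrightarrow> p \<in> G x \<Longrightarrow> \<psi> x p \<ge> 0"
        "total t \<psi> = (\<lambda>_. -1)" "flow_bound aff_test \<epsilon> t \<psi>"
        using R(4) by (auto simp: certificate_def \<epsilon>_def)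
      obtain P where P: "\<forall>x\<in>R. P x \<in> G x" "lipschitz_on_tree R K t P" using sub R(1,2) by blast
      have "R \<noteq> {}"
      proof
        assume "R = {}"
        then have "total t \<psi> = 0" using R(3) by (intro total_zero) simp
        then show False using \<psi>(3) by (simp add: fun_eq_iff)
      qed
      then obtain z where z: "z \<in> leaves t \<inter> R" using R(1) by blast
      have \<epsilon>0: "\<epsilon> \<ge> 0" unfolding \<epsilon>_def using C0(1) CK by simp
      have "\<bar>(\<Sum>x\<in>leaves t. \<psi> x (P x)) - total t \<psi> (P z)\<bar> \<le> real (size t) * (K * \<epsilon>)"
        by (rule flow_telescope[OF nest \<psi>(1) _ \<psi>(4) P(2) K \<epsilon>0 _ z balls])
          (use R(3) P(1) G in auto)
      moreover have "(\<Sum>x\<in>leaves t. \<psi> x (P x)) \<ge> 0"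
      proof (rule sum_nonneg)
        fix x assume x: "x \<in> leaves t"
        show "0 \<le> \<psi> x (P x)" using R(3) P(1) \<psi>(2)[OF x] by (cases "x \<in> R") auto
      qed
      moreover have "real (size t) * (K * \<epsilon>) < 1"
      proof -
        have "C0 ^ Suc (card (leaves t)) \<le> C0 ^ (n + 2)"
          using C0(1) card_leaves_le[of t] size by (intro power_increasing) auto
        then have "K * \<epsilon> \<le> C0 ^ (n + 2) / C"
          unfolding \<epsilon>_def using K C by (simp add: divide_right_mono)
        also have "\<dots> = 1 / real (Suc n)" using C0(1) by (simp add: C_def)
        finally have "real (size t) * (K * \<epsilon>) \<le> real n * (1 / real (Suc n))"
          using size K \<epsilon>0 by (intro mult_mono) auto
        also have "\<dots> < 1" by (simp add: field_simps)
        finally show ?thesis .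
      qed
      ultimately show False using \<psi>(3) by simp
    qed
  qed (rule C)
qed

end

section \<open>Derivative bounds for polynomials\<close>

lemma ex_count_list: "\<exists>is. \<forall>i. count_list is i = \<alpha> i" for \<alpha> :: "'n::finite \<Rightarrow> nat"
proof -
  have "\<exists>is. \<forall>i. count_list is i = (if i \<in> A then \<alpha> i else 0)" if "finite A" for A
    using that
  proof induction
    case empty
    show ?case by (rule exI[of _ "[]"]) simp
  next
    case (insert a A)
    then obtain xs where xs: "\<forall>i. count_list xs i = (if i \<in> A then \<alpha> i else 0)" by blast
    have rep: "count_list (replicate m a) i = (if i = a then m else 0)" for m i
      by (induction m) auto
    show ?case
      by (rule exI[of _ "replicate (\<alpha> a) a @ xs"]) (use insert xs in \<open>auto simp: rep\<close>)
  qed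
  from this[of UNIV] show ?thesis by simp
qed

lemma polys_eq_span:
  "(polys k :: (real ^ 'n::finite \<Rightarrow> real) set) = span (monomial_fun ` {\<alpha>. mi_order \<alpha> \<le> k})"
proof
  let ?A = "{\<alpha> :: 'n::finite \<Rightarrow> nat. mi_order \<alpha> \<le> k}"
  have ev: "(\<Sum>\<alpha>\<in>?A. c \<alpha> *\<^sub>R monomial_fun \<alpha>) = (\<lambda>x. \<Sum>\<alpha>\<in>?A. c \<alpha> * monomial_fun \<alpha> x)"
    for c :: "('n \<Rightarrow> nat) \<Rightarrow> real"
  proof -
    have "(\<Sum>\<alpha>\<in>S. c \<alpha> *\<^sub>R monomial_fun \<alpha>) x = (\<Sum>\<alpha>\<in>S. c \<alpha> * monomial_fun \<alpha> x)"
      for S and x :: "real ^ 'n"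
      by (induction S rule: infinite_finite_induct) (auto simp: scaleR_fun_def)
    then show ?thesis by blast
  qed
  show "polys k \<subseteq> span (monomial_fun ` ?A)"
  proof
    fix p :: "real ^ 'n \<Rightarrow> real" assume "p \<in> polys k"
    then obtain c where "p = (\<Sum>\<alpha>\<in>?A. c \<alpha> *\<^sub>R monomial_fun \<alpha>)" unfolding ev polys_def by blast
    moreover have "(\<Sum>\<alpha>\<in>?A. c \<alpha> *\<^sub>R monomial_fun \<alpha>) \<in> span (monomial_fun ` ?A)"
      by (rule span_sum, rule span_scale, rule span_base) simp
    ultimately show "p \<in> span (monomial_fun ` ?A)" by simp
  qed
  show "span (monomial_fun ` ?A) \<subseteq> polys k"
  proof (rule span_minimal)
    show "monomial_fun ` ?A \<subseteq> polys k"
    proof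
      fix p :: "real ^ 'n \<Rightarrow> real" assume "p \<in> monomial_fun ` ?A"
      then obtain \<beta> where \<beta>: "\<beta> \<in> ?A" "p = monomial_fun \<beta>" by blast
      have "p x = (\<Sum>\<alpha>\<in>?A. (if \<alpha> = \<beta> then 1 else 0) * monomial_fun \<alpha> x)" for x
      proof -
        have "(\<Sum>\<alpha>\<in>?A. (if \<alpha> = \<beta> then 1 else 0) * monomial_fun \<alpha> x) =
            (\<Sum>\<alpha>\<in>?A. if \<alpha> = \<beta> then monomial_fun \<beta> x else 0)"
          by (intro sum.cong) auto
        then show ?thesis using \<beta> sum.delta[OF finite_mi_order_le[of k], of \<beta> "\<lambda>_. monomial_fun \<beta> x"] by simp
      qed
      then show "p \<in> polys k"
        unfolding polys_def by (intro CollectI exI[of _ "\<lambda>\<alpha>. if \<alpha> = \<beta> then 1 else 0"] ext)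
    qed
    show "subspace (polys k :: (real ^ 'n \<Rightarrow> real) set)" unfolding subspace_def
    proof (intro conjI ballI allI)
      show "0 \<in> polys k" unfolding polys_def by (intro CollectI exI[of _ "\<lambda>_. 0"]) auto
      fix p q :: "real ^ 'n \<Rightarrow> real" assume "p \<in> polys k" "q \<in> polys k"
      then obtain c d where "p = (\<lambda>x. \<Sum>\<alpha>\<in>?A. c \<alpha> * monomial_fun \<alpha> x)" "q = (\<lambda>x. \<Sum>\<alpha>\<in>?A. d \<alpha> * monomial_fun \<alpha> x)"
        unfolding polys_def by blast
      then have "p + q = (\<lambda>x. \<Sum>\<alpha>\<in>?A. (c \<alpha> + d \<alpha>) * monomial_fun \<alpha> x)"
        by (auto simp: fun_eq_iff sum.distrib distrib_right)
      then show "p + q \<in> polys k" unfolding polys_def by (intro CollectI exI[of _ "\<lambda>\<alpha>. c \<alpha> + d \<alpha>"])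
    next
      fix r and p :: "real ^ 'n \<Rightarrow> real" assume "p \<in> polys k"
      then obtain c where "p = (\<lambda>x. \<Sum>\<alpha>\<in>?A. c \<alpha> * monomial_fun \<alpha> x)"
        unfolding polys_def by blast
      then have "r *\<^sub>R p = (\<lambda>x. \<Sum>\<alpha>\<in>?A. (r * c \<alpha>) * monomial_fun \<alpha> x)"
        by (simp add: fun_eq_iff scaleR_fun_def sum_distrib_left mult.assoc)
      then show "r *\<^sub>R p \<in> polys k" unfolding polys_def by (intro CollectI exI[of _ "\<lambda>\<alpha>. r * c \<alpha>"])
    qed
  qed
qed

lemma subspace_polys: "subspace (polys k)"
  by (simp add: polys_eq_span)

lemma polys_basis:
  obtains B :: "(real ^ 'n::finite \<Rightarrow> real) set"
  where "finite B" "independent B" "polys k = span B" "card B = dim (polys k :: (real ^ 'n \<Rightarrow> real) set)"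
proof -
  obtain B :: "(real ^ 'n \<Rightarrow> real) set"
    where B: "B \<subseteq> polys k" "independent B" "polys k \<subseteq> span B" "card B = dim (polys k :: (real ^ 'n \<Rightarrow> real) set)"
    by (rule basis_exists)
  have "B \<subseteq> span (monomial_fun ` {\<alpha>. mi_order \<alpha> \<le> k})" using B(1) by (simp add: polys_eq_span)
  then have "finite B"
    using independent_span_bound[of "monomial_fun ` {\<alpha>. mi_order \<alpha> \<le> k}" B] B(2) finite_mi_order_le by blast
  moreover have "span B \<subseteq> polys k" using B(1) subspace_polys by (rule span_minimal)
  ultimately show ?thesis using that B by blast
qed

lemma mi_deriv_expansion:
  assumes "p = (\<lambda>x. \<Sum>\<beta> | mi_order \<beta> \<le> k. c \<beta> * monomial_fun \<beta> x)"
  shows "mi_deriv \<alpha> p = (\<lambda>x. \<Sum>\<beta> | mi_order \<beta> \<le> k.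
    (c \<beta> * (\<Prod>i\<in>UNIV. \<Prod>r<\<alpha> i. real (\<beta> i - r))) * monomial_fun (\<lambda>i. \<beta> i - \<alpha> i) x)"
proof -
  obtain xs where xs: "\<And>i. count_list xs i = \<alpha> i" using ex_count_list[of \<alpha>] by blast
  have "p \<in> polys k" using assms by (auto simp: polys_def)
  then have "mi_deriv \<alpha> p = foldr partial_deriv xs p" by (rule mi_deriv_eq[OF _ xs])
  then show ?thesis unfolding assms foldr_partial_deriv_msum xs .
qed

lemma mi_deriv_scale:
  assumes "p \<in> polys k"
  shows "mi_deriv \<alpha> (r *\<^sub>R p) x = r * mi_deriv \<alpha> p x"
proof -
  obtain c where c: "p = (\<lambda>x. \<Sum>\<beta> | mi_order \<beta> \<le> k. c \<beta> * monomial_fun \<beta> x)"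
    using assms unfolding polys_def by blast
  then have "r *\<^sub>R p = (\<lambda>x. \<Sum>\<beta> | mi_order \<beta> \<le> k. (r * c \<beta>) * monomial_fun \<beta> x)"
    by (simp add: fun_eq_iff scaleR_fun_def sum_distrib_left mult.assoc)
  from mi_deriv_expansion[OF this] mi_deriv_expansion[OF c] show ?thesis
    by (simp add: sum_distrib_left mult.assoc)
qed

lemma mi_deriv_add:
  assumes "p \<in> polys k" "q \<in> polys k"
  shows "mi_deriv \<alpha> (p + q) x = mi_deriv \<alpha> p x + mi_deriv \<alpha> q x"
proof -
  obtain c d where cd: "p = (\<lambda>x. \<Sum>\<beta> | mi_order \<beta> \<le> k. c \<beta> * monomial_fun \<beta> x)"
    "q = (\<lambda>x. \<Sum>\<beta> | mi_order \<beta> \<le> k. d \<beta> * monomial_fun \<beta> x)"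
    using assms unfolding polys_def by blast
  then have "p + q = (\<lambda>x. \<Sum>\<beta> | mi_order \<beta> \<le> k. (c \<beta> + d \<beta>) * monomial_fun \<beta> x)"
    by (auto simp: fun_eq_iff sum.distrib distrib_right)
  from mi_deriv_expansion[OF this] mi_deriv_expansion[OF cd(1)] mi_deriv_expansion[OF cd(2)] show ?thesis
    by (simp add: sum.distrib[symmetric] distrib_right)
qed

text \<open>A monomial of lower order than \<alpha> has some exponent
  \<open>\<beta> i < \<alpha> i\<close>, and then the falling factorial of \<open>\<beta> i\<close>
  contains the factor 0.\<close>

lemma mi_deriv_vanish:
  assumes "p \<in> polys k" "mi_order \<alpha> > k"
  shows "mi_deriv \<alpha> p x = 0"
proof -
  obtain c where c: "p = (\<lambda>x. \<Sum>\<beta> | mi_order \<beta> \<le> k. c \<beta> * monomial_fun \<beta> x)"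
    using assms unfolding polys_def by blast
  have "(\<Prod>i\<in>UNIV. \<Prod>r<\<alpha> i. real (\<beta> i - r)) = 0" if "mi_order \<beta> \<le> k" for \<beta>
  proof -
    have "\<exists>i. \<beta> i < \<alpha> i"
    proof (rule ccontr)
      assume "\<not> ?thesis"
      then have "mi_order \<alpha> \<le> mi_order \<beta>" unfolding mi_order_def by (intro sum_mono) (simp add: not_less)
      then show False using that assms(2) by simp
    qed
    then obtain i where "\<beta> i < \<alpha> i" by blast
    then have "(\<Prod>r<\<alpha> i. real (\<beta> i - r)) = 0" by (intro prod_zero) auto
    then show ?thesis by (intro prod_zero) auto
  qed
  then show ?thesis unfolding mi_deriv_expansion[OF c] by (intro sum.neutral) auto
qed

lemma mi_deriv_Suc:
  assumes "p \<in> polys k"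
  shows "partial_deriv i (mi_deriv \<alpha> p) = mi_deriv (\<alpha>(i := Suc (\<alpha> i))) p"
proof -
  obtain xs where xs: "\<And>i. count_list xs i = \<alpha> i" using ex_count_list[of \<alpha>] by blast
  have "mi_deriv (\<alpha>(i := Suc (\<alpha> i))) p = foldr partial_deriv (i # xs) p"
    by (rule mi_deriv_eq[OF assms]) (auto simp: xs)
  then show ?thesis using mi_deriv_eq[OF assms xs] by simp
qed

lemma mi_order_Suc: "mi_order (\<alpha>(i := Suc (\<alpha> i))) = Suc (mi_order \<alpha>)"
  unfolding mi_order_def by (subst (1 2) sum.remove[of _ i]) auto

lemma mi_deriv_differentiable:
  fixes p :: "real ^ 'n::finite \<Rightarrow> real"
  assumes "p \<in> polys k"
  shows "mi_deriv \<alpha> p differentiable (at x)"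
proof -
  obtain c where c: "p = (\<lambda>x. \<Sum>\<beta> | mi_order \<beta> \<le> k. c \<beta> * monomial_fun \<beta> x)"
    using assms unfolding polys_def by blast
  have "(\<lambda>x :: real ^ 'n. \<Prod>i\<in>S. (x $ i) ^ \<beta> i) differentiable (at x)" for \<beta> and S :: "'n set"
  proof (induction S rule: infinite_finite_induct)
    case (insert i S)
    have "(\<lambda>x :: real ^ 'n. x $ i) differentiable (at x)"
      by (intro bounded_linear_imp_differentiable bounded_linear_vec_nth)
    then show ?case using insert by simp
  qed auto
  moreover have "monomial_fun \<beta> = (\<lambda>x :: real ^ 'n. \<Prod>i\<in>UNIV. (x $ i) ^ \<beta> i)" for \<beta>
    by (simp add: fun_eq_iff monomial_fun_def)
  ultimately have "monomial_fun \<beta> differentiable (at x)" for \<beta> by simp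
  then show ?thesis unfolding mi_deriv_expansion[OF c]
    by (intro differentiable_sum differentiable_mult differentiable_const finite_mi_order_le) auto
qed

lemma partial_deriv_frechet:
  assumes "(f has_derivative D) (at x)"
  shows "partial_deriv i f x = D (axis i 1)"
proof -
  interpret bounded_linear D using assms by (rule has_derivative_bounded_linear)
  have "((\<lambda>t. x + t *\<^sub>R axis i 1) has_derivative (\<lambda>t. t *\<^sub>R axis i 1)) (at 0)"
    by (auto intro!: derivative_eq_intros)
  moreover have "(f has_derivative D) (at (x + 0 *\<^sub>R axis i 1))" using assms by simp
  ultimately have "((\<lambda>t. f (x + t *\<^sub>R axis i 1)) has_derivative (\<lambda>t. D (t *\<^sub>R axis i 1))) (at 0)"
    by (rule has_derivative_compose)
  moreover have eq: "(\<lambda>t. D (t *\<^sub>R axis i 1)) = (*) (D (axis i 1))" by (simp add: fun_eq_iff scaleR)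
  ultimately have "((\<lambda>t. f (x + t *\<^sub>R axis i 1)) has_field_derivative D (axis i 1)) (at 0)"
    unfolding has_field_derivative_def by simp
  then show ?thesis unfolding partial_deriv_def by (rule DERIV_imp_deriv)
qed

lemma partial_deriv_bound:
  fixes f :: "real ^ 'n::finite \<Rightarrow> real"
  assumes diff: "\<And>z. f differentiable (at z)"
    and bound: "\<And>z i. z \<in> cball x r \<Longrightarrow> \<bar>partial_deriv i f z\<bar> \<le> M"
    and "z \<in> cball x r" "M \<ge> 0"
  shows "\<bar>f z - f x\<bar> \<le> real CARD('n) * M * r"
proof -
  obtain D where D: "\<And>z. (f has_derivative D z) (at z)" using diff unfolding differentiable_def by metis
  have on: "onorm (D z) \<le> real CARD('n) * M" if z: "z \<in> cball x r" for z
  proof (rule onorm_le)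
    fix v
    interpret bounded_linear "D z" using D by (rule has_derivative_bounded_linear)
    have "D z v = (\<Sum>i\<in>UNIV. v $ i * partial_deriv i f z)"
    proof -
      have "v = (\<Sum>i\<in>UNIV. (v $ i) *\<^sub>R axis i 1)"
        using basis_expansion[of v] by (simp add: scalar_mult_eq_scaleR)
      then have "D z v = (\<Sum>i\<in>UNIV. D z ((v $ i) *\<^sub>R axis i 1))" using sum by metis
      then show ?thesis by (simp add: scaleR partial_deriv_frechet[OF D])
    qed
    then have "norm (D z v) \<le> (\<Sum>i\<in>UNIV. \<bar>v $ i * partial_deriv i f z\<bar>)" by (simp add: sum_abs)
    also have "\<dots> \<le> (\<Sum>i\<in>(UNIV :: 'n set). norm v * M)"
      unfolding abs_mult using bound[OF z] component_le_norm_cart[of v] by (intro sum_mono mult_mono) auto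
    finally show "norm (D z v) \<le> real CARD('n) * M * norm v" by (simp add: ac_simps)
  qed
  have r: "r \<ge> 0" using assms(3) by (metis mem_cball order_trans zero_le_dist)
  have "norm (f z - f x) \<le> real CARD('n) * M * norm (z - x)"
    by (rule differentiable_bound[of "cball x r" f D])
      (use D on assms(3) r in \<open>auto intro: has_derivative_at_withinI\<close>)
  also have "\<dots> \<le> real CARD('n) * M * r"
    using assms(3,4) by (intro mult_left_mono) (auto simp: dist_norm norm_minus_commute)
  finally show ?thesis by simp
qed

text \<open>Downward induction on the order: derivatives of order \<open>k\<close> are constant, and
  each lower order is controlled by the next one through the mean value inequality, at the cost of a
  factor \<open>1 + CARD('n)\<close>.\<close>

lemma taylor_bound:
  fixes x :: "real ^ 'n::finite"
  assumes p: "p \<in> polys k" and W: "W \<ge> 0"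
    and b: "\<And>\<alpha>. mi_order \<alpha> \<le> k \<Longrightarrow> \<bar>mi_deriv \<alpha> p x\<bar> \<le> W * r ^ (k - mi_order \<alpha>)"
    and "z \<in> cball x r" "mi_order \<alpha> \<le> k"
  shows "\<bar>mi_deriv \<alpha> p z\<bar> \<le> real (Suc CARD('n)) ^ k * (W * r ^ (k - mi_order \<alpha>))"
proof -
  let ?n = "real CARD('n)"
  have r: "r \<ge> 0" using assms(4) by (metis mem_cball order_trans zero_le_dist)
  have *: "\<bar>mi_deriv \<alpha> p z\<bar> \<le> (1 + ?n) ^ j * (W * r ^ j)"
    if "mi_order \<alpha> \<le> k" "k - mi_order \<alpha> = j" "z \<in> cball x r" for j \<alpha> z
    using that
  proof (induction j arbitrary: \<alpha> z)
    case 0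
    have "partial_deriv i (mi_deriv \<alpha> p) z = 0" for i z
      unfolding mi_deriv_Suc[OF p] by (rule mi_deriv_vanish[OF p]) (use 0 in \<open>simp add: mi_order_Suc\<close>)
    then have "\<bar>mi_deriv \<alpha> p z - mi_deriv \<alpha> p x\<bar> \<le> ?n * 0 * r"
      using 0(3) by (intro partial_deriv_bound mi_deriv_differentiable[OF p]) auto
    then show ?case using b[OF 0(1)] 0 by simp
  next
    case (Suc j)
    have "\<bar>partial_deriv i (mi_deriv \<alpha> p) y\<bar> \<le> (1 + ?n) ^ j * (W * r ^ j)" if "y \<in> cball x r" for i y
      unfolding mi_deriv_Suc[OF p] by (rule Suc.IH) (use Suc.prems that in \<open>simp_all add: mi_order_Suc del: fun_upd_apply\<close>)
    then have "\<bar>mi_deriv \<alpha> p z - mi_deriv \<alpha> p x\<bar> \<le> ?n * ((1 + ?n) ^ j * (W * r ^ j)) * r"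
      using Suc.prems W r by (intro partial_deriv_bound mi_deriv_differentiable[OF p]) auto
    also have "\<dots> = ?n * (1 + ?n) ^ j * (W * r ^ Suc j)" by simp
    finally have 1: "\<bar>mi_deriv \<alpha> p z - mi_deriv \<alpha> p x\<bar> \<le> ?n * (1 + ?n) ^ j * (W * r ^ Suc j)" .
    have "W * r ^ Suc j \<ge> 0" using W r by simp
    then have "1 * (W * r ^ Suc j) \<le> (1 + ?n) ^ j * (W * r ^ Suc j)" by (intro mult_right_mono one_le_power) auto
    moreover have "\<bar>mi_deriv \<alpha> p x\<bar> \<le> W * r ^ Suc j" using b[OF Suc.prems(1)] Suc.prems(2) by simp
    moreover have "(1 + ?n) ^ Suc j * (W * r ^ Suc j) =
        (1 + ?n) ^ j * (W * r ^ Suc j) + ?n * (1 + ?n) ^ j * (W * r ^ Suc j)"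
      by (simp add: algebra_simps)
    ultimately show ?case using 1 by linarith
  qed
  have "(1 + ?n) ^ (k - mi_order \<alpha>) * (W * r ^ (k - mi_order \<alpha>)) \<le> (1 + ?n) ^ k * (W * r ^ (k - mi_order \<alpha>))"
    using W r by (intro mult_right_mono power_increasing) auto
  then show ?thesis using *[OF assms(5) refl assms(4)] by simp
qed

section \<open>The jet metric\<close>

lemma mi_deriv_diff:
  assumes "p \<in> polys k" "q \<in> polys k"
  shows "mi_deriv \<alpha> (p - q) x = mi_deriv \<alpha> p x - mi_deriv \<alpha> q x"
proof -
  have "(-1) *\<^sub>R q \<in> polys k" by (rule subspace_scale[OF subspace_polys assms(2)])
  from mi_deriv_add[OF assms(1) this, of \<alpha> x] mi_deriv_scale[OF assms(2), of \<alpha> "-1" x]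
  show ?thesis by simp
qed

section \<open>Concave moduli and the functions \<open>phi\<close>\<close>

locale modulus =
  fixes \<omega> :: "real \<Rightarrow> real"
  assumes cont: "continuous_on {0..} \<omega>" and conc: "concave_on {0..} \<omega>"
    and smono: "strict_mono_on {0..} \<omega>" and zero [simp]: "\<omega> 0 = 0"
begin

lemma strict: "0 \<le> s \<Longrightarrow> s < t \<Longrightarrow> \<omega> s < \<omega> t"
  using strict_mono_onD[OF smono, of s t] by simp

lemma mono: "0 \<le> s \<Longrightarrow> s \<le> t \<Longrightarrow> \<omega> s \<le> \<omega> t"
  using strict[of s t] by (cases "s = t") auto

lemma pos: "0 < s \<Longrightarrow> 0 < \<omega> s"
  using strict[of 0 s] by simp

lemma nonneg: "0 \<le> s \<Longrightarrow> 0 \<le> \<omega> s"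
  using mono[of 0 s] by simp

lemma less_cancel: "\<omega> s < \<omega> t \<Longrightarrow> 0 \<le> t \<Longrightarrow> s < t"
  using mono[of t s] by force

lemma shrink: "0 \<le> c \<Longrightarrow> c \<le> 1 \<Longrightarrow> 0 \<le> s \<Longrightarrow> c * \<omega> s \<le> \<omega> (c * s)"
  using concave_onD[OF conc, of c 0 s] by simp

lemma dilate:
  assumes "1 \<le> c" "0 \<le> s"
  shows "\<omega> (c * s) \<le> c * \<omega> s"
  using shrink[of "1 / c" "c * s"] assms by (simp add: field_simps)

lemma subadd:
  assumes "0 \<le> s" "0 \<le> t"
  shows "\<omega> (s + t) \<le> \<omega> s + \<omega> t"
proof (cases "s + t = 0")
  case True
  then show ?thesis using nonneg assms by simp
next
  case False
  then have st: "s + t > 0" using assms by simp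
  have "s / (s + t) * \<omega> (s + t) \<le> \<omega> s" "t / (s + t) * \<omega> (s + t) \<le> \<omega> t"
    using shrink[of "s / (s + t)" "s + t"] shrink[of "t / (s + t)" "s + t"] assms st by auto
  moreover have "s / (s + t) * \<omega> (s + t) + t / (s + t) * \<omega> (s + t) = \<omega> (s + t)"
    using st by (simp add: distrib_right[symmetric] add_divide_distrib[symmetric])
  ultimately show ?thesis by linarith
qed

lemma sum_subadd:
  assumes "\<And>i. i < m \<Longrightarrow> 0 \<le> (r :: nat \<Rightarrow> real) i"
  shows "\<omega> (\<Sum>i<m. r i) \<le> (\<Sum>i<m. \<omega> (r i))"
  using assms
proof (induction m)
  case (Suc m)
  have "\<omega> (sum r {..<m} + r m) \<le> \<omega> (sum r {..<m}) + \<omega> (r m)"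
    using Suc.prems by (intro subadd sum_nonneg) auto
  then show ?case using Suc by fastforce
qed simp

lemma psi:
  assumes "mi_order \<alpha> < k" "0 \<le> t"
  shows "0 \<le> psi k \<omega> \<alpha> t" "psi k \<omega> \<alpha> t ^ (k - mi_order \<alpha>) * \<omega> (psi k \<omega> \<alpha> t) = t"
proof -
  define j where "j = k - mi_order \<alpha>"
  have j: "j \<ge> 1" using assms by (simp add: j_def)
  define f where "f s = s ^ j * \<omega> s" for s
  \<comment> \<open>Large enough for the intermediate value theorem: \<open>b \<ge> 1\<close> gives
    \<open>f b \<ge> b * \<omega> 1 \<ge> t\<close>.\<close>
  define b where "b = max 1 (t / \<omega> 1)"
  have w1: "\<omega> 1 > 0" by (rule pos) simp
  have b: "b \<ge> 1" "t \<le> b * \<omega> 1" using w1 by (auto simp: b_def pos_divide_le_eq[symmetric])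
  have "b * \<omega> 1 \<le> b ^ j * \<omega> b"
    using b(1) w1 mono[of 1 b] self_le_power[of b j] j by (intro mult_mono) auto
  then have "t \<le> f b" using b(2) by (simp add: f_def)
  moreover have "f 0 \<le> t" using assms(2) by (simp add: f_def)
  moreover have "continuous_on {0..b} f"
    unfolding f_def by (intro continuous_intros continuous_on_subset[OF cont]) auto
  ultimately obtain s where "0 \<le> s" "f s = t" using IVT'[of f 0 t b] b(1) by auto
  then have t: "t \<in> f ` {0..}" by force
  have eq: "psi k \<omega> \<alpha> t = inv_into {0..} f t"
    unfolding psi_def f_def j_def ..
  show "0 \<le> psi k \<omega> \<alpha> t" using inv_into_into[OF t] by (simp add: eq)
  show "psi k \<omega> \<alpha> t ^ (k - mi_order \<alpha>) * \<omega> (psi k \<omega> \<alpha> t) = t"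
    using f_inv_into_f[OF t] by (simp add: eq f_def j_def)
qed

lemma phi_le:
  assumes "mi_order \<alpha> \<le> k" "0 \<le> t" "0 \<le> r" "t \<le> r ^ (k - mi_order \<alpha>) * \<omega> r"
  shows "phi k \<omega> \<alpha> t \<le> \<omega> r"
proof (cases "mi_order \<alpha> < k")
  case True
  let ?s = "psi k \<omega> \<alpha> t"
  have "?s \<le> r"
  proof (rule ccontr)
    assume "\<not> ?s \<le> r"
    then have s: "r < ?s" by simp
    have "r ^ (k - mi_order \<alpha>) * \<omega> r < ?s ^ (k - mi_order \<alpha>) * \<omega> ?s"
      using s assms(3) True nonneg[OF assms(3)] strict[OF assms(3) s] power_strict_mono[OF s assms(3)]
      by (intro mult_strict_mono) auto
    then show False using psi(2)[OF True assms(2)] assms(4) by simp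
  qed
  then show ?thesis using mono psi(1)[OF True assms(2)] True by (simp add: phi_def)
next
  case False
  then show ?thesis using assms by (simp add: phi_def)
qed

text \<open>With \<open>s\<close> the value of \<open>psi\<close> at \<open>t\<close>, only the
  power of \<open>s\<close> is estimated through \<open>r\<close>; the factor
  \<open>\<omega> s\<close> keeps its own bound \<delta>. Thus the estimates for the steps of a
  chain can be added.\<close>

lemma phi_le_imp:
  assumes "mi_order \<alpha> \<le> k" "0 \<le> t" "0 \<le> r" "phi k \<omega> \<alpha> t \<le> \<delta>" "\<delta> < \<omega> r" "0 \<le> \<delta>"
  shows "t \<le> r ^ (k - mi_order \<alpha>) * \<delta>"
proof (cases "mi_order \<alpha> < k")
  case True
  let ?s = "psi k \<omega> \<alpha> t"
  have s: "\<omega> ?s \<le> \<delta>" using assms(4) True by (simp add: phi_def)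
  then have "?s \<le> r" using less_cancel[of ?s r] assms by simp
  then have "?s ^ (k - mi_order \<alpha>) * \<omega> ?s \<le> r ^ (k - mi_order \<alpha>) * \<delta>"
    using s psi(1)[OF True assms(2)] assms(3) nonneg by (intro mult_mono power_mono) auto
  then show ?thesis using psi(2)[OF True assms(2)] by simp
next
  case False
  then show ?thesis using assms by (simp add: phi_def)
qed

end

lemma mi_order_zero [simp]: "mi_order (\<lambda>_. 0) = 0"
  by (simp add: mi_order_def)

lemma jet_delta_le_iff:
  "jet_delta k \<omega> (P, x) (Q, y) \<le> d \<longleftrightarrow> \<omega> (norm (x - y)) \<le> d \<and>
    (\<forall>\<alpha>. mi_order \<alpha> \<le> k \<longrightarrow> phi k \<omega> \<alpha> \<bar>mi_deriv \<alpha> (P - Q) x\<bar> \<le> d \<and> phi k \<omega> \<alpha> \<bar>mi_deriv \<alpha> (P - Q) y\<bar> \<le> d)"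
proof -
  let ?X = "\<Union>\<alpha>\<in>{\<alpha>. mi_order \<alpha> \<le> k}. {\<omega> (norm (x - y)), phi k \<omega> \<alpha> \<bar>mi_deriv \<alpha> (P - Q) x\<bar>,
    phi k \<omega> \<alpha> \<bar>mi_deriv \<alpha> (P - Q) y\<bar>}"
  have ne: "(\<lambda>_. 0) \<in> {\<alpha>. mi_order \<alpha> \<le> k}" by simp
  have fin: "finite ?X" by (intro finite_UN_I finite_mi_order_le) auto
  have "\<omega> (norm (x - y)) \<in> ?X" using ne by blast
  then have "?X \<noteq> {}" by blast
  with fin have "Max ?X \<le> d \<longleftrightarrow> (\<forall>a\<in>?X. a \<le> d)" by (rule Max_le_iff)
  also have "\<dots> \<longleftrightarrow> \<omega> (norm (x - y)) \<le> d \<and> (\<forall>\<alpha>. mi_order \<alpha> \<le> k \<longrightarrow>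
      phi k \<omega> \<alpha> \<bar>mi_deriv \<alpha> (P - Q) x\<bar> \<le> d \<and> phi k \<omega> \<alpha> \<bar>mi_deriv \<alpha> (P - Q) y\<bar> \<le> d)"
    using ne by blast
  finally show ?thesis by (simp add: jet_delta_def)
qed

definition deriv_ball :: "nat \<Rightarrow> (real \<Rightarrow> real) \<Rightarrow> real \<Rightarrow> real ^ 'n \<Rightarrow> real \<Rightarrow> (real ^ 'n::finite \<Rightarrow> real) set"
  where "deriv_ball k \<omega> K x r =
    {u \<in> polys k. \<forall>\<alpha>. mi_order \<alpha> \<le> k \<longrightarrow> \<bar>mi_deriv \<alpha> u x\<bar> \<le> K * (r ^ (k - mi_order \<alpha>) * \<omega> r)}"

text \<open>The factor of \<open>taylor_bound\<close>, i.e. the price of moving the centre of a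
  \<open>deriv_ball\<close> by at most its radius.\<close>

definition shift_const :: "nat \<Rightarrow> 'n::finite itself \<Rightarrow> real"
  where "shift_const k _ = real (Suc CARD('n)) ^ k"

lemma shift_const_ge_1: "shift_const k TYPE('n::finite) \<ge> 1"
  by (simp add: shift_const_def one_le_power)

context modulus begin

lemma jet_delta_nonneg: "jet_delta k \<omega> S T \<ge> 0"
proof -
  have "\<omega> (norm (snd S - snd T)) \<le> jet_delta k \<omega> S T"
    using jet_delta_le_iff[of k \<omega> "fst S" "snd S" "fst T" "snd T" "jet_delta k \<omega> S T"] by simp
  then show ?thesis using nonneg[of "norm (snd S - snd T)"] by simp
qed

lemma jet_dist_le_sum:
  assumes "\<And>i. i \<le> m \<Longrightarrow> C i \<in> jets k" "C 0 = S" "C m = T"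
  shows "jet_dist k \<omega> S T \<le> (\<Sum>i<m. jet_delta k \<omega> (C i) (C (Suc i)))"
  unfolding jet_dist_def
proof (rule cInf_lower)
  show "bdd_below {\<Sum>i<m. jet_delta k \<omega> (C i) (C (Suc i)) | m C. (\<forall>i\<le>m. C i \<in> jets k) \<and> C 0 = S \<and> C m = T}"
    by (rule bdd_belowI[of _ 0]) (auto intro!: sum_nonneg jet_delta_nonneg)
qed (use assms in blast)

lemma jet_dist_le_delta:
  assumes "S \<in> jets k" "T \<in> jets k"
  shows "jet_dist k \<omega> S T \<le> jet_delta k \<omega> S T"
  using jet_dist_le_sum[of 1 "\<lambda>i. if i = 0 then S else T"] assms by simp

lemma jet_dist_self:
  assumes "S \<in> jets k"
  shows "jet_dist k \<omega> S S \<le> 0"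
  using jet_dist_le_sum[of 0 "\<lambda>_. S"] assms by simp

lemma jet_dist_chain:
  assumes "S \<in> jets k" "T \<in> jets k" "jet_dist k \<omega> S T < d"
  obtains m C where "\<And>i. i \<le> m \<Longrightarrow> C i \<in> jets k" "C 0 = S" "C m = T"
    "(\<Sum>i<m. jet_delta k \<omega> (C i) (C (Suc i))) < d"
proof -
  let ?X = "{\<Sum>i<m. jet_delta k \<omega> (C i) (C (Suc i)) | m C. (\<forall>i\<le>m. C i \<in> jets k) \<and> C 0 = S \<and> C m = T}"
  have "(\<Sum>i<(1::nat). jet_delta k \<omega> (if i = 0 then S else T) (if Suc i = 0 then S else T)) \<in> ?X"
    using assms(1,2) by (intro CollectI exI[of _ 1] exI[of _ "\<lambda>i. if i = 0 then S else T"]) auto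
  then have "?X \<noteq> {}" by blast
  then have "\<exists>s\<in>?X. s < d" using assms(3) unfolding jet_dist_def by (intro cInf_lessD)
  then show ?thesis using that by blast
qed

lemma deriv_ball_shift:
  fixes x y :: "real ^ 'n::finite"
  assumes "norm (x - y) \<le> r'" "0 \<le> r" "r \<le> r'" "0 \<le> K"
  shows "deriv_ball k \<omega> K x r \<subseteq> deriv_ball k \<omega> (shift_const k TYPE('n) * K) y r'"
proof
  fix u assume u: "u \<in> deriv_ball k \<omega> K x r"
  have W: "0 \<le> K * \<omega> r'" using assms nonneg[of r'] by simp
  have "\<bar>mi_deriv \<alpha> u x\<bar> \<le> (K * \<omega> r') * r' ^ (k - mi_order \<alpha>)" if "mi_order \<alpha> \<le> k" for \<alpha>
  proof -
    have "\<bar>mi_deriv \<alpha> u x\<bar> \<le> K * (r ^ (k - mi_order \<alpha>) * \<omega> r)" using u that by (simp add: deriv_ball_def)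
    also have "\<dots> \<le> K * (r' ^ (k - mi_order \<alpha>) * \<omega> r')"
      using assms mono[of r r'] nonneg by (intro mult_left_mono mult_mono power_mono) auto
    finally show ?thesis by (simp add: ac_simps)
  qed
  then have "\<bar>mi_deriv \<alpha> u y\<bar> \<le> shift_const k TYPE('n) * (K * \<omega> r' * r' ^ (k - mi_order \<alpha>))" if "mi_order \<alpha> \<le> k" for \<alpha>
    unfolding shift_const_def using u W assms(1) that
    by (intro taylor_bound) (auto simp: deriv_ball_def dist_norm)
  then show "u \<in> deriv_ball k \<omega> (shift_const k TYPE('n) * K) y r'"
    using u by (simp add: deriv_ball_def ac_simps)
qed

lemma deriv_ball_mono:
  assumes "K \<le> K'" "0 \<le> r"
  shows "deriv_ball k \<omega> K x r \<subseteq> deriv_ball k \<omega> K' x r"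
proof
  fix u assume u: "u \<in> deriv_ball k \<omega> K x r"
  have "K * (r ^ (k - mi_order \<alpha>) * \<omega> r) \<le> K' * (r ^ (k - mi_order \<alpha>) * \<omega> r)" for \<alpha> :: "'a \<Rightarrow> nat"
    using assms nonneg[of r] by (intro mult_right_mono) auto
  then show "u \<in> deriv_ball k \<omega> K' x r" using u order_trans by (fastforce simp: deriv_ball_def)
qed

text \<open>The powers of the radius cost at most \<open>M ^ k\<close>, and concavity allows one
  further factor \<open>M\<close> for \<omega>.\<close>

lemma deriv_ball_radius:
  assumes "0 \<le> r" "r \<le> M * \<rho>" "1 \<le> M" "0 \<le> \<rho>" "0 \<le> K"
  shows "deriv_ball k \<omega> K x r \<subseteq> deriv_ball k \<omega> (K * M ^ Suc k) x \<rho>"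
proof
  fix u assume u: "u \<in> deriv_ball k \<omega> K x r"
  have "K * (r ^ (k - mi_order \<alpha>) * \<omega> r) \<le> K * M ^ Suc k * (\<rho> ^ (k - mi_order \<alpha>) * \<omega> \<rho>)" for \<alpha> :: "'a \<Rightarrow> nat"
  proof -
    have "\<omega> r \<le> M * \<omega> \<rho>" using mono[OF assms(1,2)] dilate[OF assms(3,4)] by simp
    then have "r ^ (k - mi_order \<alpha>) * \<omega> r \<le> (M * \<rho>) ^ (k - mi_order \<alpha>) * (M * \<omega> \<rho>)"
      using assms nonneg[of r] by (intro mult_mono power_mono) auto
    also have "\<dots> = M ^ Suc (k - mi_order \<alpha>) * (\<rho> ^ (k - mi_order \<alpha>) * \<omega> \<rho>)"
      by (simp add: power_mult_distrib)
    also have "\<dots> \<le> M ^ Suc k * (\<rho> ^ (k - mi_order \<alpha>) * \<omega> \<rho>)"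
      using assms nonneg[of \<rho>] by (intro mult_right_mono power_increasing) auto
    finally have "K * (r ^ (k - mi_order \<alpha>) * \<omega> r) \<le> K * (M ^ Suc k * (\<rho> ^ (k - mi_order \<alpha>) * \<omega> \<rho>))"
      using assms(5) by (rule mult_left_mono)
    then show ?thesis by (simp only: mult.assoc)
  qed
  then show "u \<in> deriv_ball k \<omega> (K * M ^ Suc k) x \<rho>" using u order_trans by (fastforce simp: deriv_ball_def)
qed

lemma deriv_ball_scale:
  assumes "u \<in> deriv_ball k \<omega> K x r"
  shows "c *\<^sub>R u \<in> deriv_ball k \<omega> (\<bar>c\<bar> * K) x r"
proof -
  have u: "u \<in> polys k" using assms by (simp add: deriv_ball_def)
  then have "c *\<^sub>R u \<in> polys k" by (rule subspace_scale[OF subspace_polys])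
  moreover have "\<bar>mi_deriv \<alpha> (c *\<^sub>R u) x\<bar> \<le> \<bar>c\<bar> * K * (r ^ (k - mi_order \<alpha>) * \<omega> r)" if "mi_order \<alpha> \<le> k" for \<alpha>
    unfolding mi_deriv_scale[OF u] abs_mult mult.assoc
    by (rule mult_left_mono) (use assms that in \<open>auto simp: deriv_ball_def\<close>)
  ultimately show ?thesis by (simp add: deriv_ball_def)
qed

text \<open>
  A nearly optimal chain stays within distance \<open>2 r\<close> of \<open>x\<close>, since the steps \<open>\<omega> (r\<^sub>i)\<close> add up
  to less than \<open>\<omega> (2 r)\<close>; hence its increments can all be compared at \<open>x\<close>.
\<close>

lemma jet_dist_imp_deriv_ball:
  fixes x y :: "real ^ 'n::finite"
  assumes P: "P \<in> polys k" and Q: "Q \<in> polys k" and xy: "x \<noteq> y"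
    and d: "jet_dist k \<omega> (P, x) (Q, y) \<le> \<omega> (norm (x - y))"
  shows "P - Q \<in> deriv_ball k \<omega> (shift_const k TYPE('n) * 2 ^ Suc k) x (norm (x - y))"
proof -
  define r where "r = norm (x - y)"
  have r: "r > 0" using xy by (simp add: r_def)
  \<comment> \<open>The infimum need not be attained; passing from \<open>\<omega> r\<close> to the
    larger \<open>\<omega> (2 * r)\<close> leaves room for an actual chain.\<close>
  have "jet_dist k \<omega> (P, x) (Q, y) < \<omega> (2 * r)" using d strict[of r "2 * r"] r by (simp add: r_def)
  then obtain m C where C: "\<And>i. i \<le> m \<Longrightarrow> C i \<in> jets k" "C 0 = (P, x)" "C m = (Q, y)"
    "(\<Sum>i<m. jet_delta k \<omega> (C i) (C (Suc i))) < \<omega> (2 * r)"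
    using jet_dist_chain[of "(P, x)" k "(Q, y)"] P Q by (auto simp: jets_def)
  define p where "p i = fst (C i)" for i
  define z where "z i = snd (C i)" for i
  define \<delta> where "\<delta> i = jet_delta k \<omega> (C i) (C (Suc i))" for i
  have p: "p i \<in> polys k" if "i \<le> m" for i using C(1)[OF that] by (auto simp: p_def jets_def)
  have \<delta>0: "\<delta> i \<ge> 0" for i by (simp add: \<delta>_def jet_delta_nonneg)
  have \<delta>: "\<omega> (norm (z i - z (Suc i))) \<le> \<delta> i"
    "\<And>\<alpha>. mi_order \<alpha> \<le> k \<Longrightarrow> phi k \<omega> \<alpha> \<bar>mi_deriv \<alpha> (p i - p (Suc i)) (z i)\<bar> \<le> \<delta> i" for i
    using jet_delta_le_iff[of k \<omega> "p i" "z i" "p (Suc i)" "z (Suc i)" "\<delta> i"]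
    by (auto simp: \<delta>_def p_def z_def)
  have tail: "(\<Sum>j<i. \<delta> j) < \<omega> (2 * r)" if "i \<le> m" for i
  proof -
    have "(\<Sum>j<i. \<delta> j) \<le> (\<Sum>j<m. \<delta> j)" using that \<delta>0 by (intro sum_mono2) auto
    then show ?thesis using C(4) by (simp add: \<delta>_def)
  qed
  have z0: "z 0 = x" using C(2) by (simp add: z_def)
  have near: "norm (z i - x) \<le> 2 * r" if "i \<le> m" for i
  proof -
    have "(\<Sum>j<i. z j - z (Suc j)) = z 0 - z i" by (rule sum_lessThan_telescope')
    then have "norm (z i - x) \<le> (\<Sum>j<i. norm (z j - z (Suc j)))"
      using norm_sum[of "\<lambda>j. z j - z (Suc j)" "{..<i}"] z0 by (simp add: norm_minus_commute)
    then have "\<omega> (norm (z i - x)) \<le> \<omega> (\<Sum>j<i. norm (z j - z (Suc j)))" by (intro mono) auto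
    also have "\<dots> \<le> (\<Sum>j<i. \<omega> (norm (z j - z (Suc j))))" by (rule sum_subadd) simp
    also have "\<dots> \<le> (\<Sum>j<i. \<delta> j)" by (intro sum_mono \<delta>(1))
    also have "\<dots> < \<omega> (2 * r)" by (rule tail[OF that])
    finally show ?thesis using less_cancel[of "norm (z i - x)" "2 * r"] r by simp
  qed
  have \<delta>lt: "\<delta> i < \<omega> (2 * r)" if "i < m" for i
  proof -
    have "\<delta> i \<le> (\<Sum>j<Suc i. \<delta> j)" using \<delta>0 by (simp add: sum_nonneg)
    then show ?thesis using tail[of "Suc i"] that by simp
  qed
  have step: "\<bar>mi_deriv \<alpha> (p i - p (Suc i)) x\<bar> \<le> shift_const k TYPE('n) * (\<delta> i * (2 * r) ^ (k - mi_order \<alpha>))"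
    if i: "i < m" and \<alpha>: "mi_order \<alpha> \<le> k" for i \<alpha>
    unfolding shift_const_def
  proof (rule taylor_bound[OF _ \<delta>0 _ _ \<alpha>])
    show "p i - p (Suc i) \<in> polys k" using p i by (intro subspace_diff subspace_polys) auto
    show "x \<in> cball (z i) (2 * r)" using near[of i] i by (simp add: dist_norm)
    show "\<bar>mi_deriv \<alpha> (p i - p (Suc i)) (z i)\<bar> \<le> \<delta> i * (2 * r) ^ (k - mi_order \<alpha>)" if "mi_order \<alpha> \<le> k" for \<alpha>
      using phi_le_imp[OF that _ _ \<delta>(2)[OF that] \<delta>lt[OF i] \<delta>0] r by (simp add: mult.commute)
  qed
  have "\<bar>mi_deriv \<alpha> (P - Q) x\<bar> \<le> shift_const k TYPE('n) * 2 ^ Suc k * (r ^ (k - mi_order \<alpha>) * \<omega> r)"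
    if \<alpha>: "mi_order \<alpha> \<le> k" for \<alpha>
  proof -
    let ?C = "shift_const k TYPE('n)" and ?j = "k - mi_order \<alpha>"
    have C0: "?C \<ge> 0" using shift_const_ge_1[of k, where 'n = 'n] by simp
    have PQ: "P = p 0" "Q = p m" using C(2,3) by (auto simp: p_def)
    have "mi_deriv \<alpha> (P - Q) x = mi_deriv \<alpha> (p 0) x - mi_deriv \<alpha> (p m) x"
      using mi_deriv_diff[OF P Q] by (simp add: PQ)
    also have "\<dots> = (\<Sum>i<m. mi_deriv \<alpha> (p i) x - mi_deriv \<alpha> (p (Suc i)) x)"
      by (rule sum_lessThan_telescope'[symmetric])
    also have "\<dots> = (\<Sum>i<m. mi_deriv \<alpha> (p i - p (Suc i)) x)"
      using p by (intro sum.cong) (auto simp: mi_deriv_diff[of _ k])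
    finally have "\<bar>mi_deriv \<alpha> (P - Q) x\<bar> \<le> (\<Sum>i<m. \<bar>mi_deriv \<alpha> (p i - p (Suc i)) x\<bar>)"
      by (simp add: sum_abs)
    also have "\<dots> \<le> (\<Sum>i<m. ?C * (\<delta> i * (2 * r) ^ ?j))"
      using step \<alpha> by (intro sum_mono) auto
    also have "\<dots> = ?C * (2 * r) ^ ?j * (\<Sum>i<m. \<delta> i)"
      by (simp add: sum_distrib_left sum_distrib_right ac_simps)
    \<comment> \<open>The steps add up to less than
      \<open>\<omega> (2 * r) \<le> 2 * \<omega> r\<close>. Together with the power of
      \<open>2 * r\<close> this accounts for \<open>2 ^ Suc k\<close>.\<close>
    also have "\<dots> \<le> ?C * (2 * r) ^ ?j * (2 * \<omega> r)"
      using tail[of m] dilate[of 2 r] r C0 by (intro mult_left_mono) auto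
    also have "\<dots> = ?C * (2 ^ Suc ?j * (r ^ ?j * \<omega> r))" by (simp add: power_mult_distrib)
    also have "\<dots> \<le> ?C * (2 ^ Suc k * (r ^ ?j * \<omega> r))"
      using C0 r nonneg[of r] by (intro mult_left_mono mult_right_mono power_increasing) auto
    finally show ?thesis by (simp only: mult.assoc)
  qed
  moreover have "P - Q \<in> polys k" using P Q by (intro subspace_diff subspace_polys)
  ultimately show ?thesis by (simp add: deriv_ball_def r_def)
qed

text \<open>The chain of a single step is enough. Factor 1 suffices in the hypotheses because
  constants are absorbed by the scaling in \<open>LO_norm\<close>.\<close>

lemma deriv_ball_imp_jet_dist:
  assumes P: "P \<in> polys k" and Q: "Q \<in> polys k"
    and "P - Q \<in> deriv_ball k \<omega> 1 x (norm (x - y))" "P - Q \<in> deriv_ball k \<omega> 1 y (norm (x - y))"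
  shows "jet_dist k \<omega> (P, x) (Q, y) \<le> \<omega> (norm (x - y))"
proof -
  have "jet_delta k \<omega> (P, x) (Q, y) \<le> \<omega> (norm (x - y))"
    unfolding jet_delta_le_iff using assms(3,4) by (auto simp: deriv_ball_def intro!: phi_le)
  moreover have "jet_dist k \<omega> (P, x) (Q, y) \<le> jet_delta k \<omega> (P, x) (Q, y)"
    by (rule jet_dist_le_delta) (use P Q in \<open>auto simp: jets_def\<close>)
  ultimately show ?thesis by linarith
qed

section \<open>\<open>LO_norm\<close> and pairwise derivative bounds\<close>

lemma LO_norm_imp_deriv_ball:
  fixes g :: "real ^ 'n::finite \<Rightarrow> 'n jet"
  assumes "LO_norm k \<omega> S g \<le> ereal K" "K > 0" "x \<in> S" "y \<in> S" "x \<noteq> y"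
    and "g x = (P, x)" "g y = (Q, y)" "P \<in> polys k" "Q \<in> polys k"
  shows "P - Q \<in> deriv_ball k \<omega> (2 * K * (shift_const k TYPE('n) * 2 ^ Suc k)) x (norm (x - y))"
proof -
  let ?C = "shift_const k TYPE('n) * 2 ^ Suc k"
  \<comment> \<open>An admissible constant exists only above the infimum; allowing
    \<open>2 * K\<close> costs the factor 2 of the conclusion.\<close>
  have "LO_norm k \<omega> S g < ereal (2 * K)"
    using assms(1,2) by (intro le_less_trans[OF assms(1)]) simp
  then obtain c where c: "c > 0" "c < 2 * K"
    "jet_dist k \<omega> (jet_scale (inverse c) (g x)) (jet_scale (inverse c) (g y)) \<le> \<omega> (norm (x - y))"
    unfolding LO_norm_def Inf_less_iff using assms(3,4) by auto
  have "inverse c *\<^sub>R P - inverse c *\<^sub>R Q \<in> deriv_ball k \<omega> ?C x (norm (x - y))"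
    using c(3) assms by (intro jet_dist_imp_deriv_ball subspace_scale subspace_polys) (auto simp: jet_scale_def)
  from deriv_ball_scale[OF this, of c] c(1)
  have "P - Q \<in> deriv_ball k \<omega> (c * ?C) x (norm (x - y))" by (simp add: scaleR_diff_right)
  moreover have "c * ?C \<le> 2 * K * ?C"
    using c(2) shift_const_ge_1[of k, where 'n = 'n] by (intro mult_right_mono) auto
  ultimately show ?thesis
    using subsetD[OF deriv_ball_mono[of "c * ?C" "2 * K * ?C" "norm (x - y)" k x]] norm_ge_zero by blast
qed

lemma LO_norm_le:
  fixes P :: "real ^ 'n::finite \<Rightarrow> real ^ 'n \<Rightarrow> real"
  assumes P: "\<And>x. x \<in> S \<Longrightarrow> P x \<in> polys k" and M: "M > 0"
    and ball: "\<And>x y. x \<in> S \<Longrightarrow> y \<in> S \<Longrightarrow> x \<noteq> y \<Longrightarrow> P x - P y \<in> deriv_ball k \<omega> M x (norm (x - y))"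
  shows "LO_norm k \<omega> S (\<lambda>x. (P x, x)) \<le> ereal M"
proof -
  have "jet_dist k \<omega> (jet_scale (inverse M) (P x, x)) (jet_scale (inverse M) (P y, y)) \<le> \<omega> (norm (x - y))"
    if xy: "x \<in> S" "y \<in> S" for x y
  proof (cases "x = y")
    case True
    have "jet_scale (inverse M) (P x, x) \<in> jets k"
      using P xy by (auto simp: jets_def jet_scale_def intro!: subspace_scale subspace_polys)
    then show ?thesis using True jet_dist_self by simp
  next
    case False
    have 1: "inverse M *\<^sub>R P x - inverse M *\<^sub>R P y \<in> deriv_ball k \<omega> 1 x (norm (x - y))"
      using deriv_ball_scale[OF ball[OF xy False], of "inverse M"] M by (simp add: scaleR_diff_right)
    have "(- inverse M) *\<^sub>R (P y - P x) \<in> deriv_ball k \<omega> (\<bar>- inverse M\<bar> * M) y (norm (y - x))"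
      using False by (intro deriv_ball_scale ball xy) auto
    then have 2: "inverse M *\<^sub>R P x - inverse M *\<^sub>R P y \<in> deriv_ball k \<omega> 1 y (norm (x - y))"
      using M by (simp add: scaleR_diff_right norm_minus_commute)
    show ?thesis unfolding jet_scale_def prod.case
      by (intro deriv_ball_imp_jet_dist subspace_scale subspace_polys P xy 1 2)
  qed
  then show ?thesis unfolding LO_norm_def using M by (intro Inf_lower) auto
qed

text \<open>The sum of the moduli of all quotients dominates each one; pairs with
  \<open>x = y\<close> contribute 0 through division by 0.\<close>

lemma jet_Lip_finite:
  assumes "finite S" "\<And>x. x \<in> S \<Longrightarrow> P x \<in> polys k"
  shows "(\<lambda>x. (P x, x)) \<in> jet_Lip k \<omega> S"
proof -
  define q where "q = (\<lambda>(x, y). \<bar>jet_dist k \<omega> (P x, x) (P y, y) / \<omega> (norm (x - y))\<bar>)"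
  have "jet_dist k \<omega> (P x, x) (P y, y) \<le> sum q (S \<times> S) * \<omega> (norm (x - y))"
    if xy: "x \<in> S" "y \<in> S" for x y
  proof (cases "x = y")
    case True
    then show ?thesis using jet_dist_self[of "(P x, x)" k] assms(2)[OF xy(1)] by (simp add: jets_def)
  next
    case False
    then have w: "\<omega> (norm (x - y)) > 0" by (intro pos) simp
    have "q (x, y) \<le> sum q (S \<times> S)"
      using xy assms(1) by (intro member_le_sum) (auto simp: q_def)
    moreover have "jet_dist k \<omega> (P x, x) (P y, y) / \<omega> (norm (x - y)) \<le> q (x, y)"
      unfolding q_def prod.case by (rule abs_ge_self)
    ultimately have "jet_dist k \<omega> (P x, x) (P y, y) / \<omega> (norm (x - y)) \<le> sum q (S \<times> S)"
      by linarith
    then show ?thesis using w by (simp add: pos_divide_le_eq)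
  qed
  then show ?thesis unfolding jet_Lip_def using assms(2) by (auto simp: jets_def)
qed

end

section \<open>Cluster trees of finite sets\<close>

text \<open>
  Pigeonhole: some shell \<open>j r/N < dist x\<^sub>0 x \<le> (j + 1) r/N\<close> contains no point of \<open>S\<close>, and it
  separates \<open>S\<close> into two clusters whose distance is comparable with the diameter \<open>r\<close>.
\<close>

lemma finite_metric_split:
  fixes S :: "'a::metric_space set"
  assumes "finite S" "card S \<ge> 2"
  obtains S1 S2 a b r where "a \<in> S" "b \<in> S" "dist a b = r" "S = S1 \<union> S2" "S1 \<inter> S2 = {}" "S1 \<noteq> {}" "S2 \<noteq> {}" "r > 0"
    "\<And>x y. x \<in> S \<Longrightarrow> y \<in> S \<Longrightarrow> dist x y \<le> r"
    "\<And>x y. x \<in> S1 \<Longrightarrow> y \<in> S2 \<Longrightarrow> r \<le> real (card S) * dist x y"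
proof -
  define D where "D = (\<lambda>(x, y). dist x y) ` (S \<times> S)"
  have "finite D" "S \<noteq> {}" using assms by (auto simp: D_def)
  then have "D \<noteq> {}" by (auto simp: D_def)
  define r where "r = Max D"
  have le: "dist x y \<le> r" if "x \<in> S" "y \<in> S" for x y
    unfolding r_def using \<open>finite D\<close> that by (intro Max_ge) (auto simp: D_def)
  have "r \<in> D" unfolding r_def by (rule Max_in) fact+
  then obtain a b where ab: "a \<in> S" "b \<in> S" "dist a b = r" by (auto simp: D_def)
  have "S \<noteq> {a}" using assms(2) by auto
  then obtain c where c: "c \<in> S" "c \<noteq> a" using ab(1) by blast
  then have r: "r > 0" using le[OF c(1) ab(1)] by (metis less_le_trans zero_less_dist_iff)
  define N where "N = card S"
  have N: "N \<ge> 2" using assms by (simp add: N_def)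
  \<comment> \<open>The index of the shell containing \<open>x\<close>, for
    \<open>x \<noteq> a\<close>. The \<open>N - 1\<close> points other than \<open>a\<close> cannot
    meet all \<open>N\<close> shells.\<close>
  define f where "f x = nat (\<lceil>dist a x * real N / r\<rceil> - 1)" for x
  have "card (f ` (S - {a})) < N"
    using card_image_le[of "S - {a}" f] assms(1) ab(1) N by (simp add: N_def card_Diff_singleton)
  then have "\<not> {..<N} \<subseteq> f ` (S - {a})"
    using card_mono[of "f ` (S - {a})" "{..<N}"] assms(1) by auto
  then obtain j where j: "j < N" "j \<notin> f ` (S - {a})" by auto
  have gap: "dist a x \<le> real j * r / real N \<or> dist a x > real (Suc j) * r / real N" if x: "x \<in> S" for x
  proof (rule ccontr)
    assume "\<not> ?thesis"
    then have d: "real j * r / real N < dist a x" "dist a x \<le> real (Suc j) * r / real N" by auto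
    have "x \<noteq> a"
    proof
      assume "x = a"
      moreover have "0 \<le> real j * r / real N" using r by simp
      ultimately show False using d(1) by simp
    qed
    have "real j < dist a x * real N / r" "dist a x * real N / r \<le> real (Suc j)"
      using d r N by (simp_all add: field_simps)
    then have "\<lceil>dist a x * real N / r\<rceil> = int j + 1" by (intro ceiling_unique) auto
    then have "f x = j" by (simp add: f_def)
    then show False using j(2) x \<open>x \<noteq> a\<close> by blast
  qed
  define S1 where "S1 = {x \<in> S. dist a x \<le> real j * r / real N}"
  have aS1: "a \<in> S1" using ab(1) r by (simp add: S1_def)
  have bS1: "b \<in> S - S1"
  proof -
    have "real j * r < real N * r" using j(1) r by simp
    then have "real j * r / real N < r" using N by (simp add: divide_less_eq mult.commute)
    then show ?thesis using ab by (simp add: S1_def)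
  qed
  have far: "r \<le> real (card S) * dist x y" if xy: "x \<in> S1" "y \<in> S - S1" for x y
  proof -
    have "dist a x \<le> real j * r / real N" "dist a y > real (Suc j) * r / real N"
      using xy gap[of y] by (auto simp: S1_def)
    moreover have "real (Suc j) * r / real N = real j * r / real N + r / real N"
      by (simp add: add_divide_distrib distrib_right)
    moreover have "dist a y \<le> dist a x + dist x y" by (rule dist_triangle)
    ultimately have "r / real N \<le> dist x y" by linarith
    then show ?thesis using N by (simp add: N_def pos_divide_le_eq mult.commute)
  qed
  show ?thesis
  proof (rule that[of a b r S1 "S - S1"])
    show "S = S1 \<union> (S - S1)" by (auto simp: S1_def)
  qed (use ab r le far aS1 bS1 in auto)
qed

text \<open>The body of a node is compared with the pairwise constraints of the points that it
  separates. The upper comparison comes in both orders because \<open>LO_norm_le\<close> asks for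
  derivative bounds at either point.\<close>

primrec separating :: "('x \<Rightarrow> 'x \<Rightarrow> 'u set) \<Rightarrow> ('x \<Rightarrow> 'x \<Rightarrow> 'u set) \<Rightarrow> ('x, 'u) ctree \<Rightarrow> bool" where
  "separating b B (Lf x) \<longleftrightarrow> True"
| "separating b B (Nd U l r) \<longleftrightarrow> separating b B l \<and> separating b B r \<and>
    (\<forall>x\<in>leaves l. \<forall>y\<in>leaves r. b x y \<subseteq> U \<and> U \<subseteq> B x y \<and> U \<subseteq> B y x)"

context modulus begin

lemma ball_like_deriv_ball:
  assumes "K > 0" "r > 0"
  shows "ball_like (polys k) (deriv_ball k \<omega> K x r)"
  unfolding ball_like_def
proof (intro conjI ballI)
  have w: "K * (r ^ j * \<omega> r) > 0" for j using assms pos[of r] by simp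
  let ?b = "\<lambda>\<alpha>. K * (r ^ (k - mi_order \<alpha>) * \<omega> r)"
  show "deriv_ball k \<omega> K x r \<subseteq> polys k" by (auto simp: deriv_ball_def)
  show zero: "0 \<in> deriv_ball k \<omega> K x r"
  proof -
    have "(0 :: real ^ 'a \<Rightarrow> real) \<in> polys k" by (rule subspace_0[OF subspace_polys])
    moreover have "mi_deriv \<alpha> (0 :: real ^ 'a \<Rightarrow> real) x = 0" for \<alpha>
      using mi_deriv_scale[OF \<open>0 \<in> polys k\<close>, of \<alpha> 0 x] by simp
    ultimately show ?thesis using w by (simp add: deriv_ball_def less_imp_le)
  qed
  show "convex (deriv_ball k \<omega> K x r)"
  proof (rule convexI)
    fix p q and s t :: real
    assume pq: "p \<in> deriv_ball k \<omega> K x r" "q \<in> deriv_ball k \<omega> K x r" and st: "0 \<le> s" "0 \<le> t" "s + t = 1"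
    have P: "p \<in> polys k" "q \<in> polys k" "s *\<^sub>R p \<in> polys k" "t *\<^sub>R q \<in> polys k"
      using pq subspace_scale[OF subspace_polys] by (auto simp: deriv_ball_def)
    have "\<bar>mi_deriv \<alpha> (s *\<^sub>R p + t *\<^sub>R q) x\<bar> \<le> ?b \<alpha>" if "mi_order \<alpha> \<le> k" for \<alpha>
    proof -
      have "\<bar>s * mi_deriv \<alpha> p x + t * mi_deriv \<alpha> q x\<bar> \<le> s * ?b \<alpha> + t * ?b \<alpha>"
        using pq st that by (intro order_trans[OF abs_triangle_ineq] add_mono)
          (auto simp: abs_mult deriv_ball_def intro!: mult_left_mono)
      also have "\<dots> = ?b \<alpha>" using st(3) by (simp add: distrib_right[symmetric])
      finally show ?thesis
        by (simp add: mi_deriv_add[OF P(3,4)] mi_deriv_scale[OF P(1)] mi_deriv_scale[OF P(2)])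
    qed
    then show "s *\<^sub>R p + t *\<^sub>R q \<in> deriv_ball k \<omega> K x r"
      using P subspace_add[OF subspace_polys P(3,4)] by (simp add: deriv_ball_def)
  qed
  show "- u \<in> deriv_ball k \<omega> K x r" if "u \<in> deriv_ball k \<omega> K x r" for u
    using deriv_ball_scale[OF that, of "-1"] by simp
  show "\<exists>\<tau>>0. \<tau> *\<^sub>R v \<in> deriv_ball k \<omega> K x r" if v: "v \<in> polys k" for v
  proof -
    define M where "M = 1 + (\<Sum>\<alpha> | mi_order \<alpha> \<le> k. \<bar>mi_deriv \<alpha> v x\<bar> / ?b \<alpha>)"
    have nn: "\<bar>mi_deriv \<alpha> v x\<bar> / ?b \<alpha> \<ge> 0" for \<alpha> using w[of "k - mi_order \<alpha>"] by (intro divide_nonneg_pos) auto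
    then have M: "M > 0" unfolding M_def by (intro add_pos_nonneg sum_nonneg) auto
    have "\<bar>mi_deriv \<alpha> v x\<bar> \<le> M * ?b \<alpha>" if "mi_order \<alpha> \<le> k" for \<alpha>
    proof -
      have "\<bar>mi_deriv \<alpha> v x\<bar> / ?b \<alpha> \<le> (\<Sum>\<alpha> | mi_order \<alpha> \<le> k. \<bar>mi_deriv \<alpha> v x\<bar> / ?b \<alpha>)"
        using that nn by (intro member_le_sum finite_mi_order_le) auto
      then have "\<bar>mi_deriv \<alpha> v x\<bar> / ?b \<alpha> \<le> M" by (simp add: M_def)
      then show ?thesis using w[of "k - mi_order \<alpha>"] by (simp only: pos_divide_le_eq)
    qed
    then have "v \<in> deriv_ball k \<omega> (M * K) x r" using v by (simp add: deriv_ball_def mult.assoc)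
    from deriv_ball_scale[OF this, of "1 / M"] M
    have "(1 / M) *\<^sub>R v \<in> deriv_ball k \<omega> K x r" by simp
    then show ?thesis using M by (intro exI[of _ "1 / M"]) simp
  qed
qed

text \<open>With \<open>C\<close> the shift constant, a cluster \<open>S\<close> carries the ball
  about one of its points with its diameter as radius and factor \<open>C ^ card S\<close>. A child
  has fewer points, so the larger power at the parent absorbs the factor \<open>C\<close> for the
  change of centre, and the bodies nest. The last clause is the form of this nesting that passes
  through the induction. In the upper constant, one more \<open>C\<close> moves the centre to
  \<open>x\<close>, and \<open>real N ^ Suc k\<close> pays for replacing the diameter by the
  distance of separated points, at least the diameter divided by \<open>N\<close>.\<close>

lemma cluster_tree:
  fixes S :: "(real ^ 'n::finite) set"
  assumes "finite S" "S \<noteq> {}" "card S \<le> N"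
  shows "\<exists>t. leaves t = S \<and> Suc (size t) = 2 * card S \<and> nested t \<and> (\<forall>U\<in>nodes t. ball_like (polys k) U) \<and>
    separating (\<lambda>x y. deriv_ball k \<omega> 1 x (norm (x - y)))
      (\<lambda>x y. deriv_ball k \<omega> (shift_const k TYPE('n) ^ Suc N * real N ^ Suc k) x (norm (x - y))) t \<and>
    (\<forall>z R m. card S < m \<longrightarrow> (\<forall>x\<in>S. norm (x - z) \<le> R) \<longrightarrow> (\<forall>x\<in>S. \<forall>y\<in>S. norm (x - y) \<le> R) \<longrightarrow>
      fits (deriv_ball k \<omega> (shift_const k TYPE('n) ^ m) z R) t)"
  using assms
proof (induction "card S" arbitrary: S rule: less_induct)
  case less
  define C where "C = shift_const k TYPE('n)"
  have C: "C \<ge> 1" by (simp add: C_def shift_const_ge_1)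
  show ?case
  proof (cases "card S \<ge> 2")
    case False
    then have "card S = 1" using less.prems by (metis One_nat_def Suc_1 Suc_leI card_gt_0_iff le_antisym not_less_eq_eq)
    then obtain x where "S = {x}" by (auto simp: card_1_singleton_iff)
    then show ?thesis by (intro exI[of _ "Lf x"]) simp
  next
    case True
    obtain S1 S2 a b r where ab: "a \<in> S" "b \<in> S" "dist a b = r" and S: "S = S1 \<union> S2" "S1 \<inter> S2 = {}" "S1 \<noteq> {}" "S2 \<noteq> {}" "r > 0"
      "\<And>x y. x \<in> S \<Longrightarrow> y \<in> S \<Longrightarrow> dist x y \<le> r"
      "\<And>x y. x \<in> S1 \<Longrightarrow> y \<in> S2 \<Longrightarrow> r \<le> real (card S) * dist x y"
      using finite_metric_split[OF less.prems(1) True] by metis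
    have fin: "finite S1" "finite S2" using less.prems(1) S(1) by auto
    have card: "card S = card S1 + card S2" using S(1,2) fin by (simp add: card_Un_disjoint)
    have pos12: "card S1 > 0" "card S2 > 0" using S(3,4) fin by (simp_all add: card_gt_0_iff)
    have "card S1 < card S" "card S1 \<le> N" using card pos12 less.prems(3) by auto
    from less.hyps[OF this(1) fin(1) S(3) this(2)]
    obtain l where l: "leaves l = S1" "Suc (size l) = 2 * card S1" "nested l" "\<forall>U\<in>nodes l. ball_like (polys k) U"
      "separating (\<lambda>x y. deriv_ball k \<omega> 1 x (norm (x - y)))
        (\<lambda>x y. deriv_ball k \<omega> (C ^ Suc N * real N ^ Suc k) x (norm (x - y))) l"
      and l_fits: "\<forall>z R m. card S1 < m \<longrightarrow> (\<forall>x\<in>S1. norm (x - z) \<le> R) \<longrightarrow> (\<forall>x\<in>S1. \<forall>y\<in>S1. norm (x - y) \<le> R) \<longrightarrow>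
        fits (deriv_ball k \<omega> (C ^ m) z R) l"
      unfolding C_def by (elim exE conjE)
    have "card S2 < card S" "card S2 \<le> N" using card pos12 less.prems(3) by auto
    from less.hyps[OF this(1) fin(2) S(4) this(2)]
    obtain l' where l': "leaves l' = S2" "Suc (size l') = 2 * card S2" "nested l'" "\<forall>U\<in>nodes l'. ball_like (polys k) U"
      "separating (\<lambda>x y. deriv_ball k \<omega> 1 x (norm (x - y)))
        (\<lambda>x y. deriv_ball k \<omega> (C ^ Suc N * real N ^ Suc k) x (norm (x - y))) l'"
      and l'_fits: "\<forall>z R m. card S2 < m \<longrightarrow> (\<forall>x\<in>S2. norm (x - z) \<le> R) \<longrightarrow> (\<forall>x\<in>S2. \<forall>y\<in>S2. norm (x - y) \<le> R) \<longrightarrow>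
        fits (deriv_ball k \<omega> (C ^ m) z R) l'"
      unfolding C_def by (elim exE conjE)
    obtain x0 where x0: "x0 \<in> S" using less.prems(2) by blast
    define U where "U = deriv_ball k \<omega> (C ^ card S) x0 r"
    have nr: "norm (x - y) \<le> r" if "x \<in> S" "y \<in> S" for x y using S(6)[OF that] by (simp add: dist_norm)
    have "fits U l" unfolding U_def
      by (rule l_fits[rule_format]) (use card pos12 nr x0 S(1) in auto)
    moreover have "fits U l'" unfolding U_def
      by (rule l'_fits[rule_format]) (use card pos12 nr x0 S(1) in auto)
    ultimately have nest: "nested (Nd U l l')" using l l' S(2) by simp
    have ball: "ball_like (polys k) U" unfolding U_def using C S(5) by (intro ball_like_deriv_ball) auto
    have lower: "deriv_ball k \<omega> 1 x (norm (x - y)) \<subseteq> U" if "x \<in> S" "y \<in> S" for x y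
    proof -
      have "deriv_ball k \<omega> 1 x (norm (x - y)) \<subseteq> deriv_ball k \<omega> (C * 1) x0 r"
        unfolding C_def using nr x0 that by (intro deriv_ball_shift) auto
      also have "\<dots> \<subseteq> U" unfolding U_def
        using self_le_power[OF C, of "card S"] True S(5) by (intro deriv_ball_mono) auto
      finally show ?thesis .
    qed
    have upper: "U \<subseteq> deriv_ball k \<omega> (C ^ Suc N * real N ^ Suc k) x (norm (x - y))"
      if xy: "x \<in> S" "r \<le> real (card S) * norm (x - y)" for x y
    proof -
      have N: "real (card S) \<le> real N" "real N \<ge> 1" using less.prems(3) True by auto
      have "U \<subseteq> deriv_ball k \<omega> (C * C ^ card S) x r"
        unfolding U_def C_def using nr x0 xy(1) S(5) shift_const_ge_1[of k, where 'n = 'n]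
        by (intro deriv_ball_shift) auto
      also have "\<dots> \<subseteq> deriv_ball k \<omega> (C * C ^ card S * real N ^ Suc k) x (norm (x - y))"
        using xy(2) N S(5) C order_trans[OF xy(2) mult_right_mono[OF N(1) norm_ge_zero]]
        by (intro deriv_ball_radius) auto
      also have "\<dots> \<subseteq> deriv_ball k \<omega> (C ^ Suc N * real N ^ Suc k) x (norm (x - y))"
      proof (rule deriv_ball_mono)
        have "C ^ Suc (card S) \<le> C ^ Suc N" using C less.prems(3) by (intro power_increasing) auto
        then show "C * C ^ card S * real N ^ Suc k \<le> C ^ Suc N * real N ^ Suc k"
          by (intro mult_right_mono) auto
      qed simp
      finally show ?thesis .
    qed
    have sep: "r \<le> real (card S) * norm (x - y)" "r \<le> real (card S) * norm (y - x)"
      if "x \<in> S1" "y \<in> S2" for x y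
      using S(7)[OF that] by (simp_all add: dist_norm norm_minus_commute)
    have "fits (deriv_ball k \<omega> (C ^ m) z R) (Nd U l l')"
      if m: "card S < m" and z: "\<forall>x\<in>S. norm (x - z) \<le> R" and R: "\<forall>x\<in>S. \<forall>y\<in>S. norm (x - y) \<le> R" for z R m
    proof -
      have "r \<le> R" using R ab by (auto simp: dist_norm)
      have "U \<subseteq> deriv_ball k \<omega> (C * C ^ card S) z R"
        unfolding U_def C_def using x0 z \<open>r \<le> R\<close> S(5) shift_const_ge_1[of k, where 'n = 'n]
        by (intro deriv_ball_shift) auto
      also have "\<dots> \<subseteq> deriv_ball k \<omega> (C ^ m) z R"
      proof (rule deriv_ball_mono)
        have "C ^ Suc (card S) \<le> C ^ m" using C m by (intro power_increasing) auto
        then show "C * C ^ card S \<le> C ^ m" by simp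
      qed (use \<open>r \<le> R\<close> S(5) in simp)
      finally show ?thesis by simp
    qed
    moreover have "separating (\<lambda>x y. deriv_ball k \<omega> 1 x (norm (x - y)))
        (\<lambda>x y. deriv_ball k \<omega> (C ^ Suc N * real N ^ Suc k) x (norm (x - y))) (Nd U l l')"
      unfolding separating.simps
    proof (intro conjI ballI l(5) l'(5))
      fix x y assume "x \<in> leaves l" "y \<in> leaves l'"
      then have xy: "x \<in> S1" "y \<in> S2" "x \<in> S" "y \<in> S" using l(1) l'(1) S(1) by auto
      show "deriv_ball k \<omega> 1 x (norm (x - y)) \<subseteq> U" by (rule lower[OF xy(3,4)])
      show "U \<subseteq> deriv_ball k \<omega> (C ^ Suc N * real N ^ Suc k) x (norm (x - y))"
        by (rule upper[OF xy(3) sep(1)[OF xy(1,2)]])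
      show "U \<subseteq> deriv_ball k \<omega> (C ^ Suc N * real N ^ Suc k) y (norm (y - x))"
        by (rule upper[OF xy(4) sep(2)[OF xy(1,2)]])
    qed
    ultimately show ?thesis
      unfolding C_def[symmetric] using l(1,2,4) l'(1,2,4) S(1) card nest ball
      by (intro exI[of _ "Nd U l l'"] conjI allI impI) auto
  qed
qed

section \<open>Passage between tree constraints and pairwise bounds\<close>

lemma lipschitz_on_tree_lower:
  assumes "separating (\<lambda>x y. deriv_ball k \<omega> 1 x (norm (x - y))) B t" "K > 0"
    and "\<And>x y. x \<in> R \<Longrightarrow> y \<in> R \<Longrightarrow> x \<noteq> y \<Longrightarrow> P x - P y \<in> deriv_ball k \<omega> K x (norm (x - y))"
    and "nested t"
  shows "lipschitz_on_tree R K t P"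
  using assms
proof (induction t)
  case (Nd U l r)
  have "(1 / K) *\<^sub>R (P x - P y) \<in> U" if xy: "x \<in> leaves l \<inter> R" "y \<in> leaves r \<inter> R" for x y
  proof -
    have "x \<noteq> y" using xy Nd.prems(4) by auto
    then have "(1 / K) *\<^sub>R (P x - P y) \<in> deriv_ball k \<omega> (\<bar>1 / K\<bar> * K) x (norm (x - y))"
      by (intro deriv_ball_scale Nd.prems(3)) (use xy in auto)
    moreover have "deriv_ball k \<omega> 1 x (norm (x - y)) \<subseteq> U" using Nd.prems(1) xy by auto
    ultimately show ?thesis using Nd.prems(2) by auto
  qed
  then show ?case using Nd by simp
qed simp

lemma lipschitz_on_tree_upper:
  assumes "separating b (\<lambda>x y. deriv_ball k \<omega> D x (norm (x - y))) t" "K > 0"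
    and "\<forall>U\<in>nodes t. ball_like (polys k) U" "lipschitz_on_tree UNIV K t P"
    and "x \<in> leaves t" "y \<in> leaves t" "x \<noteq> y"
  shows "P x - P y \<in> deriv_ball k \<omega> (K * D) x (norm (x - y))"
  using assms
proof (induction t)
  case (Nd U l r)
  have up: "P v - P w \<in> deriv_ball k \<omega> (K * D) v (norm (v - w))"
    if "(1 / K) *\<^sub>R (P v - P w) \<in> U" "U \<subseteq> deriv_ball k \<omega> D v (norm (v - w))" for v w
    using deriv_ball_scale[of "(1 / K) *\<^sub>R (P v - P w)" k D v "norm (v - w)" K] that Nd.prems(2) by auto
  consider "x \<in> leaves l" "y \<in> leaves l" | "x \<in> leaves r" "y \<in> leaves r"
    | "x \<in> leaves l" "y \<in> leaves r" | "y \<in> leaves l" "x \<in> leaves r"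
    using Nd.prems(5,6) by auto
  then show ?case
  proof cases
    case 3
    then show ?thesis using Nd.prems by (intro up) auto
  next
    case 4
    then have "- ((1 / K) *\<^sub>R (P y - P x)) \<in> U" using Nd.prems by (auto simp: ball_like_def)
    then have "(1 / K) *\<^sub>R (P x - P y) \<in> U" by (simp add: algebra_simps)
    then show ?thesis using 4 Nd.prems by (intro up) auto
  qed (use Nd in auto)
qed simp

end

theorem theorem1p10:
  fixes k N :: nat
  assumes "k \<ge> 1"
  shows "\<exists>\<gamma>>0. \<forall>(\<omega> :: real \<Rightarrow> real) (l :: nat) (S :: (real ^ 'n::finite) set)
    (G :: real ^ 'n \<Rightarrow> (real ^ 'n \<Rightarrow> real) set) (K :: real).
      continuous_on {0..} \<omega> \<longrightarrow> concave_on {0..} \<omega> \<longrightarrow> strict_mono_on {0..} \<omega> \<longrightarrow> \<omega> 0 = 0 \<longrightarrow>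
      finite S \<longrightarrow> card S = N \<longrightarrow>
      (\<forall>x\<in>S. G x \<subseteq> polys k \<and> convex (G x) \<and> affine_dim (G x) \<le> l) \<longrightarrow>
      K > 0 \<longrightarrow>
      (\<forall>S'\<subseteq>S. card S' \<le> 2 ^ min (l + 1) (dim (polys k :: (real ^ 'n \<Rightarrow> real) set)) \<longrightarrow>
        (\<exists>g\<in>jet_Lip k \<omega> S'. selection_on S' (jet_map G) g \<and> LO_norm k \<omega> S' g \<le> ereal K)) \<longrightarrow>
      (\<exists>g\<in>jet_Lip k \<omega> S. selection_on S (jet_map G) g \<and> LO_norm k \<omega> S g \<le> ereal (\<gamma> * K))"
proof -
  obtain B :: "(real ^ 'n \<Rightarrow> real) set" where B: "finite B" "independent B" "polys k = span B"
    "card B = dim (polys k :: (real ^ 'n \<Rightarrow> real) set)"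
    by (rule polys_basis)
  interpret fin_dim "polys k" B by standard (use B in auto)
  define Q where "Q c C \<longleftrightarrow> (\<forall>(t :: (real ^ 'n, real ^ 'n \<Rightarrow> real) ctree) G l K.
    nested t \<longrightarrow> size t \<le> 2 * N \<longrightarrow> (\<forall>U\<in>nodes t. ball_like (polys k) U) \<longrightarrow>
    (\<forall>x\<in>leaves t. G x \<subseteq> polys k \<and> convex (G x) \<and> affine_dim (G x) \<le> l) \<longrightarrow>
    c = min (l + 1) (card B) \<longrightarrow> K > 0 \<longrightarrow>
    (\<forall>R\<subseteq>leaves t. card R \<le> 2 ^ c \<longrightarrow> (\<exists>P. (\<forall>x\<in>R. P x \<in> G x) \<and> lipschitz_on_tree R K t P)) \<longrightarrow>
    (\<exists>P. (\<forall>x\<in>leaves t. P x \<in> G x) \<and> lipschitz_on_tree UNIV (C * K) t P))" for c C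
  have "\<exists>C\<ge>1. Q c C" for c unfolding Q_def by (rule tree_selection)
  then obtain C where C: "\<And>c. C c \<ge> 1" and Q: "\<And>c. Q c (C c)" by metis
  \<comment> \<open>The loss in passing from \<open>LO_norm\<close> to derivative bounds;
    \<open>D\<close> below is the loss in returning from tree bodies to pairs.\<close>
  define a where "a = 2 * (shift_const k TYPE('n) * 2 ^ Suc k)"
  define D where "D = shift_const k TYPE('n) ^ Suc N * real N ^ Suc k"
  \<comment> \<open>As \<open>c \<le> card B\<close>, only finitely many constants occur; their sum
    serves every \<open>l\<close>.\<close>
  define Cs where "Cs = (\<Sum>c\<le>card B. C c)"
  \<comment> \<open>The summand 1 keeps \<gamma> positive when \<open>N = 0\<close>, where
    \<open>D = 0\<close>.\<close>
  define \<gamma> where "\<gamma> = Cs * a * (D + 1)"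
  have a: "a > 0" using shift_const_ge_1[of k, where 'n = 'n] by (simp add: a_def)
  have D: "D \<ge> 0" using shift_const_ge_1[of k, where 'n = 'n] by (simp add: D_def)
  have Cs: "C c \<le> Cs" if "c \<le> card B" for c
    unfolding Cs_def using that order_trans[OF zero_le_one C] by (intro member_le_sum) auto
  have "Cs \<ge> 1" using Cs[of 0] C[of 0] by simp
  then have \<gamma>: "\<gamma> > 0" unfolding \<gamma>_def using a D by (intro mult_pos_pos) auto
  show ?thesis
  proof (intro exI[of _ \<gamma>] conjI allI impI \<gamma>)
    fix \<omega> :: "real \<Rightarrow> real" and l and S :: "(real ^ 'n) set" and G :: "real ^ 'n \<Rightarrow> (real ^ 'n \<Rightarrow> real) set"
      and K :: real
    assume \<omega>: "continuous_on {0..} \<omega>" "concave_on {0..} \<omega>" "strict_mono_on {0..} \<omega>" "\<omega> 0 = 0"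
      and S: "finite S" "card S = N"
      and G: "\<forall>x\<in>S. G x \<subseteq> polys k \<and> convex (G x) \<and> affine_dim (G x) \<le> l"
      and K: "K > 0"
      and sub: "\<forall>S'\<subseteq>S. card S' \<le> 2 ^ min (l + 1) (dim (polys k :: (real ^ 'n \<Rightarrow> real) set)) \<longrightarrow>
        (\<exists>g\<in>jet_Lip k \<omega> S'. selection_on S' (jet_map G) g \<and> LO_norm k \<omega> S' g \<le> ereal K)"
    interpret modulus \<omega> by standard (use \<omega> in auto)
    define c where "c = min (l + 1) (card B)"
    have "\<exists>P. (\<forall>x\<in>S. P x \<in> G x) \<and>
      (\<forall>x\<in>S. \<forall>y\<in>S. x \<noteq> y \<longrightarrow> P x - P y \<in> deriv_ball k \<omega> (\<gamma> * K) x (norm (x - y)))"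
    \<comment> \<open>Every tree has a leaf, so the empty set is treated apart.\<close>
    proof (cases "S = {}")
      case False
      obtain t where t: "leaves t = S" "Suc (size t) = 2 * card S" "nested t" "\<forall>U\<in>nodes t. ball_like (polys k) U"
        "separating (\<lambda>x y. deriv_ball k \<omega> 1 x (norm (x - y))) (\<lambda>x y. deriv_ball k \<omega> D x (norm (x - y))) t"
        using cluster_tree[OF S(1) False, of N k] S(2) unfolding D_def by auto
      have "\<exists>P. (\<forall>x\<in>R. P x \<in> G x) \<and> lipschitz_on_tree R (a * K) t P" if R: "R \<subseteq> S" "card R \<le> 2 ^ c" for R
      proof -
        obtain g where g: "selection_on R (jet_map G) g" "LO_norm k \<omega> R g \<le> ereal K"
          using sub R unfolding c_def B(4) by blast
        define P where "P x = fst (g x)" for x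
        have gP: "g x = (P x, x)" "P x \<in> G x" if "x \<in> R" for x
          using g(1) that by (auto simp: selection_on_def jet_map_def P_def)
        have "lipschitz_on_tree R (a * K) t P"
        proof (rule lipschitz_on_tree_lower[OF t(5) _ _ t(3)])
          show "a * K > 0" using a K by simp
          fix x y assume xy: "x \<in> R" "y \<in> R" "x \<noteq> y"
          have "x \<in> S" "y \<in> S" using xy(1,2) R(1) by auto
          then have "P x \<in> polys k" "P y \<in> polys k"
            using subsetD[OF _ gP(2)[OF xy(1)]] subsetD[OF _ gP(2)[OF xy(2)]] G by auto
          from LO_norm_imp_deriv_ball[OF g(2) K xy gP(1)[OF xy(1)] gP(1)[OF xy(2)] this]
          show "P x - P y \<in> deriv_ball k \<omega> (a * K) x (norm (x - y))" by (simp add: a_def ac_simps)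
        qed
        then show ?thesis using gP(2) by blast
      qed
      note solvable = this
      have "\<exists>P. (\<forall>x\<in>leaves t. P x \<in> G x) \<and> lipschitz_on_tree UNIV (C c * (a * K)) t P"
        using t(3)
      proof (rule Q[of c, unfolded Q_def, rule_format])
        show "size t \<le> 2 * N" using t(2) S(2) by simp
        show "ball_like (polys k) U" if "U \<in> nodes t" for U using t(4) that by blast
        show "G x \<subseteq> polys k \<and> convex (G x) \<and> affine_dim (G x) \<le> l" if "x \<in> leaves t" for x
          using G that t(1) by simp
        show "c = min (l + 1) (card B)" by (rule c_def)
        show "0 < a * K" using a K by simp
        show "\<exists>P. (\<forall>x\<in>R. P x \<in> G x) \<and> lipschitz_on_tree R (a * K) t P"
          if "R \<subseteq> leaves t" "card R \<le> 2 ^ c" for R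
          using solvable[of R] that t(1) by simp
      qed
      then obtain P where P: "\<forall>x\<in>S. P x \<in> G x" "lipschitz_on_tree UNIV (C c * (a * K)) t P"
        using t(1) by auto
      have CaK: "C c * (a * K) > 0" using C[of c] a K by simp
      have "P x - P y \<in> deriv_ball k \<omega> (\<gamma> * K) x (norm (x - y))" if xy: "x \<in> S" "y \<in> S" "x \<noteq> y" for x y
      proof -
        have "P x - P y \<in> deriv_ball k \<omega> (C c * (a * K) * D) x (norm (x - y))"
          by (rule lipschitz_on_tree_upper[OF t(5) CaK t(4) P(2)]) (use xy t(1) in auto)
        moreover have "C c * (a * K) * D \<le> \<gamma> * K"
        proof -
          have "C c * (a * K) * D \<le> Cs * (a * K) * (D + 1)"
            using Cs[of c] a K D \<open>Cs \<ge> 1\<close> by (intro mult_mono) (auto simp: c_def)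
          then show ?thesis by (simp add: \<gamma>_def ac_simps)
        qed
        ultimately show ?thesis
          using subsetD[OF deriv_ball_mono[of "C c * (a * K) * D" "\<gamma> * K"]] norm_ge_zero by blast
      qed
      then show ?thesis using P(1) by blast
    qed simp
    then obtain P where P: "\<And>x. x \<in> S \<Longrightarrow> P x \<in> G x"
      "\<And>x y. x \<in> S \<Longrightarrow> y \<in> S \<Longrightarrow> x \<noteq> y \<Longrightarrow> P x - P y \<in> deriv_ball k \<omega> (\<gamma> * K) x (norm (x - y))"
      by blast
    have Pp: "P x \<in> polys k" if "x \<in> S" for x using P(1)[OF that] G that by blast
    have "(\<lambda>x. (P x, x)) \<in> jet_Lip k \<omega> S" by (rule jet_Lip_finite[OF S(1) Pp])
    moreover have "selection_on S (jet_map G) (\<lambda>x. (P x, x))"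
      using P(1) by (simp add: selection_on_def jet_map_def)
    moreover have "LO_norm k \<omega> S (\<lambda>x. (P x, x)) \<le> ereal (\<gamma> * K)"
      using \<gamma> K by (intro LO_norm_le Pp P(2)) auto
    ultimately show "\<exists>g\<in>jet_Lip k \<omega> S. selection_on S (jet_map G) g \<and> LO_norm k \<omega> S g \<le> ereal (\<gamma> * K)"
      by blast
  qed
qed

end
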